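(* Suppose $\Omega\subset\mathbb{R}^d$ is open and has continuous boundary, and let $1\le p\le\infty$. Then the approximative trace in $W^{1,p}(\Omega)$ is unique.
   Context: $\Omega\subset\mathbb{R}^d$ is a nonempty open set (not assumed bounded or connected), $\Gamma:=\partial\Omega$ is its topological boundary, all functions are real-valued, and $\mathcal{H}^{d-1}$ is the $(d-1)$-dimensional Hausdorff measure. Set $\Gamma_{\mathrm{loc}}:=\{z\in\Gamma : \exists r>0,\ \mathcal{H}^{d-1}(\Gamma\cap B(z,r))<\infty\}$ and $\Gamma_{\mathrm{inf}}:=\Gamma\setminus\Gamma_{\mathrm{loc}}$. $L^1_{\mathrm{loc}}(\Gamma)$ denotes the space of locally integrable functions on $\Gamma$ with respect to $\mathcal{H}^{d-1}$ (modulo $\mathcal{H}^{d-1}$-null sets); it is identified with $L^1_{\mathrm{loc}}(\Gamma_{\mathrm{loc}})$, i.e. its elements vanish $\mathcal{H}^{d-1}$-a.e. on $\Gamma_{\mathrm{inf}}$ and are integrable over every compact $K\subset\Gamma_{\mathrm{loc}}$. It carries the topology given by the seminorms $\varphi\mapsto\int_K|\varphi|\,d\mathcal{H}^{d-1}$, $K\subset\Gamma_{\mathrm{loc}}$ compact. $W^{1,p}(\Omega)\cap C(\overline\Omega)$ is the set of continuous functions on $\overline\Omega$ whose restriction to $\Omega$ is in $W^{1,p}(\Omega)$. A function $\varphi\in L^1_{\mathrm{loc}}(\Gamma)$ is an approximative trace of $u\in W^{1,p}(\Omega)$ if there is a sequence $(u_n)$ in $W^{1,p}(\Omega)\cap C(\overline\Omega)$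 with $u_n|_\Gamma\in L^1_{\mathrm{loc}}(\Gamma)$ for all $n$, $u_n\to u$ in $W^{1,p}(\Omega)$ and $u_n|_\Gamma\to\varphi$ in $L^1_{\mathrm{loc}}(\Gamma)$. The approximative trace in $W^{1,p}(\Omega)$ is called unique if the only approximative trace of the zero function in $W^{1,p}(\Omega)$ is $\varphi=0$. $\Omega$ has continuous boundary if locally at each boundary point it is the subgraph of a continuous function: for every $z\in\Gamma$ there are local orthogonal coordinates, a rectangle $R=I\times(-H,H)$ (an open neighbourhood of $z$, with $I\subset\mathbb{R}^{d-1}$ an open cube, $H>0$) and a continuous $g\colon I\to(-\frac H2,\frac H2)$ with continuous extension to $\overline I$ such that $R\cap\Omega=\{(x',t)\in R: t<g(x')\}$ and $R\cap\Gamma=\{(x',g(x')):x'\in I\}$. *)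

theory Defs
  imports "HOL-Analysis.Analysis" "HOL-Probability.Essential_Supremum"
begin

subsection \<open>Hausdorff measure\<close>

text \<open>The empty set gets weight 0 also in dimension 0, where every nonempty set has weight 1.
  The factor is the volume of the unit ball, so that in dimension \<open>DIM('a)\<close> one obtains Lebesgue
  measure.\<close>

definition hausdorff_weight :: "nat \<Rightarrow> 'a::euclidean_space set \<Rightarrow> ennreal" where
  "hausdorff_weight k U =
     (if U = {} then 0 else ennreal (unit_ball_vol (real k) * (diameter U / 2) ^ k))"

text \<open>Boundedness is required explicitly because \<^const>\<open>diameter\<close> is meaningless on unbounded sets.\<close>

definition delta_covers :: "real \<Rightarrow> 'a::euclidean_space set \<Rightarrow> (nat \<Rightarrow> 'a set) set" where
  "delta_covers \<delta> A = {C. (\<forall>i. bounded (C i) \<and> diameter (C i) \<le> \<delta>) \<and> A \<subseteq> (\<Union>i. C i)}"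

definition hausdorff_pre :: "nat \<Rightarrow> real \<Rightarrow> 'a::euclidean_space set \<Rightarrow> ennreal" where
  "hausdorff_pre k \<delta> A = (INF C\<in>delta_covers \<delta> A. \<Sum>i. hausdorff_weight k (C i))"

definition hausdorff_outer :: "nat \<Rightarrow> 'a::euclidean_space set \<Rightarrow> ennreal" where
  "hausdorff_outer k A = (SUP \<delta>\<in>{0<..}. hausdorff_pre k \<delta> A)"

definition hausdorff :: "nat \<Rightarrow> 'a::euclidean_space measure" where
  "hausdorff k = measure_of UNIV (lambda_system UNIV UNIV (hausdorff_outer k)) (hausdorff_outer k)"

lemma hausdorff_outer_empty: "hausdorff_outer k ({} :: 'a::euclidean_space set) = 0"
proof -
  have "hausdorff_pre k \<delta> ({} :: 'a set) = 0" if "\<delta> > 0" for \<delta>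
  proof -
    have "(\<lambda>i. {}) \<in> delta_covers \<delta> ({} :: 'a set)"
      using that by (simp add: delta_covers_def diameter_def)
    then have "hausdorff_pre k \<delta> ({} :: 'a set) \<le> (\<Sum>i::nat. hausdorff_weight k ({} :: 'a set))"
      unfolding hausdorff_pre_def by (rule INF_lower2) simp
    then show ?thesis by (simp add: hausdorff_weight_def)
  qed
  then show ?thesis by (simp add: hausdorff_outer_def)
qed

lemma hausdorff_pre_UN_le: "hausdorff_pre k \<delta> (\<Union>i::nat. A i) \<le> (\<Sum>i. hausdorff_pre k \<delta> (A i))"
proof (rule ennreal_le_epsilon)
  fix e :: real assume fin: "(\<Sum>i. hausdorff_pre k \<delta> (A i)) < top" and e: "0 < e"
  have "\<exists>C\<in>delta_covers \<delta> (A i).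
      (\<Sum>j. hausdorff_weight k (C j)) < hausdorff_pre k \<delta> (A i) + ennreal (e * (1/2)^Suc i)" for i
  proof -
    have "hausdorff_pre k \<delta> (A i) < top"
      using fin by (meson ennreal_suminf_lessD)
    then have "hausdorff_pre k \<delta> (A i) < hausdorff_pre k \<delta> (A i) + ennreal (e * (1/2)^Suc i)"
      using e ennreal_add_left_cancel_less[of "hausdorff_pre k \<delta> (A i)" 0 "ennreal (e * (1/2)^Suc i)"]
      by (auto simp: ennreal_less_zero_iff)
    then show ?thesis unfolding hausdorff_pre_def by (simp add: INF_less_iff)
  qed
  then obtain C where C: "\<And>i. C i \<in> delta_covers \<delta> (A i)"
    and le: "\<And>i. (\<Sum>j. hausdorff_weight k (C i j))
      < hausdorff_pre k \<delta> (A i) + ennreal (e * (1/2)^Suc i)" by metis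
  define D where "D n = case_prod C (prod_decode n)" for n
  have "D \<in> delta_covers \<delta> (\<Union>i. A i)"
  proof -
    have "x \<in> (\<Union>n. D n)" if "x \<in> A i" for x i
    proof -
      obtain j where "x \<in> C i j" using C[of i] \<open>x \<in> A i\<close> by (auto simp: delta_covers_def)
      then have "x \<in> D (prod_encode (i, j))" by (simp add: D_def)
      then show ?thesis by blast
    qed
    moreover have "bounded (D n) \<and> diameter (D n) \<le> \<delta>" for n
      using C by (auto simp: D_def delta_covers_def split: prod.split)
    ultimately show ?thesis by (auto simp: delta_covers_def)
  qed
  then have "hausdorff_pre k \<delta> (\<Union>i. A i) \<le> (\<Sum>n. hausdorff_weight k (D n))"
    unfolding hausdorff_pre_def by (rule INF_lower)
  also have "\<dots> = (\<Sum>n. case_prod (\<lambda>i j. hausdorff_weight k (C i j)) (prod_decode n))"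
    by (simp add: D_def split_beta)
  also have "\<dots> = (\<Sum>i. \<Sum>j. hausdorff_weight k (C i j))"
    by (subst suminf_ennreal_2dimen[where f="\<lambda>(i, j). hausdorff_weight k (C i j)"])
      (auto simp: split_beta comp_def)
  also have "\<dots> \<le> (\<Sum>i. hausdorff_pre k \<delta> (A i) + ennreal (e * (1/2)^Suc i))"
    using le by (intro suminf_le) (auto simp: less_imp_le)
  also have "\<dots> = (\<Sum>i. hausdorff_pre k \<delta> (A i)) + (\<Sum>i. ennreal (e * (1/2)^Suc i))"
    by (rule suminf_add[symmetric]) auto
  also have "(\<Sum>i. ennreal (e * (1/2)^Suc i)) = ennreal e"
    using e sums_mult[OF power_half_series, of e]
    by (intro suminf_ennreal_eq) auto
  finally show "hausdorff_pre k \<delta> (\<Union>i. A i) \<le> (\<Sum>i. hausdorff_pre k \<delta> (A i)) + ennreal e" .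
qed

lemma outer_measure_space_hausdorff: "outer_measure_space UNIV (hausdorff_outer k :: 'a::euclidean_space set \<Rightarrow> ennreal)"
  unfolding outer_measure_space_def
proof (intro conjI)
  show "positive UNIV (hausdorff_outer k :: 'a set \<Rightarrow> ennreal)"
    by (simp add: positive_def hausdorff_outer_empty)
  show "increasing UNIV (hausdorff_outer k :: 'a set \<Rightarrow> ennreal)"
    unfolding increasing_def hausdorff_outer_def hausdorff_pre_def
    by (intro ballI impI SUP_mono' INF_superset_mono) (auto simp: delta_covers_def)
  show "countably_subadditive UNIV (hausdorff_outer k :: 'a set \<Rightarrow> ennreal)"
    unfolding countably_subadditive_def
  proof (intro allI impI ballI)
    fix A :: "nat \<Rightarrow> 'a set"
    show "hausdorff_outer k (\<Union>i. A i) \<le> (\<Sum>i. hausdorff_outer k (A i))"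
      unfolding hausdorff_outer_def[of k "\<Union>i. A i"]
    proof (rule SUP_least)
      fix \<delta> :: real assume "\<delta> \<in> {0<..}"
      then have "(\<Sum>i. hausdorff_pre k \<delta> (A i)) \<le> (\<Sum>i. hausdorff_outer k (A i))"
        unfolding hausdorff_outer_def by (intro suminf_le SUP_upper) auto
      with hausdorff_pre_UN_le show "hausdorff_pre k \<delta> (\<Union>i. A i) \<le> (\<Sum>i. hausdorff_outer k (A i))"
        by (rule order_trans)
    qed
  qed
qed

lemma measure_space_hausdorff:
  "measure_space UNIV (lambda_system UNIV UNIV (hausdorff_outer k)) (hausdorff_outer k)"
proof -
  interpret sigma_algebra UNIV UNIV
    using sigma_algebra_Pow[of UNIV] by simp
  show ?thesis by (rule caratheodory_lemma[OF outer_measure_space_hausdorff])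
qed

lemma space_hausdorff [simp]: "space (hausdorff k) = UNIV"
  by (simp add: hausdorff_def space_measure_of_conv)

lemma sets_hausdorff: "sets (hausdorff k) = lambda_system UNIV UNIV (hausdorff_outer k)"
  unfolding hausdorff_def
  by (metis measure_space_hausdorff measure_space_def sigma_algebra.sets_measure_of_eq)

lemma emeasure_hausdorff:
  "A \<in> sets (hausdorff k) \<Longrightarrow> emeasure (hausdorff k) A = hausdorff_outer k A"
  using measure_space_hausdorff[of k] unfolding sets_hausdorff
  unfolding hausdorff_def measure_space_def by (auto intro: emeasure_measure_of_sigma)

subsection \<open>Sobolev spaces\<close>

primrec Ck :: "nat \<Rightarrow> ('a::euclidean_space \<Rightarrow> real) \<Rightarrow> bool" where
  "Ck 0 f \<longleftrightarrow> continuous_on UNIV f"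
| "Ck (Suc k) f \<longleftrightarrow>
     (\<forall>x. f differentiable at x) \<and> (\<forall>b\<in>Basis. Ck k (\<lambda>x. frechet_derivative f (at x) b))"

definition test_function :: "'a::euclidean_space set \<Rightarrow> ('a \<Rightarrow> real) \<Rightarrow> bool" where
  "test_function \<Omega> \<psi> \<longleftrightarrow>
     (\<forall>k. Ck k \<psi>) \<and> compact (closure {x. \<psi> x \<noteq> 0}) \<and> closure {x. \<psi> x \<noteq> 0} \<subseteq> \<Omega>"

definition locally_integrable :: "'a::euclidean_space measure \<Rightarrow> 'a set \<Rightarrow> ('a \<Rightarrow> real) \<Rightarrow> bool" where
  "locally_integrable M S f \<longleftrightarrow> (\<forall>K. compact K \<and> K \<subseteq> S \<longrightarrow> set_integrable M K f)"

definition has_weak_partial ::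
  "'a::euclidean_space set \<Rightarrow> ('a \<Rightarrow> real) \<Rightarrow> 'a \<Rightarrow> ('a \<Rightarrow> real) \<Rightarrow> bool" where
  "has_weak_partial \<Omega> u b v \<longleftrightarrow>
     locally_integrable lebesgue \<Omega> u \<and> locally_integrable lebesgue \<Omega> v \<and>
     (\<forall>\<psi>. test_function \<Omega> \<psi> \<longrightarrow>
        (LINT x|lebesgue_on \<Omega>. u x * frechet_derivative \<psi> (at x) b)
        = - (LINT x|lebesgue_on \<Omega>. v x * \<psi> x))"

text \<open>Weak derivatives are unique almost everywhere, so the choice does not affect the norms below.\<close>

definition weak_partial ::
  "'a::euclidean_space set \<Rightarrow> ('a \<Rightarrow> real) \<Rightarrow> 'a \<Rightarrow> ('a \<Rightarrow> real)" where
  "weak_partial \<Omega> u b = (SOME v. has_weak_partial \<Omega> u b v)"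

text \<open>Exponents range over \<^typ>\<open>ennreal\<close>, so that \<open>\<infinity>\<close> is included.\<close>

definition in_Lp :: "ennreal \<Rightarrow> 'a measure \<Rightarrow> ('a \<Rightarrow> real) \<Rightarrow> bool" where
  "in_Lp p M f \<longleftrightarrow> f \<in> borel_measurable M \<and>
     (if p = \<infinity> then esssup M (\<lambda>x. ennreal \<bar>f x\<bar>) < \<infinity>
      else integrable M (\<lambda>x. \<bar>f x\<bar> powr enn2real p))"

definition Lp_norm :: "ennreal \<Rightarrow> 'a measure \<Rightarrow> ('a \<Rightarrow> real) \<Rightarrow> real" where
  "Lp_norm p M f =
     (if p = \<infinity> then enn2real (esssup M (\<lambda>x. ennreal \<bar>f x\<bar>))
      else (LINT x|M. \<bar>f x\<bar> powr enn2real p) powr (1 / enn2real p))"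

text \<open>Elements of Sobolev spaces are represented by functions on the whole type; only their
  restriction to \<open>\<Omega>\<close> matters.\<close>

definition in_W1p :: "ennreal \<Rightarrow> 'a::euclidean_space set \<Rightarrow> ('a \<Rightarrow> real) \<Rightarrow> bool" where
  "in_W1p p \<Omega> u \<longleftrightarrow> in_Lp p (lebesgue_on \<Omega>) u \<and>
     (\<forall>b\<in>Basis. \<exists>v. has_weak_partial \<Omega> u b v \<and> in_Lp p (lebesgue_on \<Omega>) v)"

definition W1p_norm :: "ennreal \<Rightarrow> 'a::euclidean_space set \<Rightarrow> ('a \<Rightarrow> real) \<Rightarrow> real" where
  "W1p_norm p \<Omega> u = Lp_norm p (lebesgue_on \<Omega>) u
     + (\<Sum>b\<in>Basis. Lp_norm p (lebesgue_on \<Omega>) (weak_partial \<Omega> u b))"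

subsection \<open>Approximative traces\<close>

abbreviation surface_measure :: "'a::euclidean_space measure" where
  "surface_measure \<equiv> hausdorff (DIM('a) - 1)"

definition bd_loc :: "'a::euclidean_space set \<Rightarrow> 'a set" where
  "bd_loc \<Omega> = {z \<in> frontier \<Omega>. \<exists>r>0. hausdorff_outer (DIM('a) - 1) (frontier \<Omega> \<inter> ball z r) < \<infinity>}"

definition bd_inf :: "'a::euclidean_space set \<Rightarrow> 'a set" where
  "bd_inf \<Omega> = frontier \<Omega> - bd_loc \<Omega>"

text \<open>As for Sobolev functions, only the values on the boundary matter, and equality in this space is
  equality almost everywhere on the boundary.\<close>

definition L1loc_bd :: "'a::euclidean_space set \<Rightarrow> ('a \<Rightarrow> real) \<Rightarrow> bool" where
  "L1loc_bd \<Omega> \<phi> \<longleftrightarrow>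
     locally_integrable surface_measure (bd_loc \<Omega>) \<phi> \<and>
     (AE x in surface_measure. x \<in> bd_inf \<Omega> \<longrightarrow> \<phi> x = 0)"

definition L1loc_bd_tendsto ::
  "'a::euclidean_space set \<Rightarrow> (nat \<Rightarrow> 'a \<Rightarrow> real) \<Rightarrow> ('a \<Rightarrow> real) \<Rightarrow> bool" where
  "L1loc_bd_tendsto \<Omega> f \<phi> \<longleftrightarrow>
     (\<forall>K. compact K \<and> K \<subseteq> bd_loc \<Omega> \<longrightarrow>
        (\<lambda>n. LINT x:K|surface_measure. \<bar>f n x - \<phi> x\<bar>) \<longlonglongrightarrow> 0)"

definition approximative_trace ::
  "ennreal \<Rightarrow> 'a::euclidean_space set \<Rightarrow> ('a \<Rightarrow> real) \<Rightarrow> ('a \<Rightarrow> real) \<Rightarrow> bool" where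
  "approximative_trace p \<Omega> u \<phi> \<longleftrightarrow>
     in_W1p p \<Omega> u \<and> L1loc_bd \<Omega> \<phi> \<and>
     (\<exists>f :: nat \<Rightarrow> 'a \<Rightarrow> real.
        (\<forall>n. in_W1p p \<Omega> (f n) \<and> continuous_on (closure \<Omega>) (f n) \<and> L1loc_bd \<Omega> (f n)) \<and>
        (\<lambda>n. W1p_norm p \<Omega> (\<lambda>x. f n x - u x)) \<longlonglongrightarrow> 0 \<and>
        L1loc_bd_tendsto \<Omega> f \<phi>)"

definition unique_approximative_trace :: "ennreal \<Rightarrow> 'a::euclidean_space set \<Rightarrow> bool" where
  "unique_approximative_trace p \<Omega> \<longleftrightarrow>
     (\<forall>\<phi>. approximative_trace p \<Omega> (\<lambda>x. 0) \<phi> \<longrightarrow>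
        (AE x in surface_measure. x \<in> frontier \<Omega> \<longrightarrow> \<phi> x = 0))"

subsection \<open>Continuous boundary\<close>

text \<open>The hyperplane orthogonal to a basis vector \<open>e\<close> plays the role of the space of the first
  \<open>DIM('a) - 1\<close> coordinates, and \<open>x + t *\<^sub>R e\<close> that of the point \<open>(x, t)\<close>.\<close>

definition base_cube :: "'a::euclidean_space \<Rightarrow> 'a \<Rightarrow> real \<Rightarrow> 'a set" where
  "base_cube e c r = {x. x \<bullet> e = 0 \<and> (\<forall>b\<in>Basis - {e}. \<bar>x \<bullet> b - c \<bullet> b\<bar> < r)}"

text \<open>The rigid motion \<open>\<lambda>y. a + Q y\<close> maps local coordinates to points. The single function \<open>g\<close> is
  the graph function together with its continuous extension to the closed cube.\<close>

definition subgraph_near :: "'a::euclidean_space set \<Rightarrow> 'a \<Rightarrow> bool" where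
  "subgraph_near \<Omega> z \<longleftrightarrow>
     (\<exists>Q a c r H. \<exists>e\<in>Basis. \<exists>g :: 'a \<Rightarrow> real.
        let I = base_cube e c r;
            R = (\<lambda>y. a + Q y) ` {x + t *\<^sub>R e |x t. x \<in> I \<and> - H < t \<and> t < H}
        in orthogonal_transformation Q \<and> 0 < r \<and> 0 < H \<and>
           continuous_on (closure I) g \<and> (\<forall>x\<in>I. - H / 2 < g x \<and> g x < H / 2) \<and>
           z \<in> R \<and>
           R \<inter> \<Omega> = (\<lambda>y. a + Q y) ` {x + t *\<^sub>R e |x t. x \<in> I \<and> - H < t \<and> t < H \<and> t < g x} \<and>
           R \<inter> frontier \<Omega> = (\<lambda>y. a + Q y) ` {x + g x *\<^sub>R e |x. x \<in> I})"

definition continuous_boundary :: "'a::euclidean_space set \<Rightarrow> bool" where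
  "continuous_boundary \<Omega> \<longleftrightarrow> (\<forall>z\<in>frontier \<Omega>. subgraph_near \<Omega> z)"

end

theory Submission
  imports Defs "HOL-Probability.Conditional_Expectation"
begin

text \<open>In local coordinates the boundary is a graph over a hyperplane and \<open>\<Omega>\<close> lies below it. A
  subsequence of the approximating functions \<open>u\<^sub>n\<close> has summable norms, so on almost every line parallel to
  a coordinate axis it converges to 0 uniformly, including the boundary points at which the line
  leaves \<open>\<Omega>\<close>. Hence the set \<open>E\<close> of boundary points at which \<open>u\<^sub>n\<close> does not tend to 0 is avoided by
  almost every coordinate line crossing the boundary; all those lines cross in the complement \<open>B\<close> of
  \<open>E\<close>. Suppose \<open>E\<close> has positive surface measure. Then \<open>B\<close> has positive density at the
  points of \<open>E\<close>: where both \<open>\<Omega>\<close> and its complement are thick in small cubes this is the relative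
  isoperimetric inequality together with a projection estimate, and where one of them is thin it
  follows by applying the same argument in a horizontal slice and integrating over the slices with
  Eilenberg's inequality. But the measure of \<open>B\<close> near a compact subset of \<open>E\<close> is arbitrarily small,
  a contradiction. So \<open>u\<^sub>n\<close> tends to 0 almost everywhere on the boundary, without any regularity of
  the graph.\<close>

subsection \<open>Hausdorff measure\<close>

text \<open>Lines along \<open>e\<close> alone do not suffice: a continuous graph can carry positive
  surface measure over a null set of base points, as the graph of the Cantor function does in the
  plane, and almost every vertical line misses that part. Lines in all coordinate directions do not
  settle the matter at once either, since in general a set of positive surface measure may project
  to null sets on all coordinate hyperplanes. So \<open>E\<close> is never estimated by its own
  projections. What is used is that the boundary separates \<open>\<Omega>\<close> from its
  complement: this forces the projections of \<open>B\<close> to be large, and they bound its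
  measure from below. The isoperimetric inequality says too little where one side fills a small
  fraction of a cube, as at a cusp; there it helps that the thin side still contains an open
  vertical segment issuing from the point. \<open>B\<close> becomes small near a compact subset of
  \<open>E\<close> by continuity from above, which needs finite measure and confines the argument to
  \<open>bd_loc\<close>. The exponent \<open>p\<close> enters only through the passage from
  \<open>L^p\<close> to \<open>L^1\<close> on bounded sets.\<close>

lemma hausdorff_pre_mono: "A \<subseteq> B \<Longrightarrow> hausdorff_pre k \<delta> A \<le> hausdorff_pre k \<delta> B"
  unfolding hausdorff_pre_def by (rule INF_superset_mono) (auto simp: delta_covers_def)

lemma hausdorff_pre_antimono: "\<delta> \<le> \<delta>' \<Longrightarrow> hausdorff_pre k \<delta>' A \<le> hausdorff_pre k \<delta> A"
  unfolding hausdorff_pre_def by (rule INF_superset_mono) (auto simp: delta_covers_def intro: order_trans)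

lemma hausdorff_pre_le_outer: "\<delta> > 0 \<Longrightarrow> hausdorff_pre k \<delta> A \<le> hausdorff_outer k A"
  unfolding hausdorff_outer_def by (rule SUP_upper) simp

lemma hausdorff_outer_mono: "A \<subseteq> B \<Longrightarrow> hausdorff_outer k A \<le> hausdorff_outer k B"
  unfolding hausdorff_outer_def by (intro SUP_mono') (rule hausdorff_pre_mono)

lemma hausdorff_outer_UN_le: "hausdorff_outer k (\<Union>i::nat. A i) \<le> (\<Sum>i. hausdorff_outer k (A i))"
  unfolding hausdorff_outer_def[of k "\<Union>i. A i"]
proof (rule SUP_least)
  fix \<delta> :: real assume "\<delta> \<in> {0<..}"
  then have "(\<Sum>i. hausdorff_pre k \<delta> (A i)) \<le> (\<Sum>i. hausdorff_outer k (A i))"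
    by (intro suminf_le hausdorff_pre_le_outer) auto
  with hausdorff_pre_UN_le show "hausdorff_pre k \<delta> (\<Union>i. A i) \<le> (\<Sum>i. hausdorff_outer k (A i))"
    by (rule order_trans)
qed

lemma hausdorff_weight_empty [simp]: "hausdorff_weight k {} = 0"
  by (simp add: hausdorff_weight_def)

lemma hausdorff_pre_le_weight:
  assumes "bounded C" "diameter C \<le> \<delta>"
  shows "hausdorff_pre k \<delta> C \<le> hausdorff_weight k C"
proof -
  have "0 \<le> \<delta>" using assms diameter_ge_0 by fastforce
  then have "(\<lambda>i::nat. if i = 0 then C else {}) \<in> delta_covers \<delta> C"
    using assms by (auto simp: delta_covers_def)
  then have "hausdorff_pre k \<delta> C \<le> (\<Sum>i::nat. hausdorff_weight k (if i = 0 then C else {}))"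
    unfolding hausdorff_pre_def by (rule INF_lower)
  also have "\<dots> = (\<Sum>i\<in>{0::nat}. hausdorff_weight k (if i = 0 then C else {}))"
    by (rule suminf_finite) auto
  finally show ?thesis by simp
qed

lemma hausdorff_pre_empty: "0 \<le> \<delta> \<Longrightarrow> hausdorff_pre k \<delta> {} = 0"
  using hausdorff_pre_le_weight[of "{}" \<delta> k] by simp

text \<open>Vitali's lemma delivers balls indexed by an arbitrary countable set, not by
  \<open>nat\<close>. Sums over such sets are therefore written as integrals with respect to
  \<open>count_space\<close>, here and below.\<close>

lemma hausdorff_pre_UN_countable_le:
  assumes I: "countable I" and "0 \<le> \<delta>"
  shows "hausdorff_pre k \<delta> (\<Union>i\<in>I. A i) \<le> (\<integral>\<^sup>+i. hausdorff_pre k \<delta> (A i) \<partial>count_space I)"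
proof -
  let ?N = "to_nat_on I ` I"
  have bij: "bij_betw (to_nat_on I) I ?N"
    using I by (simp add: bij_betw_def inj_on_to_nat_on)
  define A' where "A' n = (if n \<in> ?N then A (from_nat_into I n) else {})" for n
  have "(\<Union>i\<in>I. A i) \<subseteq> (\<Union>n. A' n)"
  proof
    fix x assume "x \<in> (\<Union>i\<in>I. A i)"
    then obtain i where "i \<in> I" "x \<in> A i" by auto
    then have "x \<in> A' (to_nat_on I i)" using I by (simp add: A'_def)
    then show "x \<in> (\<Union>n. A' n)" by blast
  qed
  then have "hausdorff_pre k \<delta> (\<Union>i\<in>I. A i) \<le> hausdorff_pre k \<delta> (\<Union>n. A' n)"
    by (rule hausdorff_pre_mono)
  also have "\<dots> \<le> (\<Sum>n. hausdorff_pre k \<delta> (A' n))" by (rule hausdorff_pre_UN_le)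
  also have "\<dots> = (\<integral>\<^sup>+n. hausdorff_pre k \<delta> (A' n) \<partial>count_space UNIV)"
    by (rule nn_integral_count_space_nat[symmetric])
  also have "\<dots> = (\<integral>\<^sup>+n. hausdorff_pre k \<delta> (A' n) * indicator ?N n \<partial>count_space UNIV)"
    by (intro nn_integral_cong) (auto simp: A'_def hausdorff_pre_empty[OF \<open>0 \<le> \<delta>\<close>] indicator_def)
  also have "\<dots> = (\<integral>\<^sup>+n. hausdorff_pre k \<delta> (A' n) \<partial>count_space ?N)"
    by (simp add: nn_integral_count_space_indicator)
  also have "\<dots> = (\<integral>\<^sup>+i. hausdorff_pre k \<delta> (A' (to_nat_on I i)) \<partial>count_space I)"
    by (rule nn_integral_bij_count_space[OF bij, symmetric])
  also have "\<dots> = (\<integral>\<^sup>+i. hausdorff_pre k \<delta> (A i) \<partial>count_space I)"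
    using I by (intro nn_integral_cong) (auto simp: A'_def)
  finally show ?thesis .
qed

text \<open>A set of diameter below \<open>d\<close> cannot meet both \<open>A\<close> and
  \<open>B\<close>, so at small scales every cover of the union splits into a cover of
  \<open>A\<close> and a cover of \<open>B\<close>.\<close>

lemma hausdorff_outer_separated:
  assumes d: "d > 0" and sep: "\<And>x y. x \<in> A \<Longrightarrow> y \<in> B \<Longrightarrow> d \<le> dist x y"
  shows "hausdorff_outer k A + hausdorff_outer k B \<le> hausdorff_outer k (A \<union> B)"
proof -
  have *: "hausdorff_pre k \<delta> A + hausdorff_pre k \<delta> B \<le> hausdorff_outer k (A \<union> B)"
    if \<delta>: "0 < \<delta>" "\<delta> < d" for \<delta>
  proof -
    have "hausdorff_pre k \<delta> A + hausdorff_pre k \<delta> B \<le> hausdorff_pre k \<delta> (A \<union> B)"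
      unfolding hausdorff_pre_def[of k \<delta> "A \<union> B"]
    proof (rule INF_greatest)
      fix C assume C: "C \<in> delta_covers \<delta> (A \<union> B)"
      define C1 where "C1 i = (if C i \<inter> A = {} then {} else C i)" for i
      define C2 where "C2 i = (if C i \<inter> B = {} then {} else C i)" for i
      have 1: "C1 \<in> delta_covers \<delta> A" "C2 \<in> delta_covers \<delta> B"
        using C \<delta> by (fastforce simp: C1_def C2_def delta_covers_def)+
      have "C i \<inter> A = {} \<or> C i \<inter> B = {}" for i
      proof (rule ccontr)
        assume "\<not> ?thesis"
        then obtain x y where xy: "x \<in> C i" "x \<in> A" "y \<in> C i" "y \<in> B" by auto
        then have "dist x y \<le> \<delta>"
          using C diameter_bounded_bound[of "C i" x y] by (auto simp: delta_covers_def intro: order_trans)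
        with sep[of x y] xy \<delta> show False by auto
      qed
      then have le: "hausdorff_weight k (C1 i) + hausdorff_weight k (C2 i) \<le> hausdorff_weight k (C i)" for i
        by (auto simp: C1_def C2_def)
      have "hausdorff_pre k \<delta> A + hausdorff_pre k \<delta> B
          \<le> (\<Sum>i. hausdorff_weight k (C1 i)) + (\<Sum>i. hausdorff_weight k (C2 i))"
        unfolding hausdorff_pre_def using 1 by (intro add_mono INF_lower)
      also have "\<dots> = (\<Sum>i. hausdorff_weight k (C1 i) + hausdorff_weight k (C2 i))"
        by (rule suminf_add) auto
      also have "\<dots> \<le> (\<Sum>i. hausdorff_weight k (C i))"
        using le by (intro suminf_le) auto
      finally show "hausdorff_pre k \<delta> A + hausdorff_pre k \<delta> B \<le> (\<Sum>i. hausdorff_weight k (C i))" .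
    qed
    also have "\<dots> \<le> hausdorff_outer k (A \<union> B)" using \<delta> by (intro hausdorff_pre_le_outer)
    finally show ?thesis .
  qed
  \<comment> \<open>The two suprema over scales are taken independently, so a bound for two
    different scales is needed; it follows from a common finer one.\<close>
  have **: "hausdorff_pre k \<delta> A + hausdorff_pre k \<delta>' B \<le> hausdorff_outer k (A \<union> B)"
    if "0 < \<delta>" "0 < \<delta>'" for \<delta> \<delta>'
  proof -
    define \<epsilon> where "\<epsilon> = min (min \<delta> \<delta>') (d / 2)"
    have \<epsilon>: "0 < \<epsilon>" "\<epsilon> < d" "\<epsilon> \<le> \<delta>" "\<epsilon> \<le> \<delta>'" using that d by (auto simp: \<epsilon>_def)
    then have "hausdorff_pre k \<delta> A + hausdorff_pre k \<delta>' B \<le> hausdorff_pre k \<epsilon> A + hausdorff_pre k \<epsilon> B"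
      by (intro add_mono hausdorff_pre_antimono) auto
    with *[of \<epsilon>] \<epsilon> show ?thesis by (meson order_trans)
  qed
  have ne: "{0::real<..} \<noteq> {}" by (auto intro: exI[of _ 1])
  have "hausdorff_outer k A + hausdorff_outer k B
      = (SUP \<delta>\<in>{0<..}. hausdorff_pre k \<delta> A + hausdorff_outer k B)"
    using ne by (subst ennreal_SUP_add_left) (auto simp: hausdorff_outer_def)
  also have "\<dots> \<le> hausdorff_outer k (A \<union> B)"
  proof (rule SUP_least)
    fix \<delta> :: real assume "\<delta> \<in> {0<..}"
    have "hausdorff_pre k \<delta> A + hausdorff_outer k B
        = (SUP \<delta>'\<in>{0<..}. hausdorff_pre k \<delta> A + hausdorff_pre k \<delta>' B)"
      unfolding hausdorff_outer_def[of k B]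
      by (simp only: add.commute[of "hausdorff_pre k \<delta> A"] ennreal_SUP_add_left[OF ne])
    also have "\<dots> \<le> hausdorff_outer k (A \<union> B)"
      using \<open>\<delta> \<in> {0<..}\<close> by (intro SUP_least **) auto
    finally show "hausdorff_pre k \<delta> A + hausdorff_outer k B \<le> hausdorff_outer k (A \<union> B)" .
  qed
  finally show ?thesis .
qed

section \<open>Borel sets are Hausdorff measurable\<close>

lemma hausdorff_outer_Un_le: "hausdorff_outer k (A \<union> B) \<le> hausdorff_outer k A + hausdorff_outer k B"
proof -
  have "hausdorff_outer k (\<Union>i::nat. if i = 0 then A else if i = 1 then B else {})
     \<le> (\<Sum>i::nat. hausdorff_outer k (if i = 0 then A else if i = 1 then B else {}))"
    by (rule hausdorff_outer_UN_le)
  also have "\<dots> = (\<Sum>i\<in>{0,1::nat}. hausdorff_outer k (if i = 0 then A else if i = 1 then B else {}))"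
    by (rule suminf_finite) (auto simp: hausdorff_outer_empty)
  also have "(\<Union>i::nat. if i = 0 then A else if i = 1 then B else {}) = A \<union> B"
    by (auto split: if_splits)
  finally show ?thesis by simp
qed

text \<open>Caratheodory's criterion: the shells at distance about \<open>1/n\<close> from a closed set are separated
  every second step, so their tails carry arbitrarily little of the outer measure.\<close>

lemma closed_in_sets_hausdorff:
  fixes F :: "'a::euclidean_space set"
  assumes F: "closed F"
  shows "F \<in> sets (hausdorff k)"
proof (cases "F = {}")
  case False
  note ne = this
  have main: "hausdorff_outer k (F \<inter> X) + hausdorff_outer k (X - F) \<le> hausdorff_outer k X" for X
  proof (cases "hausdorff_outer k X = \<infinity>")
    case fin: False
    define a where "a n = 1 / real (Suc n)" for n
    have a_pos: "0 < a n" for n by (simp add: a_def)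
    have a_less: "i < j \<Longrightarrow> a j < a i" for i j by (simp add: a_def frac_less2)
    have a_le: "i \<le> j \<Longrightarrow> a j \<le> a i" for i j by (simp add: a_def frac_le)
    have a0: "\<exists>n. a n \<le> y" if "0 < y" for y
      using nat_approx_posE[OF that] unfolding a_def by (metis less_imp_le)
    define Xn where "Xn n = {x\<in>X. a n \<le> infdist x F}" for n
    define R where "R n = {x\<in>X. a (Suc n) \<le> infdist x F \<and> infdist x F < a n}" for n
    let ?f = "\<lambda>n. hausdorff_outer k (R n)"
    have lip: "u - v \<le> dist x y" if "u \<le> infdist x F" "infdist y F \<le> v" for x y u v
      using infdist_triangle_abs[of x F y] that by linarith
    \<comment> \<open>\<open>p\<close> is a parity. Between two shells of the same parity lies a
      whole shell, whence the gap \<open>a (2*N+p-1) - a (2*N+p)\<close>; adding both parities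
      bounds the full series by twice the measure of \<open>X\<close>.\<close>
    have sep: "(\<Sum>i<N. ?f (2*i+p)) \<le> hausdorff_outer k (\<Union>i<N. R (2*i+p))" for N p
    proof (induction N)
      case (Suc N)
      show ?case
      \<comment> \<open>A single shell needs no separation, and for \<open>p = 0\<close> the index
        \<open>2*N+p-1\<close> would be truncated.\<close>
      proof (cases "N = 0")
        case False
        have "(\<Sum>i<Suc N. ?f (2*i+p)) \<le> hausdorff_outer k (\<Union>i<N. R (2*i+p)) + ?f (2*N+p)"
          using Suc by (simp add: add_mono)
        also have "\<dots> \<le> hausdorff_outer k ((\<Union>i<N. R (2*i+p)) \<union> R (2*N+p))"
        proof (rule hausdorff_outer_separated)
          show "0 < a (2*N+p-1) - a (2*N+p)" using False a_less[of "2*N+p-1" "2*N+p"] by simp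
          fix x y assume "x \<in> (\<Union>i<N. R (2*i+p))" and y: "y \<in> R (2*N+p)"
          then obtain i where i: "i < N" "x \<in> R (2*i+p)" by auto
          then have "a (2*N+p-1) \<le> infdist x F"
            using a_le[of "Suc (2*i+p)" "2*N+p-1"] by (simp add: R_def) linarith
          with y show "a (2*N+p-1) - a (2*N+p) \<le> dist x y"
            by (intro lip) (auto simp: R_def)
        qed
        also have "(\<Union>i<N. R (2*i+p)) \<union> R (2*N+p) = (\<Union>i<Suc N. R (2*i+p))"
          by (auto simp: less_Suc_eq)
        finally show ?thesis .
      qed (simp add: lessThan_Suc)
    qed simp
    have sepX: "(\<Sum>i<N. ?f (2*i+p)) \<le> hausdorff_outer k X" for N p
      by (rule order_trans[OF sep hausdorff_outer_mono]) (auto simp: R_def)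
    have "(\<Sum>n<N. ?f n) \<le> 2 * hausdorff_outer k X" for N
    proof -
      have "(\<Sum>n<N. ?f n) \<le> (\<Sum>n<2*N. ?f n)" by (rule sum_mono2) auto
      also have "(\<Sum>n<2*N. ?f n) = (\<Sum>i<N. ?f (2*i+0)) + (\<Sum>i<N. ?f (2*i+1))"
        by (induction N) (auto simp: algebra_simps)
      also have "\<dots> \<le> hausdorff_outer k X + hausdorff_outer k X" by (intro add_mono sepX)
      finally show ?thesis by (simp add: mult_2)
    qed
    then have "(\<Sum>n. ?f n) \<le> 2 * hausdorff_outer k X"
      by (intro suminf_le_const) auto
    also have "\<dots> < \<infinity>" using fin by (simp add: ennreal_mult_less_top less_top)
    finally have sfin: "(\<Sum>n. ?f n) < \<infinity>" .
    define q where "q n = enn2real (?f n)" for n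
    have fq: "?f n = ennreal (q n)" for n
      using sfin ennreal_suminf_lessD[of ?f \<infinity> n] by (simp add: q_def less_top)
    have q0: "0 \<le> q n" for n by (simp add: q_def)
    have "summable q" using sfin q0 by (intro summable_suminf_not_top) (auto simp: fq)
    show ?thesis
    proof (rule ennreal_le_epsilon)
      fix e :: real assume "0 < e"
      then obtain N where N: "norm (\<Sum>i. q (i + N)) < e"
        using suminf_exist_split[OF _ \<open>summable q\<close>] by blast
      have "(\<Sum>i. ?f (i + N)) = ennreal (\<Sum>i. q (i + N))"
        unfolding fq using q0 \<open>summable q\<close> by (intro suminf_ennreal2) (auto simp: summable_iff_shift)
      also have "\<dots> \<le> ennreal e" using N by (intro ennreal_leI) auto
      finally have tail: "(\<Sum>i. ?f (i + N)) \<le> ennreal e" .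
      have "X - F \<subseteq> Xn N \<union> (\<Union>i. R (i + N))"
      proof
        fix x assume x: "x \<in> X - F"
        then have "infdist x F > 0" using F ne
          by (metis DiffD2 in_closed_iff_infdist_zero infdist_nonneg less_eq_real_def)
        then obtain n where "a n \<le> infdist x F" using a0 by blast
        define n0 where "n0 = (LEAST n. a n \<le> infdist x F)"
        have n0: "a n0 \<le> infdist x F" unfolding n0_def by (rule LeastI) fact
        have n0': "infdist x F < a n" if "n < n0" for n
          using not_less_Least[OF that[unfolded n0_def]] by auto
        show "x \<in> Xn N \<union> (\<Union>i. R (i + N))"
        proof (cases "n0 \<le> N")
          case True
          then have "x \<in> Xn N" using x n0 a_le[of n0 N] by (auto simp: Xn_def)
          then show ?thesis by simp
        next
          case False
          then have "x \<in> R ((n0 - 1 - N) + N)" using x n0 n0'[of "n0 - 1"] by (auto simp: R_def)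
          then show ?thesis by blast
        qed
      qed
      then have "hausdorff_outer k (X - F) \<le> hausdorff_outer k (Xn N) + hausdorff_outer k (\<Union>i. R (i + N))"
        by (meson hausdorff_outer_mono hausdorff_outer_Un_le order_trans)
      also have "\<dots> \<le> hausdorff_outer k (Xn N) + ennreal e"
        by (intro add_left_mono order_trans[OF hausdorff_outer_UN_le tail])
      finally have "hausdorff_outer k (F \<inter> X) + hausdorff_outer k (X - F)
          \<le> hausdorff_outer k (F \<inter> X) + hausdorff_outer k (Xn N) + ennreal e"
        by (simp add: add.assoc add_left_mono)
      also have "hausdorff_outer k (F \<inter> X) + hausdorff_outer k (Xn N) \<le> hausdorff_outer k ((F \<inter> X) \<union> Xn N)"
      proof (rule hausdorff_outer_separated[OF a_pos])
        fix x y assume "x \<in> F \<inter> X" "y \<in> Xn N"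
        then have "a N - 0 \<le> dist y x" by (intro lip) (auto simp: Xn_def)
        then show "a N \<le> dist x y" by (simp add: dist_commute)
      qed
      also have "\<dots> \<le> hausdorff_outer k X" by (rule hausdorff_outer_mono) (auto simp: Xn_def)
      finally show "hausdorff_outer k (F \<inter> X) + hausdorff_outer k (X - F) \<le> hausdorff_outer k X + ennreal e"
        by (simp add: add_right_mono)
    qed
  qed simp
  have "hausdorff_outer k (F \<inter> X) + hausdorff_outer k (X - F) = hausdorff_outer k X" for X
  proof (rule antisym[OF main])
    have "X = (F \<inter> X) \<union> (X - F)" by auto
    then show "hausdorff_outer k X \<le> hausdorff_outer k (F \<inter> X) + hausdorff_outer k (X - F)"
      by (metis hausdorff_outer_Un_le)
  qed
  then show ?thesis
    by (auto simp: sets_hausdorff lambda_system_def Int_commute Diff_eq)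
qed simp

lemma borel_sets_hausdorff: "A \<in> sets borel \<Longrightarrow> A \<in> sets (hausdorff k)"
proof -
  have "sigma_sets UNIV {S::'a set. closed S} \<subseteq> sets (hausdorff k)"
    using closed_in_sets_hausdorff sets.sigma_sets_subset[of "{S::'a set. closed S}" "hausdorff k"] by auto
  then show "A \<in> sets borel \<Longrightarrow> A \<in> sets (hausdorff k)"
    by (auto simp: borel_eq_closed)
qed

lemma null_sets_hausdorff: "hausdorff_outer k N = 0 \<Longrightarrow> N \<in> null_sets (hausdorff k)"
proof -
  assume N: "hausdorff_outer k N = 0"
  have "hausdorff_outer k (N \<inter> X) + hausdorff_outer k (X - N) = hausdorff_outer k X" for X
  proof -
    have 1: "hausdorff_outer k (N \<inter> X) = 0"
      using N hausdorff_outer_mono[of "N \<inter> X" N k] by auto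
    have "hausdorff_outer k X \<le> hausdorff_outer k (N \<inter> X) + hausdorff_outer k (X - N)"
      by (rule order_trans[OF hausdorff_outer_mono hausdorff_outer_Un_le]) auto
    with 1 hausdorff_outer_mono[of "X - N" X k] show ?thesis by auto
  qed
  then have "N \<in> sets (hausdorff k)"
    by (auto simp: sets_hausdorff lambda_system_def Int_commute Diff_eq)
  with N show ?thesis by (simp add: null_sets_def emeasure_hausdorff)
qed

text \<open>An inequality is enough, as the inverse of a rigid motion is again an isometry: the
  lemma is applied to a rigid motion and to its inverse.\<close>

lemma hausdorff_outer_isometry:
  fixes T :: "'a::euclidean_space \<Rightarrow> 'a"
  assumes T: "\<And>x y. dist (T x) (T y) = dist x y"
  shows "hausdorff_outer k (T ` A) \<le> hausdorff_outer k A"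
  unfolding hausdorff_outer_def
proof (intro SUP_mono')
  fix \<delta> :: real
  show "hausdorff_pre k \<delta> (T ` A) \<le> hausdorff_pre k \<delta> A"
    unfolding hausdorff_pre_def[of k \<delta> A]
  proof (rule INF_greatest)
    fix C assume C: "C \<in> delta_covers \<delta> A"
    have d: "bounded (T ` C i)" "diameter (T ` C i) \<le> diameter (C i)" for i
    proof -
      have b: "bounded (C i)" using C by (auto simp: delta_covers_def)
      have *: "dist x y \<le> diameter (C i)" if "x \<in> T ` C i" "y \<in> T ` C i" for x y
        using that b T diameter_bounded_bound by fastforce
      show "bounded (T ` C i)"
        using b T unfolding bounded_def by (metis imageE)
      show "diameter (T ` C i) \<le> diameter (C i)"
        using * b by (intro diameter_le) (auto simp: dist_norm diameter_ge_0)
    qed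
    then have "(\<lambda>i. T ` C i) \<in> delta_covers \<delta> (T ` A)"
      using C by (fastforce simp: delta_covers_def intro: order_trans)
    then have "hausdorff_pre k \<delta> (T ` A) \<le> (\<Sum>i. hausdorff_weight k (T ` C i))"
      unfolding hausdorff_pre_def by (rule INF_lower)
    also have "\<dots> \<le> (\<Sum>i. hausdorff_weight k (C i))"
    proof (rule suminf_le)
      fix i show "hausdorff_weight k (T ` C i) \<le> hausdorff_weight k (C i)"
        using d[of i] C by (auto simp: hausdorff_weight_def diameter_ge_0 delta_covers_def
            intro!: ennreal_leI mult_left_mono power_mono divide_right_mono)
    qed auto
    finally show "hausdorff_pre k \<delta> (T ` A) \<le> (\<Sum>i. hausdorff_weight k (C i))" .
  qed
qed

section \<open>Rigid motions preserve Lebesgue measure\<close>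

lemma lborel_unique_translation_invariant:
  fixes M :: "'a::euclidean_space measure"
  assumes sf: "sigma_finite_measure M" and sets: "sets M = sets borel"
    and inv: "\<And>c. distr M borel ((+) c) = M"
    and ball: "emeasure M (ball 0 1) = emeasure lborel (ball (0::'a) 1)"
  shows "M = lborel"
proof (rule measure_eqI)
  show "sets M = sets lborel" using sets by simp
  fix A assume "A \<in> sets M"
  then have A [measurable]: "A \<in> sets borel" using sets by simp
  interpret M: sigma_finite_measure M by (rule sf)
  interpret P: pair_sigma_finite M "lborel :: 'a measure"
    by (simp add: pair_sigma_finite_def sf sigma_finite_lborel)
  have [measurable_cong]: "sets M = sets borel" by (rule sets)
  define f g where "f = (indicator A :: 'a \<Rightarrow> ennreal)" and "g = (indicator (ball 0 1) :: 'a \<Rightarrow> ennreal)"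
  have [measurable]: "f \<in> borel_measurable borel" "g \<in> borel_measurable borel"
    by (auto simp: f_def g_def intro!: borel_measurable_indicator)
  have M_shift: "(\<integral>\<^sup>+x. h (c + x) \<partial>M) = (\<integral>\<^sup>+x. h x \<partial>M)"
    if [measurable]: "h \<in> borel_measurable borel" for h :: "'a \<Rightarrow> ennreal" and c
    by (subst (2) inv[of c, symmetric]) (simp add: nn_integral_distr)
  have L_shift: "(\<integral>\<^sup>+x. h (c + x) \<partial>lborel) = (\<integral>\<^sup>+x. h x \<partial>lborel)"
    if [measurable]: "h \<in> borel_measurable borel" for h :: "'a \<Rightarrow> ennreal" and c
    by (subst (2) lborel_distr_plus[of c, symmetric]) (simp add: nn_integral_distr)
  have L_minus: "(\<integral>\<^sup>+x. h (c - x) \<partial>lborel) = (\<integral>\<^sup>+x. h x \<partial>lborel)"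
    if [measurable]: "h \<in> borel_measurable borel" for h :: "'a \<Rightarrow> ennreal" and c
    by (subst (2) lborel_affine[of "-1" c]) (simp_all add: nn_integral_density nn_integral_distr)
  \<comment> \<open>The uniqueness argument for Haar measure: the double integral of
    \<open>f x * g (x + y)\<close> is evaluated in both orders, using invariance of \<open>M\<close>
    under translations and of \<open>lborel\<close> under translations and reflections. The
    \<open>M\<close>-integral of \<open>f\<close> times the \<open>lborel\<close>-integral of
    \<open>g\<close> then equals the same product with the two measures exchanged; the unit ball as
    \<open>g\<close> fixes the factor.\<close>
  have "(\<integral>\<^sup>+x. f x \<partial>M) * (\<integral>\<^sup>+y. g y \<partial>lborel) = (\<integral>\<^sup>+x. f x * (\<integral>\<^sup>+y. g (x + y) \<partial>lborel) \<partial>M)"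
    by (simp add: L_shift nn_integral_multc)
  also have "\<dots> = (\<integral>\<^sup>+x. \<integral>\<^sup>+y. f x * g (x + y) \<partial>lborel \<partial>M)"
    by (simp add: nn_integral_cmult)
  also have "\<dots> = (\<integral>\<^sup>+y. \<integral>\<^sup>+x. f x * g (x + y) \<partial>M \<partial>lborel)"
    by (rule P.Fubini'[symmetric]) measurable
  also have "\<dots> = (\<integral>\<^sup>+y. \<integral>\<^sup>+x. f (x - y) * g x \<partial>M \<partial>lborel)"
  proof (rule nn_integral_cong)
    fix y :: 'a
    show "(\<integral>\<^sup>+x. f x * g (x + y) \<partial>M) = (\<integral>\<^sup>+x. f (x - y) * g x \<partial>M)"
      using M_shift[of "\<lambda>x. f (x - y) * g x" y] by (simp add: add.commute)
  qed
  also have "\<dots> = (\<integral>\<^sup>+x. \<integral>\<^sup>+y. f (x - y) * g x \<partial>lborel \<partial>M)"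
    by (rule P.Fubini') measurable
  also have "\<dots> = (\<integral>\<^sup>+x. (\<integral>\<^sup>+y. f y \<partial>lborel) * g x \<partial>M)"
    by (simp add: nn_integral_multc L_minus)
  also have "\<dots> = (\<integral>\<^sup>+y. f y \<partial>lborel) * (\<integral>\<^sup>+x. g x \<partial>M)"
    by (simp add: nn_integral_cmult)
  finally have "emeasure M A * emeasure lborel (ball (0::'a) 1) = emeasure lborel A * emeasure lborel (ball (0::'a) 1)"
    by (simp add: f_def g_def sets ball)
  moreover have "emeasure lborel (ball (0::'a) 1) \<noteq> 0"
    using unit_ball_vol_pos[of "real DIM('a)"] by (simp add: emeasure_ball del: unit_ball_vol_pos)
  moreover have "emeasure lborel (ball (0::'a) 1) \<noteq> \<infinity>"
    using emeasure_bounded_finite[of "ball (0::'a) 1"] by auto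
  ultimately show "emeasure M A = emeasure lborel A"
    using ennreal_mult_cancel_left[of "emeasure lborel (ball (0::'a) 1)" "emeasure M A" "emeasure lborel A"]
    by (auto simp: mult.commute)
qed

text \<open>The image measure is translation invariant, because translating by
  \<open>c = Q d\<close> after \<open>Q\<close> is translating by \<open>d\<close> before it, and it
  gives balls around 0 their old measure because \<open>Q\<close> preserves norms. No determinant is
  computed.\<close>

lemma lborel_distr_orthogonal:
  fixes Q :: "'a::euclidean_space \<Rightarrow> 'a"
  assumes Q: "orthogonal_transformation Q"
  shows "distr lborel borel Q = lborel"
proof (rule lborel_unique_translation_invariant)
  have lin: "linear Q" and nrm: "norm (Q x) = norm x" for x
    using Q by (auto simp: orthogonal_transformation)
  have bij: "bij Q" by (rule orthogonal_transformation_bij[OF Q])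
  have [measurable]: "Q \<in> borel_measurable borel"
    using lin by (intro borel_measurable_continuous_onI linear_continuous_on)
      (simp add: linear_conv_bounded_linear)
  have "Q -` ball 0 r = ball 0 r" for r using nrm by auto
  then have eb: "emeasure (distr lborel borel Q) (ball 0 r) = emeasure lborel (ball (0::'a) r)" for r
    by (subst emeasure_distr) auto
  show "emeasure (distr lborel borel Q) (ball 0 1) = emeasure lborel (ball (0::'a) 1)" by (rule eb)
  show "sigma_finite_measure (distr lborel borel Q)"
  proof
    have "(\<Union>n::nat. ball (0::'a) (real n)) = UNIV"
      by (auto simp: reals_Archimedean2)
    then show "\<exists>A. countable A \<and> A \<subseteq> sets (distr lborel borel Q) \<and> \<Union> A = space (distr lborel borel Q)
        \<and> (\<forall>a\<in>A. emeasure (distr lborel borel Q) a \<noteq> \<infinity>)"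
      by (intro exI[of _ "range (\<lambda>n::nat. ball (0::'a) (real n))"])
        (auto simp: eb emeasure_ball)
  qed
  fix c :: 'a
  obtain d where c: "c = Q d" using bij by (metis bij_pointE)
  have "distr (distr lborel borel Q) borel ((+) c) = distr lborel borel ((+) c \<circ> Q)"
    by (rule distr_distr) auto
  also have "(+) c \<circ> Q = Q \<circ> (+) d" 
    unfolding c comp_def using lin by (simp add: linear_add)
  also have "distr lborel borel (Q \<circ> (+) d) = distr (distr lborel borel ((+) d)) borel Q"
    by (rule distr_distr[symmetric]) auto
  finally show "distr (distr lborel borel Q) borel ((+) c) = distr lborel borel Q"
    by (simp add: lborel_distr_plus)
qed simp

lemma lborel_distr_rigid:
  fixes Q :: "'a::euclidean_space \<Rightarrow> 'a"
  assumes Q: "orthogonal_transformation Q"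
  shows "distr lborel borel (\<lambda>y. a + Q y) = lborel"
proof -
  have [measurable]: "Q \<in> borel_measurable borel"
    using Q by (intro borel_measurable_continuous_onI linear_continuous_on)
      (simp add: linear_conv_bounded_linear orthogonal_transformation_def)
  have "distr lborel borel (\<lambda>y. a + Q y) = distr (distr lborel borel Q) borel ((+) a)"
    by (subst distr_distr) (auto simp: comp_def)
  then show ?thesis by (simp add: lborel_distr_orthogonal[OF Q] lborel_distr_plus)
qed

subsection \<open>A relative isoperimetric inequality\<close>

definition mix :: "'a::euclidean_space set \<Rightarrow> 'a \<Rightarrow> 'a \<Rightarrow> 'a" where
  "mix J x y = (\<Sum>b\<in>Basis. (if b \<in> J then y \<bullet> b else x \<bullet> b) *\<^sub>R b)"

lemma mix_inner [simp]: "b \<in> Basis \<Longrightarrow> mix J x y \<bullet> b = (if b \<in> J then y \<bullet> b else x \<bullet> b)"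
  by (simp add: mix_def)

lemma mix_Basis: "mix Basis x y = y" "mix {} x y = x"
  by (auto simp: euclidean_eq_iff[where 'a='a])

text \<open>The map exchanges the coordinates in \<open>J\<close> between the two points, so it
  permutes an orthonormal basis of the product space. Carrying \<open>mix J y x\<close> along is
  what makes it invertible and measure preserving.\<close>

lemma orthogonal_transformation_mix:
  "orthogonal_transformation (\<lambda>p::'a::euclidean_space \<times> 'a. (mix J (fst p) (snd p), mix J (snd p) (fst p)))"
  unfolding orthogonal_transformation_def
proof (intro conjI allI)
  show "linear (\<lambda>p::'a \<times> 'a. (mix J (fst p) (snd p), mix J (snd p) (fst p)))"
    by (rule linearI) (auto simp: euclidean_eq_iff[where 'a='a] inner_add_left)
  fix p q :: "'a \<times> 'a"
  obtain x y x' y' where p: "p = (x, y)" "q = (x', y')" by (cases p, cases q)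
  have *: "u \<bullet> v = (\<Sum>b\<in>Basis. (u \<bullet> b) * (v \<bullet> b))" for u v :: 'a
    by (rule euclidean_inner)
  have "mix J x y \<bullet> mix J x' y' + mix J y x \<bullet> mix J y' x'
      = (\<Sum>b\<in>Basis. (mix J x y \<bullet> b) * (mix J x' y' \<bullet> b) + (mix J y x \<bullet> b) * (mix J y' x' \<bullet> b))"
    by (simp only: *[of "mix J x y" "mix J x' y'"] *[of "mix J y x" "mix J y' x'"] sum.distrib)
  also have "\<dots> = (\<Sum>b\<in>Basis. (x \<bullet> b) * (x' \<bullet> b) + (y \<bullet> b) * (y' \<bullet> b))"
    by (rule sum.cong) auto
  also have "\<dots> = x \<bullet> x' + y \<bullet> y'"
    by (simp only: *[of x x'] *[of y y'] sum.distrib)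
  finally show "(mix J (fst p) (snd p), mix J (snd p) (fst p)) \<bullet> (mix J (fst q) (snd q), mix J (snd q) (fst q)) = p \<bullet> q"
    by (simp add: p)
qed

definition cube :: "'a::euclidean_space \<Rightarrow> real \<Rightarrow> 'a set" where
  "cube z \<rho> = {x. \<forall>b\<in>Basis. \<bar>(x - z) \<bullet> b\<bar> \<le> \<rho>}"

lemma cube_eq_cbox: "cube z \<rho> = cbox (z - \<rho> *\<^sub>R One) (z + \<rho> *\<^sub>R One)"
  by (auto simp: cube_def mem_box inner_diff_left inner_add_left abs_le_iff algebra_simps)

lemma borel_cube [measurable]: "cube z \<rho> \<in> sets borel"
  by (simp add: cube_eq_cbox)

lemma emeasure_cube: "0 \<le> \<rho> \<Longrightarrow> emeasure lborel (cube (z::'a::euclidean_space) \<rho>) = ennreal ((2 * \<rho>) ^ DIM('a))"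
  by (simp add: cube_eq_cbox emeasure_lborel_cbox inner_diff_left inner_add_left)

lemma mix_cube: "x \<in> cube z \<rho> \<Longrightarrow> y \<in> cube z \<rho> \<Longrightarrow> mix J x y \<in> cube z \<rho>"
  by (simp add: cube_def inner_diff_left)

text \<open>In probabilistic terms: if \<open>x\<close> and \<open>y\<close> are independent and
  uniform on the cube, then \<open>mix J x y\<close> is uniform on it too. The exchange of
  coordinates maps the product of the cube with itself onto itself and preserves Lebesgue
  measure.\<close>

lemma emeasure_mix_cube:
  fixes z :: "'a::euclidean_space"
  assumes [measurable]: "A \<in> sets borel"
  shows "emeasure lborel {p\<in>cube z \<rho> \<times> cube z \<rho>. mix J (fst p) (snd p) \<in> A}
    = emeasure lborel (cube z \<rho> \<inter> A) * emeasure lborel (cube z \<rho>)"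
proof -
  let ?S = "\<lambda>p::'a \<times> 'a. (mix J (fst p) (snd p), mix J (snd p) (fst p))"
  have ot: "orthogonal_transformation ?S" by (rule orthogonal_transformation_mix)
  have [measurable]: "?S \<in> borel_measurable borel"
    using ot by (intro borel_measurable_continuous_onI linear_continuous_on)
      (simp add: linear_conv_bounded_linear orthogonal_transformation_def)
  have X: "(cube z \<rho> \<inter> A) \<times> cube z \<rho> \<in> sets borel"
    unfolding borel_prod[symmetric] by (intro pair_measureI) auto
  have pos: "x \<in> cube z \<rho> \<and> y \<in> cube z \<rho>" if "mix J x y \<in> cube z \<rho>" "mix J y x \<in> cube z \<rho>" for x y
    unfolding cube_def
  proof (intro conjI CollectI ballI)
    fix b :: 'a assume b: "b \<in> Basis"
    then have "\<bar>(mix J x y - z) \<bullet> b\<bar> \<le> \<rho>" "\<bar>(mix J y x - z) \<bullet> b\<bar> \<le> \<rho>"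
      using that by (auto simp: cube_def)
    then show "\<bar>(x - z) \<bullet> b\<bar> \<le> \<rho>" "\<bar>(y - z) \<bullet> b\<bar> \<le> \<rho>"
      using b by (auto simp: inner_diff_left split: if_splits)
  qed
  have "{p\<in>cube z \<rho> \<times> cube z \<rho>. mix J (fst p) (snd p) \<in> A} = ?S -` ((cube z \<rho> \<inter> A) \<times> cube z \<rho>)"
  proof (rule set_eqI)
    fix p :: "'a \<times> 'a"
    obtain x y where p: "p = (x, y)" by (cases p)
    show "p \<in> {p\<in>cube z \<rho> \<times> cube z \<rho>. mix J (fst p) (snd p) \<in> A}
        \<longleftrightarrow> p \<in> ?S -` ((cube z \<rho> \<inter> A) \<times> cube z \<rho>)"
      using pos[of x y] mix_cube[of x z \<rho> y J] mix_cube[of y z \<rho> x J]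
      unfolding p mem_Collect_eq vimage_eq mem_Times_iff fst_conv snd_conv by blast
  qed
  also have "emeasure lborel \<dots> = emeasure (distr lborel borel ?S) ((cube z \<rho> \<inter> A) \<times> cube z \<rho>)"
    using X by (subst emeasure_distr) auto
  also have "\<dots> = emeasure (lborel \<Otimes>\<^sub>M lborel) ((cube z \<rho> \<inter> A) \<times> cube z \<rho>)"
    by (simp add: lborel_distr_orthogonal[OF ot] lborel_prod)
  also have "\<dots> = emeasure lborel (cube z \<rho> \<inter> A) * emeasure lborel (cube z \<rho>)"
    by (rule lborel.emeasure_pair_measure_Times) auto
  finally show ?thesis .
qed

text \<open>A discrete relative isoperimetric inequality: walk from a point of \<open>W\<close> to a point outside
  \<open>W\<close> by exchanging one coordinate after the other; some step leaves \<open>W\<close>.\<close>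

lemma cube_isoperimetric:
  fixes z :: "'a::euclidean_space"
  assumes [measurable]: "W \<in> sets borel" "\<And>i. i \<in> Basis \<Longrightarrow> T i \<in> sets borel"
    and T: "\<And>i x s. \<lbrakk>i \<in> Basis; x \<in> cube z \<rho>; x \<notin> T i; x + s *\<^sub>R i \<in> cube z \<rho>; x \<in> W\<rbrakk> \<Longrightarrow> x + s *\<^sub>R i \<in> W"
  shows "emeasure lborel (cube z \<rho> \<inter> W) * emeasure lborel (cube z \<rho> - W)
      \<le> emeasure lborel (cube z \<rho>) * (\<Sum>i\<in>Basis. emeasure lborel (cube z \<rho> \<inter> T i))"
proof -
  let ?Q = "cube z \<rho>"
  let ?E = "\<lambda>J. {p \<in> ?Q \<times> ?Q. mix J (fst p) (snd p) \<notin> W \<and> fst p \<in> W}"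
  have meas_mix [measurable]: "(\<lambda>p. mix J (fst p) (snd p)) \<in> borel_measurable (borel :: ('a \<times> 'a) measure)" for J
  proof (intro borel_measurable_continuous_onI)
    have "continuous_on UNIV (\<lambda>p::'a \<times> 'a. if b \<in> J then snd p \<bullet> b else fst p \<bullet> b)" for b
      by (cases "b \<in> J") (auto intro!: continuous_intros)
    then show "continuous_on UNIV (\<lambda>p::'a \<times> 'a. mix J (fst p) (snd p))"
      unfolding mix_def by (intro continuous_intros)
  qed
  have QQ [measurable]: "?Q \<times> ?Q \<in> sets (borel :: ('a \<times> 'a) measure)"
    unfolding borel_prod[symmetric] by (intro pair_measureI) auto
  have mixA: "{p::'a \<times> 'a. mix J (fst p) (snd p) \<in> A} \<in> sets borel" if "A \<in> sets borel" for J A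
    using measurable_sets[OF meas_mix that, of J] by (simp add: vimage_def)
  have "fst \<in> borel_measurable (borel :: ('a \<times> 'a) measure)"
    by (intro borel_measurable_continuous_onI continuous_intros)
  then have fstW: "{p::'a \<times> 'a. fst p \<in> W} \<in> sets borel"
    using measurable_sets[of fst borel borel W] by (simp add: vimage_def)
  have Em: "?E J \<in> sets lborel" for J
  proof -
    have "?E J = (?Q \<times> ?Q - {p. mix J (fst p) (snd p) \<in> W}) \<inter> {p. fst p \<in> W}" by auto
    then show ?thesis using QQ mixA[of W J] fstW by simp
  qed
  have Dm: "{p \<in> ?Q \<times> ?Q. mix J (fst p) (snd p) \<in> A} \<in> sets lborel" if "A \<in> sets borel" for J A
  proof -
    have "{p \<in> ?Q \<times> ?Q. mix J (fst p) (snd p) \<in> A} = (?Q \<times> ?Q) \<inter> {p. mix J (fst p) (snd p) \<in> A}" by auto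
    then show ?thesis using QQ mixA[OF that, of J] by simp
  qed
  \<comment> \<open>\<open>?E J\<close> is the event that a walk starts in \<open>W\<close> and is
    outside after the coordinates in \<open>J\<close> have been exchanged. Exchanging one more
    coordinate \<open>i\<close> adds at most the event that the current point lies in
    \<open>T i\<close>, and that point is again uniformly distributed.\<close>
  have "emeasure lborel (?E J) \<le> (\<Sum>i\<in>J. emeasure lborel ?Q * emeasure lborel (?Q \<inter> T i))"
    if "finite J" "J \<subseteq> Basis" for J
    using that
  proof (induction J rule: finite_induct)
    case empty
    show ?case by (simp add: mix_Basis)
  next
    case (insert i J)
    have i [measurable]: "i \<in> Basis" using insert by auto
    have [measurable]: "T i \<in> sets borel" using i assms(2) by auto
    let ?D = "{p \<in> ?Q \<times> ?Q. mix J (fst p) (snd p) \<in> T i}"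
    have "?E (insert i J) \<subseteq> ?E J \<union> ?D"
    proof (rule subsetI, rule ccontr)
      fix p assume p: "p \<in> ?E (insert i J)" and n: "p \<notin> ?E J \<union> ?D"
      obtain x y where xy: "p = (x, y)" by force
      have eq: "mix (insert i J) x y = mix J x y + (y \<bullet> i - x \<bullet> i) *\<^sub>R i"
      proof (rule euclidean_eqI)
        fix b :: 'a assume b: "b \<in> Basis"
        show "mix (insert i J) x y \<bullet> b = (mix J x y + (y \<bullet> i - x \<bullet> i) *\<^sub>R i) \<bullet> b"
          using insert(2) i b by (cases "b = i") (simp_all add: inner_add_left inner_Basis)
      qed
      have pQ: "x \<in> ?Q" "y \<in> ?Q" and W: "mix (insert i J) x y \<notin> W" "x \<in> W"
        using p by (simp_all add: xy)
      have Q: "mix K x y \<in> ?Q" for K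
        using pQ by (rule mix_cube)
      have "mix J x y \<in> W" "mix J x y \<notin> T i" using n pQ W by (simp_all add: xy)
      then have "mix J x y + (y \<bullet> i - x \<bullet> i) *\<^sub>R i \<in> W"
        using Q[of J] Q[of "insert i J"] i unfolding eq by (intro T)
      then show False using W unfolding eq by blast
    qed
    then have "emeasure lborel (?E (insert i J)) \<le> emeasure lborel (?E J \<union> ?D)"
      by (rule emeasure_mono) (intro sets.Un Em Dm i \<open>T i \<in> sets borel\<close>)
    also have "\<dots> \<le> emeasure lborel (?E J) + emeasure lborel ?D"
      by (rule emeasure_subadditive) (intro Em Dm \<open>T i \<in> sets borel\<close>)+
    also have "\<dots> \<le> (\<Sum>i\<in>J. emeasure lborel ?Q * emeasure lborel (?Q \<inter> T i)) + emeasure lborel ?Q * emeasure lborel (?Q \<inter> T i)"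
      using insert by (intro add_mono) (auto simp: emeasure_mix_cube mult.commute)
    finally show ?case using insert by (simp add: add.commute)
  qed
  then have "emeasure lborel (?E Basis) \<le> (\<Sum>i\<in>Basis. emeasure lborel ?Q * emeasure lborel (?Q \<inter> T i))"
    by simp
  moreover have "?E Basis = (?Q \<inter> W) \<times> (?Q - W)" by (auto simp: mix_Basis)
  moreover have "emeasure lborel ((?Q \<inter> W) \<times> (?Q - W)) = emeasure lborel (?Q \<inter> W) * emeasure lborel (?Q - W)"
    by (simp add: lborel_prod[symmetric] lborel.emeasure_pair_measure_Times)
  ultimately show ?thesis by (simp add: sum_distrib_left)
qed

subsection \<open>Smooth bump functions\<close>

declare Ck.simps(2) [simp del]

lemma Ck_SucI:
  assumes "\<And>x. (f has_derivative f' x) (at x)" "\<And>b. b \<in> Basis \<Longrightarrow> Ck k (\<lambda>x. f' x b)"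
  shows "Ck (Suc k) f"
proof -
  have "frechet_derivative f (at x) = f' x" for x
    using assms(1) frechet_derivative_at by metis
  with assms show ?thesis by (auto simp: differentiable_def Ck.simps(2))
qed

lemma Ck_SucD:
  assumes "Ck (Suc k) f"
  shows "(f has_derivative frechet_derivative f (at x)) (at x)"
    and "b \<in> Basis \<Longrightarrow> Ck k (\<lambda>x. frechet_derivative f (at x) b)"
  using assms by (auto simp: Ck.simps(2) frechet_derivative_works[symmetric])

lemma Ck_Suc: "Ck (Suc k) f \<Longrightarrow> Ck k f"
proof (induction k arbitrary: f)
  case 0
  then have "f differentiable at x" for x by (simp add: Ck.simps(2))
  then show ?case
    by (simp add: continuous_on_eq_continuous_at differentiable_imp_continuous_within)
next
  case (Suc k)
  from Suc.prems show ?case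
    by (auto intro: Suc.IH simp: Ck.simps(2)[of "Suc k" f] Ck.simps(2)[of k f])
qed

lemma Ck_const: "Ck k (\<lambda>x. c)"
proof (induction k arbitrary: c)
  case (Suc k)
  show ?case by (rule Ck_SucI[where f'="\<lambda>x b. 0"]) (use Suc in auto)
qed simp

lemma Ck_add: "Ck k f \<Longrightarrow> Ck k g \<Longrightarrow> Ck k (\<lambda>x. f x + g x)"
proof (induction k arbitrary: f g)
  case 0
  then show ?case by (auto intro: continuous_intros)
next
  case (Suc k)
  show ?case
  proof (rule Ck_SucI[OF has_derivative_add[OF Ck_SucD(1) Ck_SucD(1)]])
    fix b :: 'a assume "b \<in> Basis"
    then show "Ck k (\<lambda>x. frechet_derivative f (at x) b + frechet_derivative g (at x) b)"
      by (intro Suc.IH Ck_SucD(2)[OF Suc.prems(1)] Ck_SucD(2)[OF Suc.prems(2)])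
  qed (use Suc in auto)
qed

lemma Ck_mult: "Ck k f \<Longrightarrow> Ck k g \<Longrightarrow> Ck k (\<lambda>x. f x * g x)"
proof (induction k arbitrary: f g)
  case 0
  then show ?case by (auto intro: continuous_intros)
next
  case (Suc k)
  show ?case
  proof (rule Ck_SucI[OF has_derivative_mult[OF Ck_SucD(1) Ck_SucD(1)]])
    fix b :: 'a assume "b \<in> Basis"
    then show "Ck k (\<lambda>x. f x * frechet_derivative g (at x) b + frechet_derivative f (at x) b * g x)"
      by (intro Ck_add Suc.IH Ck_Suc[OF Suc.prems(1)] Ck_Suc[OF Suc.prems(2)]
          Ck_SucD(2)[OF Suc.prems(1)] Ck_SucD(2)[OF Suc.prems(2)])
  qed (use Suc in auto)
qed

lemma Ck_cmult: "Ck k f \<Longrightarrow> Ck k (\<lambda>x. c * f x)"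
  by (rule Ck_mult[OF Ck_const])

lemma Ck_sum: "(\<And>i. i \<in> I \<Longrightarrow> Ck k (f i)) \<Longrightarrow> Ck k (\<lambda>x. \<Sum>i\<in>I. f i x)"
  by (induction I rule: infinite_finite_induct) (auto intro: Ck_add Ck_const)

lemma Ck_prod: "(\<And>i. i \<in> I \<Longrightarrow> Ck k (f i)) \<Longrightarrow> Ck k (\<lambda>x. \<Prod>i\<in>I. f i x)"
  by (induction I rule: infinite_finite_induct) (auto intro: Ck_mult Ck_const)

lemma linear_eq_sum_Basis:
  fixes L :: "'a::euclidean_space \<Rightarrow> real"
  assumes "linear L"
  shows "L v = (\<Sum>i\<in>Basis. (v \<bullet> i) * L i)"
proof -
  have "L v = L (\<Sum>i\<in>Basis. (v \<bullet> i) *\<^sub>R i)" by (simp add: euclidean_representation)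
  also have "\<dots> = (\<Sum>i\<in>Basis. (v \<bullet> i) * L i)"
    using assms by (simp add: linear_sum linear_cmul)
  finally show ?thesis .
qed

text \<open>Differentiating in a basis direction \<open>b\<close> gives a combination of the partial
  derivatives of \<open>f\<close> with the constant coordinates of \<open>L b\<close> as
  coefficients, so the induction on \<open>k\<close> never leaves functions of the same
  form.\<close>

lemma Ck_affine:
  fixes f :: "'b::euclidean_space \<Rightarrow> real" and L :: "'a::euclidean_space \<Rightarrow> 'b"
  assumes L: "linear L"
  shows "Ck k f \<Longrightarrow> Ck k (\<lambda>x. f (L x + c))"
proof (induction k arbitrary: f)
  case 0
  have "continuous_on UNIV L"
    using L by (simp add: linear_continuous_on linear_conv_bounded_linear)
  then show ?case using 0
    by (auto intro!: continuous_on_compose2[where g=f and t=UNIV] continuous_intros)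
next
  case (Suc k)
  have L': "((\<lambda>x. L x + c) has_derivative L) (at x)" for x
    using L by (intro has_derivative_add_const linear_imp_has_derivative)
  let ?D = "\<lambda>x. frechet_derivative f (at (L x + c))"
  show ?case
  proof (rule Ck_SucI)
    show "((\<lambda>x. f (L x + c)) has_derivative (\<lambda>h. ?D x (L h))) (at x)" for x
      using has_derivative_compose[OF L' Ck_SucD(1)[OF Suc.prems]] .
    fix b :: 'a
    have "?D x (L b) = (\<Sum>i\<in>Basis. (L b \<bullet> i) * ?D x i)" for x
      using Ck_SucD(1)[OF Suc.prems] by (intro linear_eq_sum_Basis has_derivative_linear)
    then have "(\<lambda>x. ?D x (L b)) = (\<lambda>x. \<Sum>i\<in>Basis. (L b \<bullet> i) * ?D x i)" by auto
    moreover have "Ck k (\<lambda>x. \<Sum>i\<in>Basis. (L b \<bullet> i) * ?D x i)"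
      by (intro Ck_sum Ck_cmult Suc.IH Ck_SucD(2)[OF Suc.prems])
    ultimately show "Ck k (\<lambda>x. ?D x (L b))" by metis
  qed
qed

lemma Ck_SucI_real:
  fixes f :: "real \<Rightarrow> real"
  assumes "\<And>x. (f has_real_derivative f' x) (at x)" "Ck k f'"
  shows "Ck (Suc k) f"
proof (rule Ck_SucI)
  show "(f has_derivative (\<lambda>h. f' x * h)) (at x)" for x
    using assms(1) by (simp add: has_field_derivative_def)
qed (use assms in auto)

text \<open>For \<open>y = 1 / x\<close> the derivative of \<open>p(y) exp(-y)\<close> with respect
  to \<open>x\<close> is \<open>y^2 (p(y) - p'(y)) exp(-y)\<close>; the recursion records this
  polynomial.\<close>

primrec flat_poly :: "nat \<Rightarrow> real poly" where
  "flat_poly 0 = 1"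
| "flat_poly (Suc k) = monom 1 2 * (flat_poly k - pderiv (flat_poly k))"

text \<open>\<open>flat k\<close> is the \<open>k\<close>-th derivative of \<open>exp (- 1 / x)\<close>, extended by 0.\<close>

definition flat :: "nat \<Rightarrow> real \<Rightarrow> real" where
  "flat k x = (if 0 < x then poly (flat_poly k) (1 / x) * exp (- (1 / x)) else 0)"

lemma poly_times_exp_tendsto_0:
  "((\<lambda>y::real. poly p y * exp (- y)) \<longlongrightarrow> 0) at_top"
proof -
  have "((\<lambda>y. \<Sum>i\<le>degree p. coeff p i * (y ^ i / exp y)) \<longlongrightarrow> (\<Sum>i\<le>degree p. coeff p i * 0)) at_top"
    by (intro tendsto_intros tendsto_power_div_exp_0)
  then show ?thesis
    by (simp add: poly_altdef exp_minus field_simps sum_divide_distrib sum_distrib_left)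
qed

lemma flat_has_derivative: "(flat k has_real_derivative flat (Suc k) x) (at x)"
proof -
  consider "x < 0" | "x = 0" | "x > 0" by linarith
  then show ?thesis
  proof cases
    case 1
    have "((\<lambda>x. 0) has_real_derivative 0) (at x)" by simp
    then have "(flat k has_real_derivative 0) (at x)"
      by (rule has_field_derivative_transform_within_open[where S="{..<0}"]) (use 1 in \<open>auto simp: flat_def\<close>)
    with 1 show ?thesis by (simp add: flat_def)
  next
    case 3
    have "((\<lambda>x. poly (flat_poly k) (1 / x) * exp (- (1 / x))) has_real_derivative flat (Suc k) x) (at x)"
      using 3 by (auto intro!: derivative_eq_intros poly_DERIV[THEN DERIV_chain2]
          simp: flat_def field_simps power2_eq_square poly_monom)
    then show ?thesis
      by (rule has_field_derivative_transform_within_open[where S="{0<..}"]) (use 3 in \<open>auto simp: flat_def\<close>)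
  next
    case 2
    have "((\<lambda>h. flat k h / h) \<longlongrightarrow> 0) (at_left 0)"
      by (rule tendsto_eventually) (auto simp: eventually_at_filter flat_def)
    moreover have "((\<lambda>h. flat k h / h) \<longlongrightarrow> 0) (at_right 0)"
    proof -
      \<comment> \<open>Division by \<open>h\<close> raises the degree of the polynomial in
        \<open>1 / h\<close> by one, hence the factor \<open>monom 1 1\<close>; the exponential
        still beats it.\<close>
      have "((\<lambda>h::real. poly (monom 1 1 * flat_poly k) (inverse h) * exp (- inverse h)) \<longlongrightarrow> 0) (at_right 0)"
        by (rule filterlim_compose[OF poly_times_exp_tendsto_0 filterlim_inverse_at_top_right])
      moreover have "\<forall>\<^sub>F h in at_right 0. poly (monom 1 1 * flat_poly k) (inverse h) * exp (- inverse h) = flat k h / h"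
        by (auto simp: eventually_at_filter flat_def poly_monom field_simps)
      ultimately show ?thesis by (rule Lim_transform_eventually)
    qed
    ultimately have "((\<lambda>h. flat k h / h) \<longlongrightarrow> 0) (at 0)"
      by (rule filterlim_split_at)
    with 2 show ?thesis by (simp add: DERIV_def flat_def)
  qed
qed

lemma Ck_flat: "Ck k (flat j)"
proof (induction k arbitrary: j)
  case 0
  show ?case
    by (simp add: continuous_on_eq_continuous_at DERIV_isCont[OF flat_has_derivative])
next
  case (Suc k)
  show ?case by (rule Ck_SucI_real[OF flat_has_derivative Suc])
qed

text \<open>The parameter \<open>n\<close> steepens the flanks without moving the support:
  \<open>flat 0 (n * c)\<close> tends to 1 for every \<open>c > 0\<close>, so the bumps tend
  pointwise to the indicator of the open interval while vanishing outside it for every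
  \<open>n\<close>.\<close>

definition bump :: "real \<Rightarrow> real \<Rightarrow> nat \<Rightarrow> real \<Rightarrow> real" where
  "bump a b n t = flat 0 (real n * (t - a)) * flat 0 (real n * (b - t))"

lemma Ck_bump: "Ck k (bump a b n)"
proof -
  have "Ck k (\<lambda>t. flat 0 (c * t + d))" for c d :: real
    by (rule Ck_affine[of "\<lambda>t. c * t" k "flat 0" d]) (auto intro: Ck_flat linearI simp: algebra_simps)
  from Ck_mult[OF this[of "real n" "- real n * a"] this[of "- real n" "real n * b"]] show ?thesis
    by (simp add: bump_def[abs_def] algebra_simps)
qed

lemma flat0_bounds: "0 \<le> flat 0 t" "flat 0 t \<le> 1"
  by (auto simp: flat_def)

lemma bump_bounds: "0 \<le> bump a b n t" "bump a b n t \<le> 1"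
  using flat0_bounds by (auto simp: bump_def intro: mult_le_one)

lemma bump_outside: "t \<le> a \<or> b \<le> t \<Longrightarrow> bump a b n t = 0"
  by (auto simp: bump_def flat_def zero_less_mult_iff)

lemma bump_tendsto: "(\<lambda>n. bump a b n t) \<longlonglongrightarrow> indicator {a<..<b} t"
proof (cases "a < t \<and> t < b")
  case True
  have *: "(\<lambda>n. flat 0 (real n * c)) \<longlonglongrightarrow> 1" if "0 < c" for c
  proof -
    have "(\<lambda>n. exp (- (1 / (real n * c)))) \<longlonglongrightarrow> exp (- 0)"
      using that by (intro tendsto_intros tendsto_divide_0[OF tendsto_const]
          filterlim_at_top_imp_at_infinity filterlim_at_top_mult_tendsto_pos[OF tendsto_const]
          filterlim_tendsto_pos_mult_at_top filterlim_real_sequentially)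
        (auto simp: mult.commute intro!: filterlim_tendsto_pos_mult_at_top[OF tendsto_const] filterlim_real_sequentially)
    moreover have "\<forall>\<^sub>F n in sequentially. exp (- (1 / (real n * c))) = flat 0 (real n * c)"
      using eventually_gt_at_top[of 0] by eventually_elim (use that in \<open>auto simp: flat_def\<close>)
    ultimately show ?thesis by (simp add: Lim_transform_eventually)
  qed
  show ?thesis
    using tendsto_mult[OF *[of "t - a"] *[of "b - t"]] True by (simp add: bump_def)
qed (auto simp: bump_outside not_less)

subsection \<open>Projections, densities and slices\<close>

text \<open>\<open>D\<close> holds the coordinates that are projected away. The points of the cube
  above \<open>C\<close> lie in a box with side \<open>2 * \<rho>\<close> in the directions of
  \<open>D\<close> and side twice the diameter of \<open>C\<close> in the others; the powers of 4
  and the ball volume turn \<open>(2 * diameter C) ^ k\<close> into the normalised weight.\<close>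

lemma box_cover_exists:
  fixes z :: "'a::euclidean_space"
  assumes D: "D \<subseteq> Basis" and C: "bounded C" and \<rho>: "0 \<le> \<rho>"
  shows "\<exists>T\<in>sets borel. {x\<in>cube z \<rho>. \<exists>y\<in>C. \<forall>b\<in>Basis - D. x \<bullet> b = y \<bullet> b} \<subseteq> T \<and>
     emeasure lborel T \<le> ennreal ((2 * \<rho>) ^ card D * 4 ^ card (Basis - D) / unit_ball_vol (card (Basis - D)))
       * hausdorff_weight (card (Basis - D)) C"
proof (cases "C = {}")
  case False
  then obtain x0 where x0: "x0 \<in> C" by auto
  let ?k = "card (Basis - D)" and ?d = "diameter C"
  have d: "0 \<le> ?d" using C by (rule diameter_ge_0)
  define l u where "l = (\<Sum>b\<in>Basis. (if b \<in> D then z \<bullet> b - \<rho> else x0 \<bullet> b - ?d) *\<^sub>R b)"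
    and "u = (\<Sum>b\<in>Basis. (if b \<in> D then z \<bullet> b + \<rho> else x0 \<bullet> b + ?d) *\<^sub>R b)"
  have lu: "b \<in> Basis \<Longrightarrow> l \<bullet> b = (if b \<in> D then z \<bullet> b - \<rho> else x0 \<bullet> b - ?d)"
    "b \<in> Basis \<Longrightarrow> u \<bullet> b = (if b \<in> D then z \<bullet> b + \<rho> else x0 \<bullet> b + ?d)" for b
    by (simp_all add: l_def u_def)
  have sub: "{x\<in>cube z \<rho>. \<exists>y\<in>C. \<forall>b\<in>Basis - D. x \<bullet> b = y \<bullet> b} \<subseteq> cbox l u"
  proof
    fix x assume x: "x \<in> {x\<in>cube z \<rho>. \<exists>y\<in>C. \<forall>b\<in>Basis - D. x \<bullet> b = y \<bullet> b}"
    then obtain y where y: "y \<in> C" "\<And>b. b \<in> Basis \<Longrightarrow> b \<notin> D \<Longrightarrow> x \<bullet> b = y \<bullet> b" by auto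
    show "x \<in> cbox l u"
      unfolding mem_box
    proof (intro ballI)
      fix b :: 'a assume b: "b \<in> Basis"
      show "l \<bullet> b \<le> x \<bullet> b \<and> x \<bullet> b \<le> u \<bullet> b"
      proof (cases "b \<in> D")
        case True
        have "\<bar>(x - z) \<bullet> b\<bar> \<le> \<rho>" using x b by (auto simp: cube_def)
        with True show ?thesis using lu[OF b] by (simp add: inner_diff_left abs_le_iff)
      next
        case False
        have "\<bar>(y - x0) \<bullet> b\<bar> \<le> norm (y - x0)" using b by (rule Basis_le_norm)
        also have "\<dots> \<le> ?d" using diameter_bounded_bound[OF C y(1) x0] by (simp add: dist_norm)
        finally show ?thesis using False y(2)[OF b] lu[OF b] by (simp add: inner_diff_left abs_le_iff)
      qed
    qed
  qed
  have "emeasure lborel (cbox l u) = ennreal (\<Prod>b\<in>Basis. (u - l) \<bullet> b)"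
    using \<rho> d by (subst emeasure_lborel_cbox) (auto simp: lu)
  also have "(\<Prod>b\<in>Basis. (u - l) \<bullet> b) = (\<Prod>b\<in>Basis. if b \<in> D then 2 * \<rho> else 2 * ?d)"
    by (rule prod.cong) (auto simp: lu inner_diff_left)
  also have "\<dots> = (\<Prod>b\<in>D. 2 * \<rho>) * (\<Prod>b\<in>Basis - D. 2 * ?d)"
    using D by (subst prod.If_cases) (auto simp: Int_absorb1 Diff_eq)
  also have "\<dots> = ((2 * \<rho>) ^ card D * 4 ^ ?k / unit_ball_vol ?k) * (unit_ball_vol ?k * (?d / 2) ^ ?k)"
  proof -
    have v: "unit_ball_vol (real ?k) \<noteq> 0"
      using unit_ball_vol_pos[of "real ?k"] by (simp del: unit_ball_vol_pos)
    have *: "a * (4 ^ j * y) = (a * 4 ^ j / v) * (v * y)" if "v \<noteq> 0" for a v y :: real and j :: nat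
      using that by simp
    have "(2 * y) ^ j = 4 ^ j * (y / 2) ^ j" for y :: real and j :: nat
      by (subst power_mult_distrib[symmetric]) simp
    then show ?thesis using *[OF v] by (simp only: prod_constant)
  qed
  also have "ennreal \<dots> = ennreal ((2 * \<rho>) ^ card D * 4 ^ ?k / unit_ball_vol ?k) * hausdorff_weight ?k C"
    using \<rho> d False by (subst ennreal_mult') (auto simp: hausdorff_weight_def)
  finally show ?thesis using sub by (intro bexI[of _ "cbox l u"]) auto
qed (auto intro!: bexI[of _ "{}"])

text \<open>Sums the box estimate over a cover of \<open>B\<close>. A Borel hull is constructed
  because the cylinder over a projection of \<open>B\<close> need not be Borel. Covers of scale 1
  serve as well as finer ones, since the box estimate holds for all diameters.\<close>

lemma projection_cover_exists:
  fixes z :: "'a::euclidean_space"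
  assumes D: "D \<subseteq> Basis" and \<rho>: "0 < \<rho>"
  shows "\<exists>T\<in>sets borel. {x\<in>cube z \<rho>. \<exists>y\<in>B. \<forall>b\<in>Basis - D. x \<bullet> b = y \<bullet> b} \<subseteq> T \<and>
     emeasure lborel T \<le> ennreal ((2 * \<rho>) ^ card D * 4 ^ card (Basis - D) / unit_ball_vol (card (Basis - D)))
       * hausdorff_outer (card (Basis - D)) B"
proof -
  let ?k = "card (Basis - D)"
  define c where "c = (2 * \<rho>) ^ card D * 4 ^ ?k / unit_ball_vol ?k"
  have c: "0 < c" using \<rho> by (simp add: c_def)
  let ?P = "\<lambda>C. {x\<in>cube z \<rho>. \<exists>y\<in>C. \<forall>b\<in>Basis - D. x \<bullet> b = y \<bullet> b}"
  let ?H = "hausdorff_outer ?k B"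
  have H: "\<exists>T\<in>sets borel. ?P B \<subseteq> T \<and> emeasure lborel T \<le> ennreal c * y" if "?H < y" for y
  proof -
    have "hausdorff_pre ?k 1 B < y"
      using hausdorff_pre_le_outer[of 1 ?k B] that by auto
    then obtain C where C: "C \<in> delta_covers 1 B" "(\<Sum>i. hausdorff_weight ?k (C i)) < y"
      unfolding hausdorff_pre_def by (auto simp: INF_less_iff)
    have "\<exists>T. T \<in> sets borel \<and> ?P (C i) \<subseteq> T \<and> emeasure lborel T \<le> ennreal c * hausdorff_weight ?k (C i)" for i
      unfolding c_def Bex_def[symmetric] using C \<rho>
      by (intro box_cover_exists[OF D]) (auto simp: delta_covers_def)
    then have "\<forall>i. \<exists>T. T \<in> sets borel \<and> ?P (C i) \<subseteq> T \<and> emeasure lborel T \<le> ennreal c * hausdorff_weight ?k (C i)"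
      by (rule allI)
    from choice[OF this] obtain T where
      T': "\<forall>i. T i \<in> sets borel \<and> ?P (C i) \<subseteq> T i \<and> emeasure lborel (T i) \<le> ennreal c * hausdorff_weight ?k (C i)" ..
    then have T: "\<And>i. T i \<in> sets borel" "\<And>i. ?P (C i) \<subseteq> T i"
      "\<And>i. emeasure lborel (T i) \<le> ennreal c * hausdorff_weight ?k (C i)" by simp_all
    show ?thesis
    proof (intro bexI conjI)
      show "(\<Union>i. T i) \<in> sets borel" using T(1) by auto
      show "?P B \<subseteq> (\<Union>i. T i)"
      proof
        fix x assume "x \<in> ?P B"
        then obtain y where y: "x \<in> cube z \<rho>" "y \<in> B" "\<forall>b\<in>Basis - D. x \<bullet> b = y \<bullet> b" by auto
        then obtain i where "y \<in> C i" using C(1) by (auto simp: delta_covers_def)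
        then have "x \<in> ?P (C i)" using y by auto
        then show "x \<in> (\<Union>i. T i)" using T(2)[of i] by blast
      qed
      have "emeasure lborel (\<Union>i. T i) \<le> (\<Sum>i. emeasure lborel (T i))"
        using T(1) by (intro emeasure_subadditive_countably) auto
      also have "\<dots> \<le> (\<Sum>i. ennreal c * hausdorff_weight ?k (C i))"
        using T(3) by (intro suminf_le) auto
      also have "\<dots> = ennreal c * (\<Sum>i. hausdorff_weight ?k (C i))" by simp
      also have "\<dots> \<le> ennreal c * y" using C(2) by (intro mult_left_mono) auto
      finally show "emeasure lborel (\<Union>i. T i) \<le> ennreal c * y" .
    qed
  qed
  \<comment> \<open>The measure itself, rather than a number above it, is reached by intersecting
    the hulls for \<open>?H + 1 / (n + 1)\<close>; for infinite measure the whole space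
    serves.\<close>
  have "\<exists>T\<in>sets borel. ?P B \<subseteq> T \<and> emeasure lborel T \<le> ennreal c * ?H"
  proof (cases "?H = \<infinity>")
    case True
    then show ?thesis using c by (intro bexI[of _ UNIV]) (auto simp: ennreal_mult_top)
  next
    case False
    have ex: "\<exists>T. T \<in> sets borel \<and> ?P B \<subseteq> T \<and> emeasure lborel T \<le> ennreal c * (?H + ennreal (1 / Suc n))" for n
      unfolding Bex_def[symmetric]
    proof (rule H)
      show "?H < ?H + ennreal (1 / Suc n)"
        using False ennreal_add_left_cancel_less[of ?H 0 "ennreal (1 / Suc n)"]
        by (auto simp: ennreal_less_zero_iff)
    qed
    from choice[OF allI, OF ex] obtain T where
      T': "\<forall>n. T n \<in> sets borel \<and> ?P B \<subseteq> T n \<and> emeasure lborel (T n) \<le> ennreal c * (?H + ennreal (1 / Suc n))" ..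
    then have T: "\<And>n. T n \<in> sets borel" "\<And>n. ?P B \<subseteq> T n"
      "\<And>n. emeasure lborel (T n) \<le> ennreal c * (?H + ennreal (1 / Suc n))" by simp_all
    show ?thesis
    proof (intro bexI conjI)
      show "(\<Inter>n. T n) \<in> sets borel" using T(1) by auto
      show "?P B \<subseteq> (\<Inter>n. T n)" using T(2) by blast
      have le: "emeasure lborel (\<Inter>n. T n) \<le> ennreal c * (?H + ennreal (1 / Suc n))" for n
        by (rule order_trans[OF emeasure_mono T(3)]) (use T(1) in auto)
      have "(\<lambda>n. ennreal c * (?H + ennreal (1 / Suc n))) \<longlonglongrightarrow> ennreal c * (?H + ennreal 0)"
        by (intro ennreal_tendsto_cmult tendsto_add tendsto_const tendsto_ennrealI LIMSEQ_Suc[OF lim_1_over_n]) auto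
      then show "emeasure lborel (\<Inter>n. T n) \<le> ennreal c * ?H"
        using le by (intro LIMSEQ_le_const) (auto simp del: of_nat_Suc)
    qed
  qed
  then show ?thesis by (simp only: c_def)
qed

text \<open>A set of the cover meets the level \<open>t\<close> only for \<open>t\<close> in an
  interval of length twice its diameter, so integrating its \<open>k\<close>-dimensional weight over
  \<open>t\<close> costs one more power of the diameter; this gives the constant. Fatou's lemma lets
  the scale tend to 0. The measurable majorant \<open>F\<close> stands in for the measure of the
  slices, so that measurability of the latter in \<open>t\<close> does not have to be
  proved.\<close>

lemma eilenberg_inequality:
  fixes h :: "'a::euclidean_space \<Rightarrow> real"
  assumes h: "\<And>x y. \<bar>h x - h y\<bar> \<le> dist x y" and fin: "hausdorff_outer (Suc k) B < \<infinity>"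
  obtains F where "F \<in> borel_measurable borel" "\<And>t. hausdorff_outer k (B \<inter> {x. h x = t}) \<le> F t"
    "(\<integral>\<^sup>+t. F t \<partial>lborel) \<le> ennreal (4 * unit_ball_vol k / unit_ball_vol (Suc k)) * hausdorff_outer (Suc k) B"
proof -
  let ?H = "hausdorff_outer (Suc k) B"
  define c where "c = 4 * unit_ball_vol k / unit_ball_vol (Suc k)"
  have c: "0 < c" using unit_ball_vol_pos[of "real k"] unit_ball_vol_pos[of "real (Suc k)"]
    by (simp add: c_def del: unit_ball_vol_pos)
  have "\<exists>C. C \<in> delta_covers (1 / Suc n) B \<and> (\<Sum>i. hausdorff_weight (Suc k) (C i)) < ?H + ennreal (1 / Suc n)" for n
  proof -
    have "hausdorff_pre (Suc k) (1 / Suc n) B \<le> ?H" by (rule hausdorff_pre_le_outer) simp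
    also have "?H < ?H + ennreal (1 / Suc n)"
      using fin ennreal_add_left_cancel_less[of ?H 0 "ennreal (1 / Suc n)"]
      by (auto simp: ennreal_less_zero_iff)
    finally show ?thesis unfolding hausdorff_pre_def by (auto simp: INF_less_iff)
  qed
  then obtain C where C: "\<And>n. C n \<in> delta_covers (1 / Suc n) B"
    and Cs: "\<And>n. (\<Sum>i. hausdorff_weight (Suc k) (C n i)) < ?H + ennreal (1 / Suc n)" by metis
  define w where "w n i = (if C n i = {} then {} else
      {h (SOME x. x \<in> C n i) - diameter (C n i) .. h (SOME x. x \<in> C n i) + diameter (C n i)})" for n i
  have bd: "bounded (C n i)" "diameter (C n i) \<le> 1 / Suc n" for n i
    using C[of n] by (auto simp: delta_covers_def)
  have d0: "0 \<le> diameter (C n i)" for n i using bd by (simp add: diameter_ge_0)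
  have hw: "h x \<in> w n i" if "x \<in> C n i" for x n i
  proof -
    have "(SOME x. x \<in> C n i) \<in> C n i" using that by (rule someI)
    then have "\<bar>h x - h (SOME x. x \<in> C n i)\<bar> \<le> diameter (C n i)"
      using h diameter_bounded_bound[OF bd(1) that] order_trans by blast
    then show ?thesis using that by (auto simp: w_def)
  qed
  have [measurable]: "w n i \<in> sets borel" for n i by (auto simp: w_def)
  define F where "F n t = (\<Sum>i. hausdorff_weight k (C n i) * indicator (w n i) t)" for n t
  have [measurable]: "F n \<in> borel_measurable borel" for n unfolding F_def by measurable
  have intF: "(\<integral>\<^sup>+t. F n t \<partial>lborel) \<le> ennreal c * (?H + ennreal (1 / Suc n))" for n
  proof -
    have "(\<integral>\<^sup>+t. F n t \<partial>lborel) = (\<Sum>i. \<integral>\<^sup>+t. hausdorff_weight k (C n i) * indicator (w n i) t \<partial>lborel)"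
      unfolding F_def by (rule nn_integral_suminf) auto
    also have "\<dots> = (\<Sum>i. hausdorff_weight k (C n i) * emeasure lborel (w n i))"
      by (simp add: nn_integral_cmult_indicator)
    also have "\<dots> = (\<Sum>i. ennreal c * hausdorff_weight (Suc k) (C n i))"
    proof (rule suminf_cong)
      fix i
      show "hausdorff_weight k (C n i) * emeasure lborel (w n i) = ennreal c * hausdorff_weight (Suc k) (C n i)"
      proof (cases "C n i = {}")
        case False
        have "unit_ball_vol (real (Suc k)) \<noteq> 0"
          using unit_ball_vol_pos[of "real (Suc k)"] by (simp del: unit_ball_vol_pos)
        then show ?thesis
          using False d0[of n i] c
          by (simp add: hausdorff_weight_def w_def ennreal_mult[symmetric] c_def)
      qed simp
    qed
    also have "\<dots> = ennreal c * (\<Sum>i. hausdorff_weight (Suc k) (C n i))" by simp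
    also have "\<dots> \<le> ennreal c * (?H + ennreal (1 / Suc n))"
      using Cs[of n] by (intro mult_left_mono) auto
    finally show ?thesis .
  qed
  have preF: "hausdorff_pre k (1 / Suc n) (B \<inter> {x. h x = t}) \<le> F n t" for n t
  proof -
    define C' where "C' i = (if t \<in> w n i then C n i else {})" for i
    have "C' \<in> delta_covers (1 / Suc n) (B \<inter> {x. h x = t})"
      using C[of n] hw by (fastforce simp: delta_covers_def C'_def)
    then have "hausdorff_pre k (1 / Suc n) (B \<inter> {x. h x = t}) \<le> (\<Sum>i. hausdorff_weight k (C' i))"
      unfolding hausdorff_pre_def by (rule INF_lower)
    also have "\<dots> = F n t" unfolding F_def by (rule suminf_cong) (auto simp: C'_def indicator_def)
    finally show ?thesis .
  qed
  show ?thesis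
  proof
    show "(\<lambda>t. liminf (\<lambda>n. F n t)) \<in> borel_measurable borel" by measurable
    show "hausdorff_outer k (B \<inter> {x. h x = t}) \<le> liminf (\<lambda>n. F n t)" for t
      unfolding hausdorff_outer_def
    proof (rule SUP_least)
      fix \<delta> :: real assume "\<delta> \<in> {0<..}"
      then obtain N where N: "1 / real (Suc N) < \<delta>" using nat_approx_posE[of \<delta>] by auto
      have "\<forall>\<^sub>F n in sequentially. hausdorff_pre k \<delta> (B \<inter> {x. h x = t}) \<le> F n t"
        using eventually_ge_at_top[of N]
      proof eventually_elim
        case (elim n)
        have "1 / real (Suc n) \<le> 1 / real (Suc N)" using elim by (intro frac_le) auto
        then have "1 / real (Suc n) \<le> \<delta>" using N by linarith
        then show ?case using preF[of n t] hausdorff_pre_antimono order_trans by blast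
      qed
      then show "hausdorff_pre k \<delta> (B \<inter> {x. h x = t}) \<le> liminf (\<lambda>n. F n t)"
        by (rule Liminf_bounded)
    qed
    have "(\<integral>\<^sup>+t. liminf (\<lambda>n. F n t) \<partial>lborel) \<le> liminf (\<lambda>n. \<integral>\<^sup>+t. F n t \<partial>lborel)"
      by (rule nn_integral_liminf) auto
    also have "\<dots> \<le> liminf (\<lambda>n. ennreal c * (?H + ennreal (1 / Suc n)))"
      using intF by (intro Liminf_mono always_eventually allI)
    also have "\<dots> = ennreal c * ?H"
    proof (rule lim_imp_Liminf)
      have "(\<lambda>n. ennreal c * (?H + ennreal (1 / Suc n))) \<longlonglongrightarrow> ennreal c * (?H + ennreal 0)"
        by (intro ennreal_tendsto_cmult tendsto_add tendsto_const tendsto_ennrealI LIMSEQ_Suc[OF lim_1_over_n]) auto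
      then show "(\<lambda>n. ennreal c * (?H + ennreal (1 / Suc n))) \<longlonglongrightarrow> ennreal c * ?H" by simp
    qed simp
    finally show "(\<integral>\<^sup>+t. liminf (\<lambda>n. F n t) \<partial>lborel)
        \<le> ennreal (4 * unit_ball_vol k / unit_ball_vol (Suc k)) * ?H"
      by (simp only: c_def)
  qed
qed

text \<open>\<open>D\<close> holds the directions in which \<open>W\<close> is a cylinder: none for
  the full-dimensional estimate, only the vertical one for a slice. Along any other direction a move
  that leaves \<open>W\<close> starts in the null set \<open>N i\<close> or above a point of
  \<open>B\<close>, so the exit sets of the isoperimetric inequality are, up to null sets, bounded
  by projections of \<open>B\<close>. If \<open>D\<close> were all of \<open>Basis\<close>, no move
  could leave \<open>W\<close>, although \<open>W\<close> and its complement both fill part of the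
  cube.\<close>

lemma cube_hausdorff_lower:
  fixes z :: "'a::euclidean_space"
  assumes [measurable]: "W \<in> sets borel" and D: "D \<subseteq> Basis" and \<alpha>: "0 < \<alpha>" and \<rho>: "0 < \<rho>"
    and N: "\<And>i. i \<in> Basis - D \<Longrightarrow> N i \<in> null_sets lborel"
    and inv: "\<And>i x s. \<lbrakk>i \<in> D; x \<in> W\<rbrakk> \<Longrightarrow> x + s *\<^sub>R i \<in> W"
    and cross: "\<And>i x s. \<lbrakk>i \<in> Basis - D; x \<in> cube z \<rho>; x \<notin> N i; x + s *\<^sub>R i \<in> cube z \<rho>; x \<in> W; x + s *\<^sub>R i \<notin> W\<rbrakk>
      \<Longrightarrow> \<exists>y\<in>B. \<forall>b\<in>Basis - insert i D. x \<bullet> b = y \<bullet> b"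
    and d1: "ennreal (\<alpha> * (2 * \<rho>) ^ DIM('a)) \<le> emeasure lborel (cube z \<rho> \<inter> W)"
    and d2: "ennreal (\<alpha> * (2 * \<rho>) ^ DIM('a)) \<le> emeasure lborel (cube z \<rho> - W)"
  defines "k \<equiv> DIM('a) - Suc (card D)"
  shows "D \<noteq> Basis" and "ennreal (\<alpha>\<^sup>2 * 2 ^ k * unit_ball_vol k / (DIM('a) * 4 ^ k) * \<rho> ^ k) \<le> hausdorff_outer k B"
proof -
  let ?d = "DIM('a)" and ?H = "hausdorff_outer k B"
  define q where "q = (2 * \<rho>) ^ Suc (card D) * 4 ^ k / unit_ball_vol k"
  have v: "0 < unit_ball_vol (real k)" by simp
  have fD: "finite D" by (rule finite_subset[OF D finite_Basis])
  have ck: "card (Basis - insert i D) = k \<and> card (insert i D) = Suc (card D)" if "i \<in> Basis - D" for i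
    using that D fD by (simp add: k_def card_Diff_subset)
  have "\<forall>i. \<exists>T. i \<in> Basis - D \<longrightarrow> T \<in> sets borel \<and> {x\<in>cube z \<rho>. \<exists>y\<in>B. \<forall>b\<in>Basis - insert i D. x \<bullet> b = y \<bullet> b} \<subseteq> T \<and>
     emeasure lborel T \<le> ennreal q * ?H"
  proof
    fix i
    show "\<exists>T. i \<in> Basis - D \<longrightarrow> T \<in> sets borel \<and> {x\<in>cube z \<rho>. \<exists>y\<in>B. \<forall>b\<in>Basis - insert i D. x \<bullet> b = y \<bullet> b} \<subseteq> T \<and>
     emeasure lborel T \<le> ennreal q * ?H"
    proof (cases "i \<in> Basis - D")
      case True
      have "insert i D \<subseteq> Basis" using True D by auto
      from projection_cover_exists[OF this \<rho>, of z B] show ?thesis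
        unfolding Bex_def using ck[OF True] by (simp only: q_def) blast
    qed blast
  qed
  from choice[OF this] obtain T' where T': "\<And>i. i \<in> Basis - D \<Longrightarrow> T' i \<in> sets borel"
    "\<And>i. i \<in> Basis - D \<Longrightarrow> {x\<in>cube z \<rho>. \<exists>y\<in>B. \<forall>b\<in>Basis - insert i D. x \<bullet> b = y \<bullet> b} \<subseteq> T' i"
    "\<And>i. i \<in> Basis - D \<Longrightarrow> emeasure lborel (T' i) \<le> ennreal q * ?H" by blast
  define T where "T i = (if i \<in> D then {} else N i \<union> T' i)" for i
  have Tm: "T i \<in> sets borel" if "i \<in> Basis" for i
    using T'(1)[of i] N[of i] that by (auto simp: T_def null_sets_def)
  have Te: "emeasure lborel (cube z \<rho> \<inter> T i) \<le> (if i \<in> D then 0 else ennreal q * ?H)" if i: "i \<in> Basis" for i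
  proof (cases "i \<in> D")
    case False
    have "emeasure lborel (cube z \<rho> \<inter> T i) \<le> emeasure lborel (T i)"
      using Tm[OF i] by (intro emeasure_mono) auto
    also have "\<dots> = emeasure lborel (T' i)"
      using False i N[of i] T'(1)[of i] by (simp add: T_def emeasure_Un_null_set Un_commute[of "N i"])
    also have "\<dots> \<le> ennreal q * ?H" using T'(3)[of i] False i by simp
    finally show ?thesis using False by simp
  qed (simp add: T_def)
  have "emeasure lborel (cube z \<rho> \<inter> W) * emeasure lborel (cube z \<rho> - W)
      \<le> emeasure lborel (cube z \<rho>) * (\<Sum>i\<in>Basis. emeasure lborel (cube z \<rho> \<inter> T i))"
  proof (rule cube_isoperimetric)
    fix i x s assume i: "i \<in> Basis" and x: "x \<in> cube z \<rho>" "x \<notin> T i" "x + s *\<^sub>R i \<in> cube z \<rho>" "x \<in> W"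
    show "x + s *\<^sub>R i \<in> W"
    proof (cases "i \<in> D")
      case True
      then show ?thesis using inv x by blast
    next
      case False
      then have "x \<notin> N i" "x \<notin> T' i" using x(2) by (auto simp: T_def)
      then show ?thesis using cross[of i x s] T'(2)[of i] i x False by blast
    qed
  qed (use Tm in auto)
  also have "(\<Sum>i\<in>Basis. emeasure lborel (cube z \<rho> \<inter> T i)) \<le> (\<Sum>i\<in>Basis. if i \<in> D then 0 else ennreal q * ?H)"
    by (intro sum_mono Te)
  finally have 1: "emeasure lborel (cube z \<rho> \<inter> W) * emeasure lborel (cube z \<rho> - W)
      \<le> emeasure lborel (cube z \<rho>) * (\<Sum>i\<in>Basis. if i \<in> D then 0 else ennreal q * ?H)"
    by (simp add: mult_left_mono)
  have "ennreal (\<alpha> * (2 * \<rho>) ^ ?d) * ennreal (\<alpha> * (2 * \<rho>) ^ ?d)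
      \<le> emeasure lborel (cube z \<rho> \<inter> W) * emeasure lborel (cube z \<rho> - W)"
    by (intro mult_mono d1 d2) auto
  also note 1
  finally have main: "ennreal ((\<alpha> * (2 * \<rho>) ^ ?d) * (\<alpha> * (2 * \<rho>) ^ ?d))
      \<le> ennreal ((2 * \<rho>) ^ ?d) * (\<Sum>i\<in>Basis. if i \<in> D then 0 else ennreal q * ?H)"
    using \<alpha> \<rho> by (simp add: emeasure_cube ennreal_mult)
  have pos: "0 < (\<alpha> * (2 * \<rho>) ^ ?d) * (\<alpha> * (2 * \<rho>) ^ ?d)" using \<alpha> \<rho> by simp
  show DB: "D \<noteq> Basis"
  proof
    assume DB: "D = Basis"
    have "(\<Sum>i\<in>Basis. if i \<in> D then 0 else ennreal q * ?H) = 0" by (simp add: DB)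
    with main have "ennreal ((\<alpha> * (2 * \<rho>) ^ ?d) * (\<alpha> * (2 * \<rho>) ^ ?d)) \<le> 0" by simp
    with pos show False by (simp add: ennreal_le_iff2[of _ 0, simplified])
  qed
  \<comment> \<open>Powers of \<open>2 * \<rho>\<close> are cancelled: the two volumes contribute
    exponent \<open>2 * DIM('a)\<close>, the volume of the cube \<open>DIM('a)\<close>, and each
    projection \<open>card D + 1\<close>, so the exponent \<open>k\<close> remains.\<close>
  show "ennreal (\<alpha>\<^sup>2 * 2 ^ k * unit_ball_vol k / (?d * 4 ^ k) * \<rho> ^ k) \<le> ?H"
  proof (cases "?H")
    case (real \<eta>)
    have q0: "0 \<le> q" using \<rho> v by (simp add: q_def)
    have "(\<Sum>i\<in>Basis. if i \<in> D then 0 else ennreal q * ?H) \<le> (\<Sum>i\<in>(Basis :: 'a set). ennreal q * ?H)"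
      by (intro sum_mono) auto
    also have "\<dots> = ennreal (?d * q * \<eta>)"
      using real q0 by (simp add: ennreal_mult ennreal_of_nat_eq_real_of_nat mult.assoc)
    finally have "ennreal ((\<alpha> * (2 * \<rho>) ^ ?d) * (\<alpha> * (2 * \<rho>) ^ ?d)) \<le> ennreal ((2 * \<rho>) ^ ?d) * ennreal (?d * q * \<eta>)"
      using main by (meson mult_left_mono order_trans zero_le)
    then have "(\<alpha> * (2 * \<rho>) ^ ?d) * (\<alpha> * (2 * \<rho>) ^ ?d) \<le> (2 * \<rho>) ^ ?d * (?d * q * \<eta>)"
      using \<rho> q0 real by (simp add: ennreal_mult[symmetric] ennreal_le_iff)
    then have "(2 * \<rho>) ^ ?d * (\<alpha>\<^sup>2 * (2 * \<rho>) ^ ?d) \<le> (2 * \<rho>) ^ ?d * (?d * q * \<eta>)"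
      by (simp add: power2_eq_square mult_ac)
    then have a: "\<alpha>\<^sup>2 * (2 * \<rho>) ^ ?d \<le> ?d * q * \<eta>" using \<rho> by simp
    have "card D < ?d" using DB D by (simp add: psubset_card_mono psubsetI)
    then have dk: "?d = Suc (card D) + k" by (simp add: k_def)
    have "(2 * \<rho>) ^ Suc (card D) * (\<alpha>\<^sup>2 * (2 * \<rho>) ^ k) \<le> (2 * \<rho>) ^ Suc (card D) * (?d * (4 ^ k / unit_ball_vol k) * \<eta>)"
    proof -
      have "(2 * \<rho>) ^ Suc (card D) * (\<alpha>\<^sup>2 * (2 * \<rho>) ^ k) = \<alpha>\<^sup>2 * (2 * \<rho>) ^ ?d"
        by (subst dk) (simp only: power_add mult_ac)
      also have "\<dots> \<le> ?d * q * \<eta>" by (rule a)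
      also have "\<dots> = (2 * \<rho>) ^ Suc (card D) * (?d * (4 ^ k / unit_ball_vol k) * \<eta>)"
        unfolding q_def by (simp only: mult_ac times_divide_eq_right times_divide_eq_left)
      finally show ?thesis .
    qed
    then have b: "\<alpha>\<^sup>2 * (2 * \<rho>) ^ k \<le> ?d * (4 ^ k / unit_ball_vol k) * \<eta>"
      using \<rho> by (simp only: mult_le_cancel_left_pos zero_less_power zero_less_mult_iff zero_less_numeral simp_thms)
    have d0: "0 < real ?d" by simp
    have "\<alpha>\<^sup>2 * 2 ^ k * unit_ball_vol k / (?d * 4 ^ k) * \<rho> ^ k = (\<alpha>\<^sup>2 * (2 * \<rho>) ^ k) * (unit_ball_vol k / (?d * 4 ^ k))"
      by (simp add: power_mult_distrib)
    also have "\<dots> \<le> (?d * (4 ^ k / unit_ball_vol k) * \<eta>) * (unit_ball_vol k / (?d * 4 ^ k))"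
      using b v by (intro mult_right_mono) auto
    also have "\<dots> = \<eta>" using v d0 by (simp add: less_imp_neq[symmetric] del: unit_ball_vol_pos)
    finally show ?thesis using real by (simp add: ennreal_leI)
  qed simp
qed

text \<open>The selected balls are disjoint, so their shares \<open>c * r j ^ k\<close> of
  \<open>B\<close> add up to at most the measure of \<open>B\<close>, while their fivefold
  enlargements reach every centre. Indices are kept apart from centres because in a slice different
  points may be lifted to the same centre.\<close>

lemma vitali_hausdorff_select:
  fixes a :: "'i \<Rightarrow> 'a::euclidean_space"
  assumes B: "B \<in> sets borel" and r: "\<And>i. i \<in> A \<Longrightarrow> 0 < r i \<and> r i \<le> R"
    and c: "\<And>i. i \<in> A \<Longrightarrow> ennreal (c * r i ^ k) \<le> hausdorff_outer k (B \<inter> cball (a i) (r i))" and "0 \<le> c"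
  obtains C where "countable C" "C \<subseteq> A" "\<And>i. i \<in> A \<Longrightarrow> \<exists>j\<in>C. a i \<in> cball (a j) (5 * r j)"
    "ennreal c * (\<integral>\<^sup>+j. ennreal (r j ^ k) \<partial>count_space C) \<le> hausdorff_outer k B"
proof -
  have "a ` A \<subseteq> (\<Union>i\<in>A. cball (a i) (r i))" using r by (force simp: less_imp_le)
  from Vitali_covering_lemma_cballs[OF this r] obtain C where C: "countable C" "C \<subseteq> A"
    "pairwise (\<lambda>i j. disjnt (cball (a i) (r i)) (cball (a j) (r j))) C"
    "a ` A \<subseteq> (\<Union>i\<in>C. cball (a i) (5 * r i))" by blast
  have m: "B \<inter> cball (a i) (r i) \<in> sets (hausdorff k)" for i
    using B by (intro borel_sets_hausdorff) auto
  have "ennreal c * (\<integral>\<^sup>+j. ennreal (r j ^ k) \<partial>count_space C) = (\<integral>\<^sup>+j. ennreal (c * r j ^ k) \<partial>count_space C)"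
    using \<open>0 \<le> c\<close> by (subst nn_integral_cmult[symmetric]) (auto simp: ennreal_mult')
  also have "\<dots> \<le> (\<integral>\<^sup>+j. emeasure (hausdorff k) (B \<inter> cball (a j) (r j)) \<partial>count_space C)"
    using C(2) c by (intro nn_integral_mono) (auto simp: emeasure_hausdorff[OF m])
  also have "\<dots> = emeasure (hausdorff k) (\<Union>j\<in>C. B \<inter> cball (a j) (r j))"
    using C m by (intro emeasure_UN_countable[symmetric])
      (auto simp: disjoint_family_on_def pairwise_def disjnt_def)
  also have "\<dots> = hausdorff_outer k (\<Union>j\<in>C. B \<inter> cball (a j) (r j))"
    using C(1) m by (intro emeasure_hausdorff sets.countable_UN') auto
  also have "\<dots> \<le> hausdorff_outer k B" by (rule hausdorff_outer_mono) auto
  finally have "ennreal c * (\<integral>\<^sup>+j. ennreal (r j ^ k) \<partial>count_space C) \<le> hausdorff_outer k B" .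
  moreover have "\<exists>j\<in>C. a i \<in> cball (a j) (5 * r j)" if "i \<in> A" for i
    using C(4) that by blast
  ultimately show ?thesis using that C(1,2) by blast
qed

lemma hausdorff_weight_le:
  assumes "bounded S" "diameter S \<le> 2 * R" "0 \<le> R"
  shows "hausdorff_weight k S \<le> ennreal (unit_ball_vol k * R ^ k)"
proof -
  have "0 \<le> diameter S / 2" "diameter S / 2 \<le> R" using assms diameter_ge_0[OF assms(1)] by auto
  then show ?thesis using assms
    by (auto simp: hausdorff_weight_def intro!: ennreal_leI mult_left_mono power_mono)
qed

text \<open>A Vitali argument: the fivefold balls cover \<open>A\<close> with weight at most
  \<open>unit_ball_vol k * 5 ^ k * r ^ k\<close> each, and each of the disjoint balls pays with a
  share \<open>c * r ^ k\<close> of \<open>B\<close>.\<close>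

lemma hausdorff_le_of_lower_density:
  fixes A :: "'a::euclidean_space set"
  assumes B: "B \<in> sets borel" and c: "0 < c"
    and dens: "\<And>x \<delta>. x \<in> A \<Longrightarrow> 0 < \<delta> \<Longrightarrow> \<exists>r. 0 < r \<and> r < \<delta> \<and> ennreal (c * r ^ k) \<le> hausdorff_outer k (B \<inter> cball x r)"
  shows "ennreal c * hausdorff_outer k A \<le> ennreal (unit_ball_vol k * 5 ^ k) * hausdorff_outer k B"
proof -
  have "ennreal c * hausdorff_pre k \<delta> A \<le> ennreal (unit_ball_vol k * 5 ^ k) * hausdorff_outer k B" if \<delta>: "0 < \<delta>" for \<delta>
  proof -
    \<comment> \<open>A ball of radius \<open>5 * r\<close> with \<open>r < \<delta> / 10\<close>
      has diameter at most \<open>\<delta>\<close>.\<close>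
    have "\<forall>x. \<exists>r. x \<in> A \<longrightarrow> 0 < r \<and> r < \<delta> / 10 \<and> ennreal (c * r ^ k) \<le> hausdorff_outer k (B \<inter> cball x r)"
      using dens[of _ "\<delta> / 10"] \<delta> by simp
    from choice[OF this] obtain r where "\<And>x. x \<in> A \<Longrightarrow> 0 < r x \<and> r x < \<delta> / 10"
      "\<And>x. x \<in> A \<Longrightarrow> ennreal (c * r x ^ k) \<le> hausdorff_outer k (B \<inter> cball x (r x))"
      by blast
    then have r: "\<And>x. x \<in> A \<Longrightarrow> 0 < r x \<and> r x \<le> \<delta> / 10"
      "\<And>x. x \<in> A \<Longrightarrow> ennreal (c * r x ^ k) \<le> hausdorff_outer k (B \<inter> cball x (r x))"
      by (simp_all add: less_imp_le)
    obtain C where C: "countable C" "C \<subseteq> A" "\<And>x. x \<in> A \<Longrightarrow> \<exists>j\<in>C. x \<in> cball j (5 * r j)"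
      "ennreal c * (\<integral>\<^sup>+j. ennreal (r j ^ k) \<partial>count_space C) \<le> hausdorff_outer k B"
      using vitali_hausdorff_select[of B A r "\<delta> / 10" c k "\<lambda>x. x"] B r c by (auto simp: less_imp_le)
    have "hausdorff_pre k \<delta> A \<le> hausdorff_pre k \<delta> (\<Union>j\<in>C. cball j (5 * r j))"
      using C(3) by (intro hausdorff_pre_mono) auto
    also have "\<dots> \<le> (\<integral>\<^sup>+j. hausdorff_pre k \<delta> (cball j (5 * r j)) \<partial>count_space C)"
      using C(1) \<delta> by (intro hausdorff_pre_UN_countable_le) auto
    also have "\<dots> \<le> (\<integral>\<^sup>+j. ennreal (unit_ball_vol k * 5 ^ k) * ennreal (r j ^ k) \<partial>count_space C)"
    proof (intro nn_integral_mono)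
      fix j assume "j \<in> space (count_space C)"
      then have j: "0 < r j" "r j \<le> \<delta> / 10" using r C(2) by auto
      then have "hausdorff_pre k \<delta> (cball j (5 * r j)) \<le> hausdorff_weight k (cball j (5 * r j))"
        by (intro hausdorff_pre_le_weight) auto
      also have "\<dots> \<le> ennreal (unit_ball_vol k * (5 * r j) ^ k)"
        using j by (intro hausdorff_weight_le) auto
      also have "\<dots> = ennreal (unit_ball_vol k * 5 ^ k) * ennreal (r j ^ k)"
        using j by (simp add: ennreal_mult[symmetric] power_mult_distrib mult.assoc)
      finally show "hausdorff_pre k \<delta> (cball j (5 * r j)) \<le> ennreal (unit_ball_vol k * 5 ^ k) * ennreal (r j ^ k)" .
    qed
    also have "\<dots> = ennreal (unit_ball_vol k * 5 ^ k) * (\<integral>\<^sup>+j. ennreal (r j ^ k) \<partial>count_space C)"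
      by (rule nn_integral_cmult) auto
    finally have "ennreal c * hausdorff_pre k \<delta> A
        \<le> ennreal c * (ennreal (unit_ball_vol k * 5 ^ k) * (\<integral>\<^sup>+j. ennreal (r j ^ k) \<partial>count_space C))"
      by (rule mult_left_mono) auto
    also have "\<dots> = ennreal (unit_ball_vol k * 5 ^ k) * (ennreal c * (\<integral>\<^sup>+j. ennreal (r j ^ k) \<partial>count_space C))"
      by (simp only: mult_ac)
    also have "\<dots> \<le> ennreal (unit_ball_vol k * 5 ^ k) * hausdorff_outer k B"
      by (rule mult_left_mono[OF C(4)]) auto
    finally show ?thesis .
  qed
  then show ?thesis
    unfolding hausdorff_outer_def[of k A] by (auto simp: SUP_mult_left_ennreal intro!: SUP_least)
qed

text \<open>Points just below the level \<open>t\<close> are covered by cylinders of height \<open>r\<close> over the balls selected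
  in the slice; a cylinder of radius \<open>\<rho>\<close> is cut into about \<open>r / \<rho>\<close> pieces of diameter comparable to \<open>\<rho>\<close>.\<close>

lemma hausdorff_pre_le_slice:
  fixes v :: "'a::euclidean_space"
  assumes B: "B \<in> sets borel" and c: "0 < c" and v: "norm v = 1" and r: "0 < r" and M: "1 \<le> M"
    and A: "\<And>z. z \<in> A \<Longrightarrow> t - r < z \<bullet> v \<and> z \<bullet> v \<le> t"
    and dens: "\<And>z. z \<in> A \<Longrightarrow> \<exists>\<rho>. 0 < \<rho> \<and> \<rho> \<le> M * r \<and> ennreal (c * \<rho> ^ k) \<le> hausdorff_outer k (B \<inter> cball (z + (t - z \<bullet> v) *\<^sub>R v) \<rho>)"
  shows "ennreal c * hausdorff_pre (Suc k) (11 * M * r) A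
     \<le> ennreal (unit_ball_vol (Suc k) * 6 ^ Suc k * (2 * M * r)) * hausdorff_outer k B"
proof -
  define a where "a z = z + (t - z \<bullet> v) *\<^sub>R v" for z
  have "\<forall>z. \<exists>\<rho>. z \<in> A \<longrightarrow> 0 < \<rho> \<and> \<rho> \<le> M * r \<and> ennreal (c * \<rho> ^ k) \<le> hausdorff_outer k (B \<inter> cball (a z) \<rho>)"
    using dens unfolding a_def by blast
  from choice[OF this] obtain \<rho> where \<rho>: "\<And>z. z \<in> A \<Longrightarrow> 0 < \<rho> z \<and> \<rho> z \<le> M * r"
    "\<And>z. z \<in> A \<Longrightarrow> ennreal (c * \<rho> z ^ k) \<le> hausdorff_outer k (B \<inter> cball (a z) (\<rho> z))" by blast
  obtain C where C: "countable C" "C \<subseteq> A" "\<And>z. z \<in> A \<Longrightarrow> \<exists>j\<in>C. a z \<in> cball (a j) (5 * \<rho> j)"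
    "ennreal c * (\<integral>\<^sup>+j. ennreal (\<rho> j ^ k) \<partial>count_space C) \<le> hausdorff_outer k B"
    using vitali_hausdorff_select[of B A \<rho> "M * r" c k a] B \<rho> c by (auto simp: less_imp_le)
  \<comment> \<open>The points of \<open>A\<close> whose lift to level \<open>t\<close> falls into
    the enlarged ball of \<open>j\<close>: part of a vertical cylinder of radius
    \<open>5 * \<rho> j\<close> and height at most \<open>r\<close>.\<close>
  define Y where "Y j = {z\<in>A. a z \<in> cball (a j) (5 * \<rho> j)}" for j
  let ?\<delta> = "11 * M * r" and ?q = "unit_ball_vol (Suc k) * 6 ^ Suc k"
  have cyl: "hausdorff_pre (Suc k) ?\<delta> (Y j) \<le> ennreal (?q * (2 * M * r)) * ennreal (\<rho> j ^ k)" if "j \<in> C" for j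
  proof -
    have j: "0 < \<rho> j" "\<rho> j \<le> M * r" using \<rho> C(2) that by auto
    \<comment> \<open>Pieces of height \<open>\<rho> j\<close>. Two points of a piece differ by at
      most \<open>10 * \<rho> j\<close> after lifting and by at most \<open>\<rho> j\<close> in
      height, which gives the factor 11 in the diameter and, rounding up its half, the factor 6 in
      the weight.\<close>
    define n where "n = nat \<lfloor>r / \<rho> j\<rfloor> + 1"
    define Z where "Z l = {z\<in>Y j. real l * \<rho> j \<le> t - z \<bullet> v \<and> t - z \<bullet> v \<le> (real l + 1) * \<rho> j}" for l :: nat
    have Zd: "norm (x - y) \<le> 11 * \<rho> j" if "x \<in> Z l" "y \<in> Z l" for x y l
    proof -
      have "norm (a x - a y) \<le> norm (a x - a j) + norm (a j - a y)"
        by (metis norm_triangle_ineq diff_add_cancel add_diff_eq)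
      also have "\<dots> \<le> 10 * \<rho> j"
        using that by (auto simp: Z_def Y_def dist_norm norm_minus_commute)
      finally have 1: "norm (a x - a y) \<le> 10 * \<rho> j" .
      have "\<bar>x \<bullet> v - y \<bullet> v\<bar> \<le> \<rho> j"
        using that by (auto simp: Z_def abs_le_iff algebra_simps)
      then have 2: "norm ((x \<bullet> v - y \<bullet> v) *\<^sub>R v) \<le> \<rho> j" by (simp add: v)
      have "x - y = (a x - a y) + (x \<bullet> v - y \<bullet> v) *\<^sub>R v"
        by (simp add: a_def algebra_simps)
      then have "norm (x - y) \<le> norm (a x - a y) + norm ((x \<bullet> v - y \<bullet> v) *\<^sub>R v)"
        by (metis norm_triangle_ineq)
      with 1 2 show ?thesis by linarith
    qed
    have Zb: "bounded (Z l)" for l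
    proof (cases "Z l = {}")
      case False
      then obtain y where "y \<in> Z l" by auto
      then have "Z l \<subseteq> cball y (11 * \<rho> j)"
        using Zd by (auto simp: dist_norm norm_minus_commute)
      then show ?thesis using bounded_cball bounded_subset by blast
    qed simp
    have Zdiam: "diameter (Z l) \<le> 11 * \<rho> j" for l
      using Zd j by (intro diameter_le) auto
    have "Y j \<subseteq> (\<Union>l\<in>{..<n}. Z l)"
    proof
      fix z assume z: "z \<in> Y j"
      then have "z \<in> A" by (simp add: Y_def)
      then have h: "0 \<le> t - z \<bullet> v" "t - z \<bullet> v < r" using A[of z] by linarith+
      define l where "l = nat \<lfloor>(t - z \<bullet> v) / \<rho> j\<rfloor>"
      have "0 \<le> (t - z \<bullet> v) / \<rho> j" using h j by simp
      then have "real l = of_int \<lfloor>(t - z \<bullet> v) / \<rho> j\<rfloor>" by (simp add: l_def)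
      then have "real l \<le> (t - z \<bullet> v) / \<rho> j" "(t - z \<bullet> v) / \<rho> j \<le> real l + 1"
        by linarith+
      then have "z \<in> Z l" using z j by (simp add: Z_def pos_le_divide_eq pos_divide_le_eq)
      moreover have "(t - z \<bullet> v) / \<rho> j \<le> r / \<rho> j" using h j by (simp add: divide_right_mono)
      then have "l \<le> nat \<lfloor>r / \<rho> j\<rfloor>" unfolding l_def by (intro nat_mono floor_mono)
      then have "l < n" by (simp add: n_def)
      ultimately show "z \<in> (\<Union>l\<in>{..<n}. Z l)" by blast
    qed
    then have "hausdorff_pre (Suc k) ?\<delta> (Y j) \<le> hausdorff_pre (Suc k) ?\<delta> (\<Union>l\<in>{..<n}. Z l)"
      by (rule hausdorff_pre_mono)
    also have "\<dots> \<le> (\<integral>\<^sup>+l. hausdorff_pre (Suc k) ?\<delta> (Z l) \<partial>count_space {..<n})"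
      using r M by (intro hausdorff_pre_UN_countable_le) auto
    also have "\<dots> \<le> (\<integral>\<^sup>+l. ennreal (?q * \<rho> j ^ Suc k) \<partial>count_space {..<n})"
    proof (rule nn_integral_mono)
      fix l
      have "diameter (Z l) \<le> ?\<delta>" using Zdiam[of l] j by (simp add: mult.assoc)
      then have "hausdorff_pre (Suc k) ?\<delta> (Z l) \<le> hausdorff_weight (Suc k) (Z l)"
        using Zb by (rule hausdorff_pre_le_weight[rotated])
      also have "\<dots> \<le> ennreal (unit_ball_vol (Suc k) * (6 * \<rho> j) ^ Suc k)"
        using Zb Zdiam[of l] j by (intro hausdorff_weight_le) auto
      also have "unit_ball_vol (Suc k) * (6 * \<rho> j) ^ Suc k = ?q * \<rho> j ^ Suc k"
        by (simp only: power_mult_distrib mult.assoc)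
      finally show "hausdorff_pre (Suc k) ?\<delta> (Z l) \<le> ennreal (?q * \<rho> j ^ Suc k)" .
    qed
    also have "\<dots> = of_nat n * ennreal (?q * \<rho> j ^ Suc k)"
      by (simp add: mult.commute)
    also have "\<dots> = ennreal (real n * (?q * \<rho> j ^ Suc k))"
      by (simp only: ennreal_of_nat_eq_real_of_nat ennreal_mult'[OF of_nat_0_le_iff])
    \<comment> \<open>There are about \<open>r / \<rho> j\<close> pieces of weight of order
      \<open>\<rho> j ^ (k + 1)\<close>, together of order at most \<open>r * \<rho> j ^ k\<close>.
      The factor \<open>r\<close> is cancelled later, when the estimate is averaged over an interval
      of levels of length \<open>r / 4\<close>.\<close>
    also have "\<dots> \<le> ennreal ((?q * (2 * M * r)) * \<rho> j ^ k)"
    proof (rule ennreal_leI)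
      have "0 \<le> r / \<rho> j" using r j by simp
      then have "real n \<le> r / \<rho> j + 1" unfolding n_def by linarith
      then have "real n * \<rho> j \<le> (r / \<rho> j + 1) * \<rho> j" using j by (intro mult_right_mono) auto
      also have "\<dots> = r + \<rho> j" using j by (simp add: field_simps)
      also have "\<dots> \<le> 2 * M * r"
      proof -
        have "1 * r \<le> M * r" using M r by (intro mult_right_mono) auto
        with j show ?thesis by linarith
      qed
      finally have *: "real n * \<rho> j \<le> 2 * M * r" .
      have "real n * (?q * \<rho> j ^ Suc k) = (real n * \<rho> j) * (?q * \<rho> j ^ k)" by (simp only: power_Suc mult_ac)
      also have "\<dots> \<le> (2 * M * r) * (?q * \<rho> j ^ k)" using * j by (intro mult_right_mono) auto
      finally show "real n * (?q * \<rho> j ^ Suc k) \<le> (?q * (2 * M * r)) * \<rho> j ^ k" by (simp only: mult_ac)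
    qed
    also have "\<dots> = ennreal (?q * (2 * M * r)) * ennreal (\<rho> j ^ k)"
      using j M r by (intro ennreal_mult) auto
    finally show ?thesis .
  qed
  have "hausdorff_pre (Suc k) ?\<delta> A \<le> hausdorff_pre (Suc k) ?\<delta> (\<Union>j\<in>C. Y j)"
    using C(3) by (intro hausdorff_pre_mono) (auto simp: Y_def)
  also have "\<dots> \<le> (\<integral>\<^sup>+j. hausdorff_pre (Suc k) ?\<delta> (Y j) \<partial>count_space C)"
    using C(1) r M by (intro hausdorff_pre_UN_countable_le) auto
  also have "\<dots> \<le> (\<integral>\<^sup>+j. ennreal (?q * (2 * M * r)) * ennreal (\<rho> j ^ k) \<partial>count_space C)"
    using cyl by (intro nn_integral_mono) auto
  also have "\<dots> = ennreal (?q * (2 * M * r)) * (\<integral>\<^sup>+j. ennreal (\<rho> j ^ k) \<partial>count_space C)"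
    by (rule nn_integral_cmult) auto
  finally have "ennreal c * hausdorff_pre (Suc k) ?\<delta> A
      \<le> ennreal c * (ennreal (?q * (2 * M * r)) * (\<integral>\<^sup>+j. ennreal (\<rho> j ^ k) \<partial>count_space C))"
    by (rule mult_left_mono) auto
  also have "\<dots> = ennreal (?q * (2 * M * r)) * (ennreal c * (\<integral>\<^sup>+j. ennreal (\<rho> j ^ k) \<partial>count_space C))"
    by (simp only: mult_ac)
  also have "\<dots> \<le> ennreal (?q * (2 * M * r)) * hausdorff_outer k B"
    by (rule mult_left_mono[OF C(4)]) auto
  finally show ?thesis .
qed

subsection \<open>Weak derivatives along lines\<close>

text \<open>Products suffice as test functions: a derivative or a shift along a basis vector touches
  one factor only, and products of bumps approximate indicators of boxes.\<close>

definition tensor :: "('a \<Rightarrow> real \<Rightarrow> real) \<Rightarrow> 'a::euclidean_space \<Rightarrow> real" where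
  "tensor \<beta> x = (\<Prod>b\<in>Basis. \<beta> b (x \<bullet> b))"

lemma Ck_tensor:
  fixes \<beta> :: "'a::euclidean_space \<Rightarrow> real \<Rightarrow> real"
  assumes "\<And>b. b \<in> Basis \<Longrightarrow> Ck k (\<beta> b)"
  shows "Ck k (tensor \<beta>)"
proof -
  have "linear (\<lambda>x::'a. x \<bullet> b)" for b by (rule linearI) (auto simp: inner_add_left)
  from Ck_affine[OF this, where c=0] have "Ck k (\<lambda>x. \<beta> b (x \<bullet> b))" if "b \<in> Basis" for b
    using assms[OF that] by simp
  then show ?thesis unfolding tensor_def[abs_def] by (rule Ck_prod)
qed

lemma tensor_nonzero_imp:
  assumes "\<And>b t. b \<in> Basis \<Longrightarrow> t \<notin> {a \<bullet> b..c \<bullet> b} \<Longrightarrow> \<beta> b t = 0" "tensor \<beta> x \<noteq> 0"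
  shows "x \<in> cbox a c"
  unfolding mem_box
proof
  fix b :: 'a assume b: "b \<in> Basis"
  with assms(2) have "\<beta> b (x \<bullet> b) \<noteq> 0" unfolding tensor_def by (metis finite_Basis prod_zero)
  then show "a \<bullet> b \<le> x \<bullet> b \<and> x \<bullet> b \<le> c \<bullet> b" using assms(1)[OF b, of "x \<bullet> b"] by auto
qed

lemma test_function_tensor:
  fixes \<Omega> :: "'a::euclidean_space set"
  assumes "\<And>b k. b \<in> Basis \<Longrightarrow> Ck k (\<beta> b)"
    and "\<And>b t. b \<in> Basis \<Longrightarrow> t \<notin> {a \<bullet> b..c \<bullet> b} \<Longrightarrow> \<beta> b t = 0" and "cbox a c \<subseteq> \<Omega>"
  shows "test_function \<Omega> (tensor \<beta>)"
proof -
  have "{x. tensor \<beta> x \<noteq> 0} \<subseteq> cbox a c"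
    using tensor_nonzero_imp[of a c \<beta>] assms(2) by blast
  then have "closure {x. tensor \<beta> x \<noteq> 0} \<subseteq> cbox a c"
    by (intro closure_minimal) auto
  then have "compact (closure {x. tensor \<beta> x \<noteq> 0})" "closure {x. tensor \<beta> x \<noteq> 0} \<subseteq> \<Omega>"
    using assms(3) by (meson bounded_cbox bounded_subset closed_closure compact_eq_bounded_closed order_trans)+
  then show ?thesis
    using assms(1) by (simp add: test_function_def Ck_tensor)
qed

lemma frechet_derivative_tensor:
  fixes x :: "'a::euclidean_space"
  assumes w: "w \<in> Basis" and C: "\<And>b. b \<in> Basis \<Longrightarrow> Ck 1 (\<beta> b)"
    and d: "(\<beta> w has_real_derivative \<beta>') (at (x \<bullet> w))"
  shows "frechet_derivative (tensor \<beta>) (at x) w = \<beta>' * (\<Prod>b\<in>Basis - {w}. \<beta> b (x \<bullet> b))"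
proof -
  let ?D = "frechet_derivative (tensor \<beta>) (at x)"
  let ?P = "\<Prod>b\<in>Basis - {w}. \<beta> b (x \<bullet> b)"
  have C1: "Ck (Suc 0) (tensor \<beta>)" using C by (intro Ck_tensor) simp
  have D: "(tensor \<beta> has_derivative ?D) (at (x + 0 *\<^sub>R w))"
    using Ck_SucD(1)[OF C1] by simp
  have "((\<lambda>t. x + t *\<^sub>R w) has_derivative (\<lambda>t. t *\<^sub>R w)) (at 0)"
    by (auto intro!: derivative_eq_intros)
  from has_derivative_compose[OF this D]
  have "((\<lambda>t. tensor \<beta> (x + t *\<^sub>R w)) has_derivative (\<lambda>t. ?D (t *\<^sub>R w))) (at 0)" .
  moreover have "(\<lambda>t. ?D (t *\<^sub>R w)) = (\<lambda>t. ?D w * t)"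
    using has_derivative_linear[OF D] by (auto simp: linear_cmul)
  ultimately have 1: "((\<lambda>t. tensor \<beta> (x + t *\<^sub>R w)) has_real_derivative ?D w) (at 0)"
    unfolding has_field_derivative_def by simp
  have "tensor \<beta> (x + t *\<^sub>R w) = \<beta> w (x \<bullet> w + t) * ?P" for t
  proof -
    have "tensor \<beta> (x + t *\<^sub>R w) = \<beta> w ((x + t *\<^sub>R w) \<bullet> w) * (\<Prod>b\<in>Basis - {w}. \<beta> b ((x + t *\<^sub>R w) \<bullet> b))"
      unfolding tensor_def using w by (intro prod.remove) auto
    also have "(\<Prod>b\<in>Basis - {w}. \<beta> b ((x + t *\<^sub>R w) \<bullet> b)) = ?P"
      using w by (intro prod.cong) (auto simp: inner_add_left inner_Basis)
    finally show ?thesis using w by (simp add: inner_add_left)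
  qed
  moreover have "((\<lambda>t. \<beta> w (x \<bullet> w + t) * ?P) has_real_derivative \<beta>' * ?P) (at 0)"
  proof -
    have "((\<lambda>t. \<beta> w (x \<bullet> w + t)) has_real_derivative \<beta>' * 1) (at 0)"
      using d by (intro DERIV_chain2[where f="\<beta> w"]) (auto intro!: derivative_eq_intros)
    then show ?thesis by (auto intro!: derivative_eq_intros)
  qed
  ultimately have 2: "((\<lambda>t. tensor \<beta> (x + t *\<^sub>R w)) has_real_derivative \<beta>' * ?P) (at 0)"
    by simp
  show ?thesis using DERIV_unique[OF 1 2] .
qed

lemma antiderivative_vanishing_below:
  fixes \<beta> :: "real \<Rightarrow> real"
  assumes c: "continuous_on UNIV \<beta>" and z: "\<And>t. t < a \<Longrightarrow> \<beta> t = 0"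
  obtains G where "\<And>t. (G has_real_derivative \<beta> t) (at t)"
proof
  \<comment> \<open>Starting one unit below \<open>a\<close> puts every \<open>t \<ge> a\<close>
    into the interior of the interval on which the fundamental theorem is used; for
    \<open>t < a - 1\<close> the interval is empty and the integral is 0, as it should be.\<close>
  let ?G = "\<lambda>t. integral {a - 1..t} \<beta>"
  fix t
  show "(?G has_real_derivative \<beta> t) (at t)"
  proof (cases "t < a")
    case True
    have G0: "?G s = 0" if "s < a" for s
      using that z by (intro integral_unique has_integral_is_0) auto
    have "((\<lambda>s. 0) has_real_derivative \<beta> t) (at t)" using z[OF True] by simp
    then show ?thesis
      by (rule has_field_derivative_transform_within_open[where S="{..<a}"]) (use True G0 in auto)
  next
    case False
    have "(?G has_real_derivative \<beta> t) (at t within {a - 1..t + 1})"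
      using False by (intro integral_has_real_derivative continuous_on_subset[OF c]) auto
    moreover have "at t within {a - 1..t + 1} = at t"
      using False by (intro at_within_interior) auto
    ultimately show ?thesis by simp
  qed
qed

lemma lborel_translate:
  fixes f :: "'a::euclidean_space \<Rightarrow> 'b::{banach, second_countable_topology}"
  assumes [measurable]: "f \<in> borel_measurable borel"
  shows integral_lborel_translate: "(LINT x|lborel. f (x + c)) = (LINT x|lborel. f x)"
    and integrable_lborel_translate: "integrable lborel (\<lambda>x. f (x + c)) \<longleftrightarrow> integrable lborel f"
proof -
  have eq: "distr lborel borel ((+) c) = (lborel :: 'a measure)" by (rule lborel_distr_plus)
  have "(LINT x|lborel. f x) = (LINT x|distr lborel borel ((+) c). f x)" by (simp add: eq)
  also have "\<dots> = (LINT x|lborel. f (x + c))" by (subst integral_distr) (auto simp: add.commute)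
  finally show "(LINT x|lborel. f (x + c)) = (LINT x|lborel. f x)" by simp
  have "integrable lborel f \<longleftrightarrow> integrable (distr lborel borel ((+) c)) f" by (simp add: eq)
  also have "\<dots> \<longleftrightarrow> integrable lborel (\<lambda>x. f (x + c))"
    by (subst integrable_distr_eq) (auto simp: add.commute)
  finally show "integrable lborel (\<lambda>x. f (x + c)) \<longleftrightarrow> integrable lborel f" by simp
qed

text \<open>The weak derivative is represented by a Borel function on the whole space, so that it can be
  integrated along lines.\<close>

definition weak_dir :: "'a::euclidean_space set \<Rightarrow> ('a \<Rightarrow> real) \<Rightarrow> 'a \<Rightarrow> ('a \<Rightarrow> real) \<Rightarrow> bool" where
  "weak_dir \<Omega> u w V \<longleftrightarrow> V \<in> borel_measurable borel \<and>
     (\<forall>K. compact K \<and> K \<subseteq> \<Omega> \<longrightarrow> set_integrable lborel K V) \<and>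
     (\<forall>\<psi>. test_function \<Omega> \<psi> \<longrightarrow>
        (LINT x:\<Omega>|lborel. u x * frechet_derivative \<psi> (at x) w) = - (LINT x:\<Omega>|lborel. V x * \<psi> x))"

text \<open>The integral of \<open>tensor \<beta> (x - \<tau> *\<^sub>R w)\<close> over
  \<open>\<tau>\<close> in \<open>{0..s}\<close> is a test function with \<open>w\<close>-derivative
  \<open>tensor \<beta> x - tensor \<beta> (x - s *\<^sub>R w)\<close>. Inserting it into the
  definition of the weak derivative and moving the shifts to the other factor gives the fundamental
  theorem of calculus in weak form. Cutting off with \<open>K\<close> makes the functions integrable
  on the whole space.\<close>

lemma weak_dir_shift:
  fixes \<Omega> :: "'a::euclidean_space set"
  assumes w: "w \<in> Basis" and wd: "weak_dir \<Omega> u w V" and u: "continuous_on \<Omega> u"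
    and s: "0 < s" and sub: "cbox l (h + s *\<^sub>R w) \<subseteq> \<Omega>"
  defines "K \<equiv> cbox l (h + s *\<^sub>R w)"
  defines "u1 \<equiv> \<lambda>x. indicator K x * u x" and "v1 \<equiv> \<lambda>x. indicator K x * V x"
  defines "f \<equiv> \<lambda>x. u1 (x + s *\<^sub>R w) - u1 x - (LINT \<tau>|lborel. indicator {0..s} \<tau> * v1 (x + \<tau> *\<^sub>R w))"
  shows "integrable lborel f"
    and "\<lbrakk>\<And>b k. b \<in> Basis \<Longrightarrow> Ck k (\<beta> b); \<And>b t. b \<in> Basis \<Longrightarrow> t \<notin> {l \<bullet> b..h \<bullet> b} \<Longrightarrow> \<beta> b t = 0;
       \<And>b t. b \<in> Basis \<Longrightarrow> \<bar>\<beta> b t\<bar> \<le> 1\<rbrakk> \<Longrightarrow> (LINT x|lborel. f x * tensor \<beta> x) = 0"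
proof -
  have Kc: "compact K" "K \<subseteq> \<Omega>" using sub by (auto simp: K_def)
  have [measurable]: "K \<in> sets borel" by (simp add: K_def)
  have iu: "integrable lborel u1"
    using borel_integrable_compact[OF Kc(1) continuous_on_subset[OF u Kc(2)]] by (simp add: u1_def)
  have iv: "integrable lborel v1"
    using wd Kc unfolding weak_dir_def set_integrable_def v1_def by simp
  have [measurable]: "u1 \<in> borel_measurable borel" "v1 \<in> borel_measurable borel"
    using iu iv by (auto dest: borel_measurable_integrable)
  let ?I = "\<lambda>\<tau>. indicator {0..s} \<tau> :: real"
  have [measurable]: "(\<lambda>p::real \<times> 'a. snd p + fst p *\<^sub>R w) \<in> borel_measurable (borel \<Otimes>\<^sub>M borel)" by measurable
  have iI: "integrable lborel ?I" using s by (intro integrable_real_indicator) auto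
  have ig: "integrable (lborel \<Otimes>\<^sub>M lborel) (\<lambda>(\<tau>, x). ?I \<tau> * v1 (x + \<tau> *\<^sub>R w))"
  proof (rule lborel_pair.Fubini_integrable)
    have "(LINT x|lborel. norm (?I \<tau> * v1 (x + \<tau> *\<^sub>R w))) = ?I \<tau> * (LINT x|lborel. \<bar>v1 x\<bar>)" for \<tau>
      by (simp add: abs_mult integral_lborel_translate[where f="\<lambda>x. \<bar>v1 x\<bar>"])
    then show "integrable lborel (\<lambda>\<tau>. LINT x|lborel. norm (case (\<tau>, x) of (\<tau>, x) \<Rightarrow> ?I \<tau> * v1 (x + \<tau> *\<^sub>R w)))"
      using iI by simp
    show "AE \<tau> in lborel. integrable lborel (\<lambda>x. case (\<tau>, x) of (\<tau>, x) \<Rightarrow> ?I \<tau> * v1 (x + \<tau> *\<^sub>R w))"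
      using iv by (simp add: integrable_lborel_translate)
  qed measurable
  have iG: "integrable lborel (\<lambda>x. LINT \<tau>|lborel. ?I \<tau> * v1 (x + \<tau> *\<^sub>R w))"
    using lborel_pair.integrable_snd[OF ig] by simp
  show f_int: "integrable lborel f"
    unfolding f_def using iu iG by (intro Bochner_Integration.integrable_diff) (auto simp: integrable_lborel_translate)
  assume \<beta>C: "\<And>b k. b \<in> Basis \<Longrightarrow> Ck k (\<beta> b)"
    and \<beta>0: "\<And>b t. b \<in> Basis \<Longrightarrow> t \<notin> {l \<bullet> b..h \<bullet> b} \<Longrightarrow> \<beta> b t = 0"
    and \<beta>1: "\<And>b t. b \<in> Basis \<Longrightarrow> \<bar>\<beta> b t\<bar> \<le> 1"
  let ?\<psi> = "tensor \<beta>"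
  have c\<psi>: "continuous_on UNIV ?\<psi>"
    using Ck_tensor[where k=0, OF \<beta>C] by simp
  have [measurable]: "?\<psi> \<in> borel_measurable borel"
    using c\<psi> by (rule borel_measurable_continuous_onI)
  have \<psi>1: "\<bar>?\<psi> x\<bar> \<le> 1" for x
    unfolding tensor_def abs_prod using \<beta>1 by (intro prod_le_1) auto
  have bnd: "integrable lborel (\<lambda>x. q x * ?\<psi> (x - c))"
    if "integrable lborel q" for q and c
    using that \<psi>1 by (intro Bochner_Integration.integrable_bound[OF that])
      (auto simp: abs_mult intro!: mult_left_le)
  have \<beta>w: "continuous_on UNIV (\<beta> w)" using \<beta>C[OF w, of 0] by simp
  obtain G where G: "\<And>t. (G has_real_derivative \<beta> w t) (at t)"
    using antiderivative_vanishing_below[OF \<beta>w, of "l \<bullet> w"] \<beta>0[OF w] by (metis atLeastAtMost_iff not_less)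
  \<comment> \<open>\<open>B\<close> is \<open>\<beta> w\<close> integrated over a window of length
    \<open>s\<close>; replacing the factor for \<open>w\<close> by \<open>B\<close> keeps the
    integrated test function a tensor product.\<close>
  define B where "B t = G t - G (t - s)" for t
  have B_int: "(LINT \<tau>|lborel. ?I \<tau> * \<beta> w (t - \<tau>)) = B t" for t
  proof -
    have d: "((\<lambda>\<tau>. - G (t - \<tau>)) has_real_derivative \<beta> w (t - x)) (at x)" for x
    proof -
      have "((\<lambda>\<tau>. G (t - \<tau>)) has_real_derivative \<beta> w (t - x) * (- 1)) (at x)"
        by (rule DERIV_chain2[OF G]) (auto intro!: derivative_eq_intros)
      from DERIV_minus[OF this] show ?thesis by simp
    qed
    have "isCont (\<beta> w) y" for y using \<beta>w by (simp add: continuous_on_eq_continuous_at)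
    then have ct: "isCont (\<lambda>\<tau>. \<beta> w (t - \<tau>)) x" for x
      by (rule isCont_o2[rotated]) (intro continuous_intros)
    have "(LINT \<tau>|lborel. \<beta> w (t - \<tau>) * ?I \<tau>) = - G (t - s) - - G (t - 0)"
      using s by (intro integral_FTC_Icc_real d ct) auto
    then show ?thesis by (simp add: B_def mult.commute)
  qed
  have B0: "B t = 0" if "t \<notin> {l \<bullet> w..(h + s *\<^sub>R w) \<bullet> w}" for t
  proof -
    have "?I \<tau> * \<beta> w (t - \<tau>) = 0" for \<tau>
      using that w \<beta>0[OF w, of "t - \<tau>"] by (auto simp: inner_add_left indicator_def)
    then have "(\<lambda>\<tau>. ?I \<tau> * \<beta> w (t - \<tau>)) = (\<lambda>\<tau>. 0)" by (rule ext)
    then have "B t = (LINT \<tau>|(lborel :: real measure). 0)" by (simp only: B_int[symmetric])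
    then show ?thesis by simp
  qed
  have dB: "(B has_real_derivative \<beta> w t - \<beta> w (t - s)) (at t)" for t
  proof -
    have "((\<lambda>t. G (t - s)) has_real_derivative \<beta> w (t - s) * 1) (at t)"
      by (rule DERIV_chain2[OF G]) (auto intro!: derivative_eq_intros)
    from DERIV_diff[OF G this] show ?thesis by (simp add: B_def[abs_def])
  qed
  have BC: "Ck k B" for k
  proof (rule Ck_Suc, rule Ck_SucI_real[OF dB])
    have "Ck k (\<lambda>t. \<beta> w (t + - s))"
      by (rule Ck_affine[where L="\<lambda>t. t" and c="- s"]) (auto intro: \<beta>C[OF w] linearI)
    from Ck_add[OF \<beta>C[OF w] Ck_cmult[OF this, of "-1"]]
    show "Ck k (\<lambda>t. \<beta> w t - \<beta> w (t - s))" by simp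
  qed
  define \<beta>' where "\<beta>' = \<beta>(w := B)"
  let ?\<Psi> = "tensor \<beta>'"
  have \<Psi>_supp: "\<beta>' b t = 0" if "b \<in> Basis" "t \<notin> {l \<bullet> b..(h + s *\<^sub>R w) \<bullet> b}" for b t
    using that B0 \<beta>0[OF that(1)] w by (cases "b = w") (auto simp: \<beta>'_def inner_add_left inner_Basis)
  have \<Psi>C: "Ck k (\<beta>' b)" if "b \<in> Basis" for b k
    using that BC \<beta>C by (simp add: \<beta>'_def)
  have test: "test_function \<Omega> ?\<Psi>"
    by (rule test_function_tensor[OF \<Psi>C \<Psi>_supp sub])
  have split: "tensor \<gamma> x = \<gamma> w (x \<bullet> w) * (\<Prod>b\<in>Basis - {w}. \<gamma> b (x \<bullet> b))" for \<gamma> x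
    unfolding tensor_def using w by (intro prod.remove) auto
  have shift: "tensor \<gamma> (x - c *\<^sub>R w) = \<gamma> w (x \<bullet> w - c) * (\<Prod>b\<in>Basis - {w}. \<gamma> b (x \<bullet> b))" for \<gamma> x c
  proof -
    have "(\<Prod>b\<in>Basis - {w}. \<gamma> b ((x - c *\<^sub>R w) \<bullet> b)) = (\<Prod>b\<in>Basis - {w}. \<gamma> b (x \<bullet> b))"
      using w by (intro prod.cong) (auto simp: inner_diff_left inner_Basis)
    then show ?thesis using w by (simp add: split[of \<gamma> "x - c *\<^sub>R w"] inner_diff_left)
  qed
  have rest: "(\<Prod>b\<in>Basis - {w}. \<beta>' b (x \<bullet> b)) = (\<Prod>b\<in>Basis - {w}. \<beta> b (x \<bullet> b))" for x
    by (intro prod.cong) (auto simp: \<beta>'_def)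
  have D: "frechet_derivative ?\<Psi> (at x) w = ?\<psi> x - ?\<psi> (x - s *\<^sub>R w)" for x
  proof -
    have "frechet_derivative ?\<Psi> (at x) w = (\<beta> w (x \<bullet> w) - \<beta> w (x \<bullet> w - s)) * (\<Prod>b\<in>Basis - {w}. \<beta>' b (x \<bullet> b))"
      by (rule frechet_derivative_tensor[OF w \<Psi>C]) (auto simp: \<beta>'_def dB)
    then show ?thesis by (simp add: rest shift split[of \<beta> x] left_diff_distrib)
  qed
  have \<Psi>_int: "?\<Psi> x = (LINT \<tau>|lborel. ?I \<tau> * ?\<psi> (x - \<tau> *\<^sub>R w))" for x
  proof -
    have "?\<Psi> x = (LINT \<tau>|lborel. ?I \<tau> * \<beta> w (x \<bullet> w - \<tau>)) * (\<Prod>b\<in>Basis - {w}. \<beta> b (x \<bullet> b))"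
      by (simp add: split[of \<beta>' x] rest B_int) (simp add: \<beta>'_def)
    also have "\<dots> = (LINT \<tau>|lborel. ?I \<tau> * \<beta> w (x \<bullet> w - \<tau>) * (\<Prod>b\<in>Basis - {w}. \<beta> b (x \<bullet> b)))"
      by simp
    finally show ?thesis by (simp add: shift mult.assoc)
  qed
  have K1: "x \<in> K" if "?\<psi> x \<noteq> 0" for x
  proof -
    have "x \<in> cbox l h" using tensor_nonzero_imp[OF \<beta>0 that] by blast
    then show ?thesis using w s unfolding K_def mem_box
      by (auto simp: inner_add_left inner_Basis)
  qed
  have K2: "x \<in> K" if "?\<psi> (x - s *\<^sub>R w) \<noteq> 0" for x
  proof -
    have "x - s *\<^sub>R w \<in> cbox l h" using tensor_nonzero_imp[OF \<beta>0 that] by blast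
    then have *: "b \<in> Basis \<Longrightarrow> l \<bullet> b \<le> x \<bullet> b - s * (w \<bullet> b) \<and> x \<bullet> b - s * (w \<bullet> b) \<le> h \<bullet> b" for b
      by (auto simp: mem_box inner_diff_left)
    show ?thesis unfolding K_def mem_box
    proof
      fix b :: 'a assume b: "b \<in> Basis"
      have "0 \<le> s * (w \<bullet> b)" using s w b by (simp add: inner_Basis)
      then show "l \<bullet> b \<le> x \<bullet> b \<and> x \<bullet> b \<le> (h + s *\<^sub>R w) \<bullet> b"
        using *[OF b] by (simp add: inner_add_left)
    qed
  qed
  have K3: "x \<in> K" if "?\<Psi> x \<noteq> 0" for x
    using tensor_nonzero_imp[OF \<Psi>_supp that] by (simp add: K_def)
  have "(LINT x:\<Omega>|lborel. u x * frechet_derivative ?\<Psi> (at x) w) = - (LINT x:\<Omega>|lborel. V x * ?\<Psi> x)"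
    using wd test by (simp add: weak_dir_def)
  moreover have "(LINT x:\<Omega>|lborel. u x * frechet_derivative ?\<Psi> (at x) w)
      = (LINT x|lborel. u1 x * ?\<psi> x - u1 x * ?\<psi> (x - s *\<^sub>R w))"
    unfolding set_lebesgue_integral_def D u1_def
  proof (rule Bochner_Integration.integral_cong[OF refl])
    fix x :: 'a
    show "indicat_real \<Omega> x *\<^sub>R (u x * (?\<psi> x - ?\<psi> (x - s *\<^sub>R w)))
        = indicator K x * u x * ?\<psi> x - indicator K x * u x * ?\<psi> (x - s *\<^sub>R w)"
    proof (cases "x \<in> K")
      case True
      then show ?thesis using Kc(2) by (auto simp: algebra_simps)
    next
      case False
      then have "?\<psi> x = 0" "?\<psi> (x - s *\<^sub>R w) = 0" using K1 K2 by blast+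
      then show ?thesis by simp
    qed
  qed
  moreover have "(LINT x|lborel. u1 x * ?\<psi> x - u1 x * ?\<psi> (x - s *\<^sub>R w))
     = (LINT x|lborel. u1 x * ?\<psi> x) - (LINT x|lborel. u1 x * ?\<psi> (x - s *\<^sub>R w))"
    using bnd[OF iu, of 0] bnd[OF iu, of "s *\<^sub>R w"] by simp
  moreover have "(LINT x|lborel. u1 x * ?\<psi> (x - s *\<^sub>R w)) = (LINT x|lborel. u1 (x + s *\<^sub>R w) * ?\<psi> x)"
    using integral_lborel_translate[of "\<lambda>x. u1 x * ?\<psi> (x - s *\<^sub>R w)" "s *\<^sub>R w"] by simp
  moreover have "(LINT x:\<Omega>|lborel. V x * ?\<Psi> x) = (LINT x|lborel. v1 x * ?\<Psi> x)"
    unfolding set_lebesgue_integral_def v1_def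
    using K3 Kc(2) by (intro Bochner_Integration.integral_cong) (auto simp: indicator_def)
  moreover have "(LINT x|lborel. v1 x * ?\<Psi> x) = (LINT x|lborel. (LINT \<tau>|lborel. ?I \<tau> * v1 (x + \<tau> *\<^sub>R w)) * ?\<psi> x)"
  proof -
    have i1: "integrable (lborel \<Otimes>\<^sub>M lborel) (\<lambda>(x, \<tau>). v1 x * (?I \<tau> * ?\<psi> (x - \<tau> *\<^sub>R w)))"
    proof -
      have "integrable (lborel \<Otimes>\<^sub>M lborel) (\<lambda>(x, \<tau>). v1 x * ?I \<tau>)"
      proof (rule lborel_pair.Fubini_integrable)
        show "integrable lborel (\<lambda>x. LINT \<tau>|lborel. norm (case (x, \<tau>) of (x, \<tau>) \<Rightarrow> v1 x * ?I \<tau>))"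
          using iv iI by (simp add: abs_mult)
        show "AE x in lborel. integrable lborel (\<lambda>\<tau>. case (x, \<tau>) of (x, \<tau>) \<Rightarrow> v1 x * ?I \<tau>)"
          using iI by simp
      qed measurable
      then show ?thesis
      proof (rule Bochner_Integration.integrable_bound)
        show "AE p in lborel \<Otimes>\<^sub>M lborel. norm (case p of (x, \<tau>) \<Rightarrow> v1 x * (?I \<tau> * ?\<psi> (x - \<tau> *\<^sub>R w)))
            \<le> norm (case p of (x, \<tau>) \<Rightarrow> v1 x * ?I \<tau>)"
          using \<psi>1 by (intro AE_I2) (auto simp: abs_mult mult.assoc[symmetric] intro!: mult_left_le)
      qed measurable
    qed
    have i2: "integrable (lborel \<Otimes>\<^sub>M lborel) (\<lambda>(\<tau>, x). ?I \<tau> * v1 (x + \<tau> *\<^sub>R w) * ?\<psi> x)"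
      using ig
    proof (rule Bochner_Integration.integrable_bound)
      show "AE p in lborel \<Otimes>\<^sub>M lborel. norm (case p of (\<tau>, x) \<Rightarrow> ?I \<tau> * v1 (x + \<tau> *\<^sub>R w) * ?\<psi> x)
          \<le> norm (case p of (\<tau>, x) \<Rightarrow> ?I \<tau> * v1 (x + \<tau> *\<^sub>R w))"
        using \<psi>1 by (intro AE_I2) (auto simp: abs_mult intro!: mult_left_le)
    qed measurable
    have "(LINT x|lborel. v1 x * ?\<Psi> x) = (LINT x|lborel. LINT \<tau>|lborel. v1 x * (?I \<tau> * ?\<psi> (x - \<tau> *\<^sub>R w)))"
      by (simp add: \<Psi>_int)
    also have "\<dots> = (LINT \<tau>|lborel. LINT x|lborel. v1 x * (?I \<tau> * ?\<psi> (x - \<tau> *\<^sub>R w)))"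
      using lborel_pair.Fubini_integral[OF i1] by simp
    also have "\<dots> = (LINT \<tau>|lborel. LINT x|lborel. ?I \<tau> * v1 (x + \<tau> *\<^sub>R w) * ?\<psi> x)"
    proof (rule Bochner_Integration.integral_cong[OF refl])
      fix \<tau> :: real
      show "(LINT x|lborel. v1 x * (?I \<tau> * ?\<psi> (x - \<tau> *\<^sub>R w))) = (LINT x|lborel. ?I \<tau> * v1 (x + \<tau> *\<^sub>R w) * ?\<psi> x)"
        using integral_lborel_translate[of "\<lambda>x. v1 x * (?I \<tau> * ?\<psi> (x - \<tau> *\<^sub>R w))" "\<tau> *\<^sub>R w"]
        by (simp add: mult_ac)
    qed
    also have "\<dots> = (LINT x|lborel. LINT \<tau>|lborel. ?I \<tau> * v1 (x + \<tau> *\<^sub>R w) * ?\<psi> x)"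
      using lborel_pair.Fubini_integral[OF i2] by simp
    finally show ?thesis by simp
  qed
  moreover have "(LINT x|lborel. f x * ?\<psi> x) = (LINT x|lborel. u1 (x + s *\<^sub>R w) * ?\<psi> x) - (LINT x|lborel. u1 x * ?\<psi> x)
      - (LINT x|lborel. (LINT \<tau>|lborel. ?I \<tau> * v1 (x + \<tau> *\<^sub>R w)) * ?\<psi> x)"
    using bnd[of "\<lambda>x. u1 (x + s *\<^sub>R w)" 0] bnd[OF iu, of 0] bnd[OF iG, of 0] iu
    by (simp add: f_def left_diff_distrib integrable_lborel_translate)
  ultimately show "(LINT x|lborel. f x * ?\<psi> x) = 0" by simp
qed

section \<open>Functions are determined by their integrals over boxes\<close>

lemma prod_indicator_box:
  "(\<Prod>b\<in>Basis. indicator {a \<bullet> b<..<c \<bullet> b} (x \<bullet> b) :: real) = indicator (box a c) (x :: 'a::euclidean_space)"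
proof (cases "x \<in> box a c")
  case True
  then show ?thesis by (auto simp: mem_box intro!: prod.neutral)
next
  case False
  then obtain b where b: "b \<in> Basis" "\<not> (a \<bullet> b < x \<bullet> b \<and> x \<bullet> b < c \<bullet> b)" by (auto simp: mem_box)
  then have "\<exists>b\<in>Basis. indicator {a \<bullet> b<..<c \<bullet> b} (x \<bullet> b) = (0::real)" by (intro bexI[of _ b]) auto
  then have "(\<Prod>b\<in>Basis. indicator {a \<bullet> b<..<c \<bullet> b} (x \<bullet> b) :: real) = 0"
    by (simp only: prod_zero finite_Basis)
  with False show ?thesis by simp
qed

text \<open>Positive and negative part, taken as densities, define measures that agree on boxes, an
  intersection-stable generator of the Borel sets; hence the densities agree almost
  everywhere.\<close>

lemma AE_zero_if_box_integrals_zero: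
  fixes F :: "'a::euclidean_space \<Rightarrow> real"
  assumes F: "integrable lborel F" and z: "\<And>a c. (LINT x|lborel. F x * indicator (box a c) x) = 0"
  shows "AE x in lborel. F x = 0"
proof -
  have [measurable]: "F \<in> borel_measurable borel" using F by auto
  let ?M = "density lborel (\<lambda>x. ennreal (F x))" and ?N = "density lborel (\<lambda>x. ennreal (- F x))"
  have fin: "(\<integral>\<^sup>+x. ennreal (G x) \<partial>lborel) \<noteq> \<infinity>" if "integrable lborel G" for G :: "'a \<Rightarrow> real"
    using that by (auto simp: real_integrable_def)
  have Fi: "integrable lborel (\<lambda>x. F x * indicator (box a c) x)" for a c
    using F by (intro integrable_mult_indicator[where 'b=real, simplified mult.commute real_scaleR_def]) auto
  have M: "emeasure ?M (box a c) = (\<integral>\<^sup>+x. ennreal (F x * indicator (box a c) x) \<partial>lborel)" for a c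
    by (subst emeasure_density) (auto intro!: nn_integral_cong split: split_indicator)
  have N: "emeasure ?N (box a c) = (\<integral>\<^sup>+x. ennreal (- (F x * indicator (box a c) x)) \<partial>lborel)" for a c
    by (subst emeasure_density) (auto intro!: nn_integral_cong split: split_indicator)
  have eq: "emeasure ?M (box a c) = emeasure ?N (box a c)" for a c
  proof -
    let ?G = "\<lambda>x. F x * indicator (box a c) x"
    have "enn2real (\<integral>\<^sup>+x. ennreal (?G x) \<partial>lborel) = enn2real (\<integral>\<^sup>+x. ennreal (- ?G x) \<partial>lborel)"
      using z[of a c] real_lebesgue_integral_def[OF Fi[of a c]] by simp
    moreover have "(\<integral>\<^sup>+x. ennreal (?G x) \<partial>lborel) \<noteq> \<infinity>" "(\<integral>\<^sup>+x. ennreal (- ?G x) \<partial>lborel) \<noteq> \<infinity>"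
      using fin[OF Fi[of a c]] fin[OF Bochner_Integration.integrable_minus[OF Fi[of a c]]] by auto
    ultimately show ?thesis unfolding M N
      by (cases rule: ennreal2_cases[of "\<integral>\<^sup>+x. ennreal (?G x) \<partial>lborel" "\<integral>\<^sup>+x. ennreal (- ?G x) \<partial>lborel"]) auto
  qed
  have "?M = ?N"
  proof (rule measure_eqI_generator_eq)
    let ?E = "range (\<lambda>(a, b). box a b :: 'a set)"
    let ?A = "\<lambda>n::nat. box (- (real n *\<^sub>R One)) (real n *\<^sub>R One) :: 'a set"
    show "Int_stable ?E"
      by (auto simp: Int_stable_def box_Int_box)
    show "?E \<subseteq> Pow UNIV" by simp
    show "sets ?M = sigma_sets UNIV ?E" "sets ?N = sigma_sets UNIV ?E"
      by (simp_all add: borel_eq_box)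
    show "range ?A \<subseteq> ?E" by auto
    show "(\<Union>i. ?A i) = UNIV" by (rule UN_box_eq_UNIV)
    show "emeasure ?M (?A i) \<noteq> \<infinity>" for i
      unfolding M using fin[OF Fi] .
    show "emeasure ?M X = emeasure ?N X" if "X \<in> ?E" for X
      using that eq by auto
  qed
  then have "AE x in lborel. ennreal (F x) = ennreal (- F x)"
    by (intro sigma_finite_measure.density_unique[OF sigma_finite_lborel]) auto
  then show ?thesis
  proof eventually_elim
    case (elim x)
    \<comment> \<open>\<open>ennreal\<close> sends negative numbers to 0, so equality of
      \<open>ennreal (F x)\<close> and \<open>ennreal (- F x)\<close> makes both zero or neither; a
      real number and its negative cannot both be positive.\<close>
    have "F x \<le> 0 \<longleftrightarrow> - F x \<le> 0" unfolding ennreal_eq_0_iff[symmetric] elim ..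
    then show "F x = 0" by linarith
  qed
qed

lemma AE_zero_on_box:
  fixes f :: "'a::euclidean_space \<Rightarrow> real"
  assumes f: "integrable lborel f"
    and z: "\<And>a c n. \<forall>b\<in>Basis. l \<bullet> b \<le> a \<bullet> b \<and> c \<bullet> b \<le> h \<bullet> b \<Longrightarrow>
        (LINT x|lborel. f x * tensor (\<lambda>b. bump (a \<bullet> b) (c \<bullet> b) n) x) = 0"
  shows "AE x in lborel. x \<in> box l h \<longrightarrow> f x = 0"
proof -
  have [measurable]: "f \<in> borel_measurable borel" using f by auto
  have box0: "(LINT x|lborel. f x * indicator (box a c) x) = 0"
    if ac: "\<forall>b\<in>Basis. l \<bullet> b \<le> a \<bullet> b \<and> c \<bullet> b \<le> h \<bullet> b" for a c
  proof -
    let ?t = "\<lambda>n. tensor (\<lambda>b. bump (a \<bullet> b) (c \<bullet> b) n)"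
    have "Ck 0 (?t n)" for n by (rule Ck_tensor) (rule Ck_bump)
    then have [measurable]: "?t n \<in> borel_measurable borel" for n
      by (intro borel_measurable_continuous_onI) simp
    have t1: "\<bar>?t n x\<bar> \<le> 1" for n x
      unfolding tensor_def abs_prod using bump_bounds by (intro prod_le_1) (auto simp: abs_le_iff)
    have "(\<lambda>n. LINT x|lborel. f x * ?t n x) \<longlonglongrightarrow> (LINT x|lborel. f x * indicator (box a c) x)"
    proof (rule integral_dominated_convergence)
      show "integrable lborel (\<lambda>x. \<bar>f x\<bar>)" using f by simp
      have "(\<lambda>n. ?t n x) \<longlonglongrightarrow> indicator (box a c) x" for x
        unfolding tensor_def prod_indicator_box[symmetric] by (intro tendsto_prod bump_tendsto)
      then show "AE x in lborel. (\<lambda>n. f x * ?t n x) \<longlonglongrightarrow> f x * indicator (box a c) x"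
        by (intro AE_I2 tendsto_intros)
      show "AE x in lborel. norm (f x * ?t n x) \<le> \<bar>f x\<bar>" for n
        using t1 by (intro AE_I2) (auto simp: abs_mult intro!: mult_left_le)
    qed auto
    then show ?thesis using z[OF ac] by (simp add: LIMSEQ_const_iff)
  qed
  define F where "F x = f x * indicator (box l h) x" for x
  have "AE x in lborel. F x = 0"
  proof (rule AE_zero_if_box_integrals_zero)
    show "integrable lborel F"
      unfolding F_def using f
      by (intro integrable_mult_indicator[where 'b=real, simplified mult.commute real_scaleR_def]) auto
    fix a c :: 'a
    \<comment> \<open>An arbitrary box is first clipped to \<open>box l h\<close>, since the
      hypothesis only speaks about bumps supported there.\<close>
    define a' c' where "a' = (\<Sum>b\<in>Basis. max (a \<bullet> b) (l \<bullet> b) *\<^sub>R b)" and "c' = (\<Sum>b\<in>Basis. min (c \<bullet> b) (h \<bullet> b) *\<^sub>R b)"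
    have "box l h \<inter> box a c = box a' c'"
      by (auto simp: a'_def c'_def mem_box)
    then have "F x * indicator (box a c) x = f x * indicator (box a' c') x" for x
      by (simp add: F_def indicator_inter_arith[symmetric] mult.assoc)
    then show "(LINT x|lborel. F x * indicator (box a c) x) = 0"
      using box0[of a' c'] by (simp add: a'_def c'_def)
  qed
  then show ?thesis by eventually_elim (auto simp: F_def)
qed

lemma bump_supported_in_box:
  assumes "\<forall>b\<in>Basis. l \<bullet> b \<le> a \<bullet> b \<and> c \<bullet> b \<le> h \<bullet> b" "b \<in> Basis"
  shows "Ck k (bump (a \<bullet> b) (c \<bullet> b) n)" "t \<notin> {l \<bullet> b..h \<bullet> b} \<Longrightarrow> bump (a \<bullet> b) (c \<bullet> b) n t = 0"
    "\<bar>bump (a \<bullet> b) (c \<bullet> b) n t\<bar> \<le> 1"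
proof -
  show "Ck k (bump (a \<bullet> b) (c \<bullet> b) n)" by (rule Ck_bump)
  show "\<bar>bump (a \<bullet> b) (c \<bullet> b) n t\<bar> \<le> 1" using bump_bounds[of "a \<bullet> b" "c \<bullet> b" n t] by (simp add: abs_le_iff)
  assume "t \<notin> {l \<bullet> b..h \<bullet> b}"
  moreover have "l \<bullet> b \<le> a \<bullet> b" "c \<bullet> b \<le> h \<bullet> b" using assms by auto
  ultimately show "bump (a \<bullet> b) (c \<bullet> b) n t = 0" by (intro bump_outside) auto
qed

text \<open>For one step length and one box. The exceptional null set depends on both, which is
  repaired later by using only countably many boxes and rational steps.\<close>

lemma weak_dir_shift_AE:
  fixes \<Omega> :: "'a::euclidean_space set"
  assumes w: "w \<in> Basis" and wd: "weak_dir \<Omega> u w V" and u: "continuous_on \<Omega> u"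
    and s: "0 < s" and sub: "cbox l (h + s *\<^sub>R w) \<subseteq> \<Omega>"
  shows "AE x in lborel. x \<in> box l h \<longrightarrow> u (x + s *\<^sub>R w) - u x =
     (LINT \<tau>|lborel. indicator {0..s} \<tau> * (indicator (cbox l (h + s *\<^sub>R w)) (x + \<tau> *\<^sub>R w) * V (x + \<tau> *\<^sub>R w)))"
  (is "AE x in lborel. _ \<longrightarrow> _ = ?I x")
proof -
  let ?K = "cbox l (h + s *\<^sub>R w)"
  let ?u = "\<lambda>x. indicator ?K x * u x"
  have "AE x in lborel. x \<in> box l h \<longrightarrow> ?u (x + s *\<^sub>R w) - ?u x - ?I x = 0"
  proof (rule AE_zero_on_box)
    show "integrable lborel (\<lambda>x. ?u (x + s *\<^sub>R w) - ?u x - ?I x)"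
      using weak_dir_shift(1)[OF w wd u s sub] .
    show "(LINT x|lborel. (?u (x + s *\<^sub>R w) - ?u x - ?I x) * tensor (\<lambda>b. bump (a \<bullet> b) (c \<bullet> b) n) x) = 0"
      if "\<forall>b\<in>Basis. l \<bullet> b \<le> a \<bullet> b \<and> c \<bullet> b \<le> h \<bullet> b" for a c n
      by (rule weak_dir_shift(2)[OF w wd u s sub, where \<beta>="\<lambda>b. bump (a \<bullet> b) (c \<bullet> b) n"])
        (rule bump_supported_in_box[OF that]; assumption)+
  qed
  then show ?thesis
  proof eventually_elim
    case (elim x)
    show ?case
    proof
      assume x: "x \<in> box l h"
      have w0: "0 \<le> w \<bullet> b" if "b \<in> Basis" for b using w that by (simp add: inner_Basis)
      have "x \<in> ?K" "x + s *\<^sub>R w \<in> ?K"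
        using x s w0 by (force simp: mem_box inner_add_left intro: add_increasing2 add_mono less_imp_le)+
      then show "u (x + s *\<^sub>R w) - u x = ?I x" using elim x by simp
    qed
  qed
qed

section \<open>The fundamental theorem along almost every line\<close>

lemma small_box_sup:
  fixes D :: "'a::euclidean_space set"
  assumes D: "\<And>X. open X \<Longrightarrow> X \<noteq> {} \<Longrightarrow> \<exists>d\<in>D. d \<in> X" and \<delta>: "0 < \<delta>"
  obtains l h where "l \<in> D" "h \<in> D" "x \<in> box l h" "\<And>b. b \<in> Basis \<Longrightarrow> x \<bullet> b - \<delta> < l \<bullet> b \<and> h \<bullet> b < x \<bullet> b + \<delta>"
proof -
  have "box (x - \<delta> *\<^sub>R One) x \<noteq> {}" "box x (x + \<delta> *\<^sub>R One) \<noteq> {}"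
    using \<delta> by (auto simp: box_ne_empty inner_diff_left inner_add_left)
  then obtain l h where lh: "l \<in> D" "l \<in> box (x - \<delta> *\<^sub>R One) x" "h \<in> D" "h \<in> box x (x + \<delta> *\<^sub>R One)"
    using D[of "box (x - \<delta> *\<^sub>R One) x"] D[of "box x (x + \<delta> *\<^sub>R One)"] by (auto simp: open_box)
  show ?thesis
    using lh by (intro that[of l h]) (auto simp: mem_box inner_diff_left inner_add_left)
qed

lemma norm_le_DIM_times:
  fixes x :: "'a::euclidean_space" and \<rho> :: real
  assumes "\<And>b. b \<in> Basis \<Longrightarrow> \<bar>x \<bullet> b\<bar> \<le> \<rho>"
  shows "norm x \<le> DIM('a) * \<rho>"
proof -
  have "(\<Sum>b\<in>Basis. \<bar>x \<bullet> b\<bar>) \<le> DIM('a) * \<rho>"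
    using assms by (rule sum_bounded_above)
  with norm_le_l1[of x] show ?thesis by (rule order_trans)
qed

text \<open>Around a segment in \<open>\<Omega>\<close> there is a thin box inside
  \<open>\<Omega>\<close>. For rational step length its corners can be described by points of a
  countable dense set, so countably many null sets suffice for all rational steps. Continuity of
  \<open>u\<close> carries the estimate to real steps. As an inequality with values in
  \<open>ennreal\<close> it makes sense whether or not \<open>V\<close> is integrable on the
  line.\<close>

lemma weak_dir_segment_AE:
  fixes \<Omega> :: "'a::euclidean_space set"
  assumes w: "w \<in> Basis" and wd: "weak_dir \<Omega> u w V" and \<Omega>: "open \<Omega>" and u: "continuous_on \<Omega> u"
  shows "AE x in lborel. \<forall>s>0. (\<forall>\<tau>\<in>{0..s}. x + \<tau> *\<^sub>R w \<in> \<Omega>) \<longrightarrow>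
     ennreal \<bar>u (x + s *\<^sub>R w) - u x\<bar> \<le> (\<integral>\<^sup>+\<tau>. indicator {0..s} \<tau> * ennreal \<bar>V (x + \<tau> *\<^sub>R w)\<bar> \<partial>lborel)"
proof -
  obtain D :: "'a set" where D: "countable D" "\<And>X. open X \<Longrightarrow> X \<noteq> {} \<Longrightarrow> \<exists>d\<in>D. d \<in> X"
    using countable_dense_exists by blast
  define J where "J = {(l, h, s). l \<in> D \<and> h \<in> D \<and> s \<in> \<rat> \<and> 0 < s \<and> cbox l (h + s *\<^sub>R w) \<subseteq> \<Omega>}"
  let ?eq = "\<lambda>l h s x. x \<in> box l h \<longrightarrow> u (x + s *\<^sub>R w) - u x =
     (LINT \<tau>|lborel. indicator {0..s} \<tau> * (indicator (cbox l (h + s *\<^sub>R w)) (x + \<tau> *\<^sub>R w) * V (x + \<tau> *\<^sub>R w)))"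
  have "countable (D \<times> D \<times> \<rat>)" using D(1) countable_rat by auto
  then have "countable J" by (rule countable_subset[rotated]) (auto simp: J_def)
  moreover have "\<forall>j\<in>J. AE x in lborel. case j of (l, h, s) \<Rightarrow> ?eq l h s x"
    using weak_dir_shift_AE[OF w wd u] by (auto simp: J_def)
  ultimately have "AE x in lborel. \<forall>j\<in>J. case j of (l, h, s) \<Rightarrow> ?eq l h s x"
    by (simp add: AE_ball_countable)
  then show ?thesis
  proof eventually_elim
    case (elim x)
    show ?case
    proof (intro allI impI)
      fix s :: real assume s: "0 < s" and seg: "\<forall>\<tau>\<in>{0..s}. x + \<tau> *\<^sub>R w \<in> \<Omega>"
      let ?R = "\<integral>\<^sup>+\<tau>. indicator {0..s} \<tau> * ennreal \<bar>V (x + \<tau> *\<^sub>R w)\<bar> \<partial>lborel"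
      have rat: "ennreal \<bar>u (x + s' *\<^sub>R w) - u x\<bar> \<le> ?R" if s': "s' \<in> \<rat>" "0 < s'" "s' < s" for s'
      proof -
        have "compact ((\<lambda>\<tau>. x + \<tau> *\<^sub>R w) ` {0..s})"
          by (intro compact_continuous_image continuous_intros) auto
        moreover have "(\<lambda>\<tau>. x + \<tau> *\<^sub>R w) ` {0..s} \<subseteq> \<Omega>" using seg by auto
        ultimately obtain \<epsilon> where \<epsilon>: "\<epsilon> > 0" "(\<Union>p\<in>(\<lambda>\<tau>. x + \<tau> *\<^sub>R w) ` {0..s}. ball p \<epsilon>) \<subseteq> \<Omega>"
          using compact_subset_open_imp_ball_epsilon_subset \<Omega> by blast
        define \<delta> where "\<delta> = \<epsilon> / (2 * DIM('a))"
        have \<delta>: "0 < \<delta>" "DIM('a) * \<delta> < \<epsilon>" using \<epsilon>(1) by (auto simp: \<delta>_def)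
        obtain l h where lh: "l \<in> D" "h \<in> D" "x \<in> box l h"
          "\<And>b. b \<in> Basis \<Longrightarrow> x \<bullet> b - \<delta> < l \<bullet> b \<and> h \<bullet> b < x \<bullet> b + \<delta>"
          using small_box_sup[OF D(2) \<delta>(1), of x] by metis
        have "cbox l (h + s' *\<^sub>R w) \<subseteq> \<Omega>"
        proof
          fix y assume y: "y \<in> cbox l (h + s' *\<^sub>R w)"
          \<comment> \<open>The point of the segment nearest in height to \<open>y\<close>. The box
            exceeds the segment by at most \<open>\<delta>\<close> in each coordinate, and
            \<open>\<delta>\<close> was taken so small that
            \<open>DIM('a) * \<delta> < \<epsilon>\<close>.\<close>
          define \<tau> where "\<tau> = max 0 (min s' (y \<bullet> w - x \<bullet> w))"
          have c: "\<bar>(y - (x + \<tau> *\<^sub>R w)) \<bullet> b\<bar> \<le> \<delta>" if b: "b \<in> Basis" for b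
          proof -
            have "l \<bullet> b \<le> y \<bullet> b" "y \<bullet> b \<le> h \<bullet> b + s' * (w \<bullet> b)"
              using y b by (auto simp: mem_box inner_add_left)
            moreover note lh(4)[OF b]
            moreover have "w \<bullet> b = (if b = w then 1 else 0)" using b w by (simp add: inner_Basis)
            ultimately show ?thesis
              using \<open>0 < s'\<close> \<open>0 < \<delta>\<close> by (auto simp: \<tau>_def inner_diff_left inner_add_left abs_le_iff max_def min_def)
          qed
          have "norm (y - (x + \<tau> *\<^sub>R w)) \<le> DIM('a) * \<delta>" by (intro norm_le_DIM_times c)
          also have "\<dots> < \<epsilon>" by (rule \<delta>)
          finally have "y \<in> ball (x + \<tau> *\<^sub>R w) \<epsilon>" by (simp add: dist_norm norm_minus_commute)
          moreover have "\<tau> \<in> {0..s}" using s' by (auto simp: \<tau>_def)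
          ultimately show "y \<in> \<Omega>" using \<epsilon>(2) by blast
        qed
        then have "(l, h, s') \<in> J" using lh s' by (simp add: J_def)
        with elim have "?eq l h s' x" by fastforce
        with lh(3) have eq: "u (x + s' *\<^sub>R w) - u x =
          (LINT \<tau>|lborel. indicator {0..s'} \<tau> * (indicator (cbox l (h + s' *\<^sub>R w)) (x + \<tau> *\<^sub>R w) * V (x + \<tau> *\<^sub>R w)))"
          (is "_ = (LINT \<tau>|lborel. ?g \<tau>)") by simp
        \<comment> \<open>A function that is not integrable has Bochner integral 0, so the bound
          holds in either case.\<close>
        have "ennreal (norm (LINT \<tau>|lborel. ?g \<tau>)) \<le> (\<integral>\<^sup>+\<tau>. ennreal (norm (?g \<tau>)) \<partial>lborel)"
        proof (cases "integrable lborel ?g")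
          case True
          then show ?thesis by (rule integral_norm_bound_ennreal)
        qed (simp add: not_integrable_integral_eq)
        also have "\<dots> \<le> ?R"
          using s' by (intro nn_integral_mono) (auto simp: indicator_def)
        finally show ?thesis using eq by simp
      qed
      show "ennreal \<bar>u (x + s *\<^sub>R w) - u x\<bar> \<le> ?R"
      proof (cases ?R)
        case (real r)
        let ?S = "{0<..<s} \<inter> \<rat>" and ?f = "\<lambda>s'. \<bar>u (x + s' *\<^sub>R w) - u x\<bar>"
        have cl: "s \<in> closure ?S"
          unfolding closure_approachable
        proof (intro allI impI)
          fix e :: real assume "0 < e"
          then obtain q where "q \<in> \<rat>" "max 0 (s - e) < q" "q < s"
            using Rats_dense_in_real[of "max 0 (s - e)" s] s \<open>0 < e\<close> by (meson diff_less_eq less_add_same_cancel1 max_less_iff_conj)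
          then show "\<exists>y\<in>?S. dist y s < e" by (intro bexI[of _ q]) (auto simp: dist_real_def)
        qed
        have ct: "continuous_on (closure ?S) ?f"
        proof (rule continuous_on_subset)
          have "closure ?S \<subseteq> closure {0..s}" by (rule closure_mono) auto
          then show "closure ?S \<subseteq> {0..s}" by simp
          show "continuous_on {0..s} ?f"
            using seg by (intro continuous_intros continuous_on_compose2[OF u]) auto
        qed
        have le: "?f s' \<le> r" if "s' \<in> ?S" for s'
          using rat[of s'] that real by (auto simp: ennreal_le_iff)
        have "?f s \<le> r" by (rule continuous_le_on_closure[OF ct cl le])
        then show ?thesis using real by (simp add: ennreal_leI)
      qed simp
    qed
  qed
qed

text \<open>\<open>weak_partial\<close> is chosen by \<open>SOME\<close>, whereas membership in the
  Lebesgue space is known for a possibly different weak derivative; uniqueness identifies the two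
  almost everywhere.\<close>

lemma weak_dir_unique:
  fixes \<Omega> :: "'a::euclidean_space set"
  assumes \<Omega>: "open \<Omega>" and V: "weak_dir \<Omega> u w V" and V': "weak_dir \<Omega> u w V'"
  shows "AE x in lborel. x \<in> \<Omega> \<longrightarrow> V x = V' x"
proof -
  obtain D :: "'a set" where D: "countable D" "\<And>X. open X \<Longrightarrow> X \<noteq> {} \<Longrightarrow> \<exists>d\<in>D. d \<in> X"
    using countable_dense_exists by blast
  define J where "J = {(l, h). l \<in> D \<and> h \<in> D \<and> cbox l h \<subseteq> \<Omega>}"
  have box: "AE x in lborel. x \<in> box l h \<longrightarrow> V x = V' x" if sub: "cbox l h \<subseteq> \<Omega>" for l h
  proof -
    let ?K = "cbox l h"
    have iV: "integrable lborel (\<lambda>x. indicator ?K x * W x)" if "weak_dir \<Omega> u w W" for W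
      using that sub unfolding weak_dir_def set_integrable_def by simp
    have "AE x in lborel. x \<in> box l h \<longrightarrow> indicator ?K x * V x - indicator ?K x * V' x = 0"
    proof (rule AE_zero_on_box)
      show "integrable lborel (\<lambda>x. indicator ?K x * V x - indicator ?K x * V' x)"
        using iV[OF V] iV[OF V'] by simp
      fix a c :: 'a and n :: nat assume ac: "\<forall>b\<in>Basis. l \<bullet> b \<le> a \<bullet> b \<and> c \<bullet> b \<le> h \<bullet> b"
      let ?t = "tensor (\<lambda>b. bump (a \<bullet> b) (c \<bullet> b) n)"
      have test: "test_function \<Omega> ?t"
        by (rule test_function_tensor[where \<beta>="\<lambda>b. bump (a \<bullet> b) (c \<bullet> b) n", OF _ _ sub])
          (rule bump_supported_in_box[OF ac]; assumption)+
      have tK: "x \<in> ?K" if "?t x \<noteq> 0" for x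
        by (rule tensor_nonzero_imp[where \<beta>="\<lambda>b. bump (a \<bullet> b) (c \<bullet> b) n", OF _ that])
          (rule bump_supported_in_box(2)[OF ac])
      have "Ck 0 ?t" using test by (simp add: test_function_def)
      then have [measurable]: "?t \<in> borel_measurable borel"
        by (intro borel_measurable_continuous_onI) simp
      have t1: "\<bar>?t x\<bar> \<le> 1" for x
        unfolding tensor_def abs_prod using bump_bounds by (intro prod_le_1) (auto simp: abs_le_iff)
      have i: "integrable lborel (\<lambda>x. indicator ?K x * W x * ?t x)" if W: "weak_dir \<Omega> u w W" for W
      proof (rule Bochner_Integration.integrable_bound[OF iV[OF W]])
        have [measurable]: "W \<in> borel_measurable borel" using W by (simp add: weak_dir_def)
        show "(\<lambda>x. indicator ?K x * W x * ?t x) \<in> borel_measurable lborel" by measurable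
        show "AE x in lborel. norm (indicator ?K x * W x * ?t x) \<le> norm (indicator ?K x * W x)"
          using t1 by (intro AE_I2) (auto simp: abs_mult intro!: mult_left_le)
      qed
      have e: "(LINT x:\<Omega>|lborel. W x * ?t x) = (LINT x|lborel. indicator ?K x * W x * ?t x)" for W
        unfolding set_lebesgue_integral_def
      proof (rule Bochner_Integration.integral_cong[OF refl])
        fix x :: 'a
        show "indicat_real \<Omega> x *\<^sub>R (W x * ?t x) = indicator ?K x * W x * ?t x"
        proof (cases "x \<in> ?K")
          case True
          then have "x \<in> \<Omega>" using sub by blast
          with True show ?thesis by simp
        next
          case False
          then have "?t x = 0" using tK[of x] by blast
          then show ?thesis by simp
        qed
      qed
      have "(LINT x:\<Omega>|lborel. V x * ?t x) = (LINT x:\<Omega>|lborel. V' x * ?t x)"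
      proof -
        have "(LINT x:\<Omega>|lborel. u x * frechet_derivative ?t (at x) w) = - (LINT x:\<Omega>|lborel. V x * ?t x)"
          using V test by (simp add: weak_dir_def)
        moreover have "(LINT x:\<Omega>|lborel. u x * frechet_derivative ?t (at x) w) = - (LINT x:\<Omega>|lborel. V' x * ?t x)"
          using V' test by (simp add: weak_dir_def)
        ultimately show ?thesis by linarith
      qed
      then show "(LINT x|lborel. (indicator ?K x * V x - indicator ?K x * V' x) * ?t x) = 0"
        unfolding e using i[OF V] i[OF V'] by (simp add: left_diff_distrib)
    qed
    then show ?thesis
    proof eventually_elim
      case (elim x)
      show ?case
      proof
        assume x: "x \<in> box l h"
        then have "x \<in> ?K" using box_subset_cbox by blast
        with elim x show "V x = V' x" by simp
      qed
    qed
  qed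
  have "countable J" by (rule countable_subset[of _ "D \<times> D"]) (use D(1) in \<open>auto simp: J_def\<close>)
  moreover have "\<forall>j\<in>J. AE x in lborel. case j of (l, h) \<Rightarrow> x \<in> box l h \<longrightarrow> V x = V' x"
    using box by (auto simp: J_def)
  ultimately have "AE x in lborel. \<forall>j\<in>J. case j of (l, h) \<Rightarrow> x \<in> box l h \<longrightarrow> V x = V' x"
    by (simp add: AE_ball_countable)
  then show ?thesis
  proof eventually_elim
    case (elim x)
    show ?case
    proof
      assume "x \<in> \<Omega>"
      then obtain \<epsilon> where \<epsilon>: "0 < \<epsilon>" "ball x \<epsilon> \<subseteq> \<Omega>" using \<Omega> open_contains_ball by blast
      define \<delta> where "\<delta> = \<epsilon> / (2 * DIM('a))"
      have \<delta>: "0 < \<delta>" "DIM('a) * \<delta> < \<epsilon>" using \<epsilon>(1) by (auto simp: \<delta>_def)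
      obtain l h where lh: "l \<in> D" "h \<in> D" "x \<in> box l h"
        "\<And>b. b \<in> Basis \<Longrightarrow> x \<bullet> b - \<delta> < l \<bullet> b \<and> h \<bullet> b < x \<bullet> b + \<delta>"
        using small_box_sup[OF D(2) \<delta>(1), of x] by metis
      have "cbox l h \<subseteq> \<Omega>"
      proof
        fix y assume y: "y \<in> cbox l h"
        have "norm (y - x) \<le> DIM('a) * \<delta>"
          by (rule norm_le_DIM_times) (use y lh(4) in \<open>fastforce simp: mem_box inner_diff_left abs_le_iff\<close>)
        also have "\<dots> < \<epsilon>" by (rule \<delta>)
        finally have "y \<in> ball x \<epsilon>" by (simp add: dist_norm norm_minus_commute)
        then show "y \<in> \<Omega>" using \<epsilon>(2) by blast
      qed
      then have "(l, h) \<in> J" using lh by (simp add: J_def)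
      then show "V x = V' x" using elim lh(3) by fastforce
    qed
  qed
qed

subsection \<open>Boundary points that are rarely crossed\<close>

lemma cube_subset_cball:
  fixes \<rho> :: real
  shows "cube z \<rho> \<subseteq> cball (z::'a::euclidean_space) (DIM('a) * \<rho>)"
proof
  fix x assume "x \<in> cube z \<rho>"
  then have "norm (x - z) \<le> DIM('a) * \<rho>" by (intro norm_le_DIM_times) (simp add: cube_def)
  then show "x \<in> cball z (DIM('a) * \<rho>)" by (simp add: dist_norm norm_minus_commute)
qed

lemma emeasure_lborel_translate:
  fixes A :: "'a::euclidean_space set"
  assumes "A \<in> sets borel"
  shows "emeasure lborel {x. x + c \<in> A} = emeasure lborel A"
proof -
  have "emeasure lborel A = emeasure (distr lborel borel ((+) c)) A" by (simp add: lborel_distr_plus)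
  also have "\<dots> = emeasure lborel {x. x + c \<in> A}"
    using assms by (subst emeasure_distr) (auto simp: vimage_def add.commute)
  finally show ?thesis by simp
qed

text \<open>For a unit vector \<open>v\<close> this is the orthogonal projection onto the hyperplane
  at height \<open>t\<close>. A slice of \<open>W\<close> is represented by the full-dimensional
  cylinder \<open>{x. level v t x \<in> W}\<close>, so that Lebesgue measure on the type itself can
  be used and no type of lower dimension is required.\<close>

definition level :: "'a::euclidean_space \<Rightarrow> real \<Rightarrow> 'a \<Rightarrow> 'a" where
  "level v t x = x + (t - x \<bullet> v) *\<^sub>R v"

lemma borel_level [measurable]: "level v t \<in> borel_measurable borel"
  unfolding level_def[abs_def] by measurable

lemma nn_integral_lines_null:
  fixes w :: "'a::euclidean_space"
  assumes N: "N \<in> null_sets lborel"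
  shows "(\<integral>\<^sup>+x. \<integral>\<^sup>+t. indicator N (x + t *\<^sub>R w) \<partial>lborel \<partial>lborel) = (0::ennreal)"
proof -
  have [measurable]: "N \<in> sets borel" using N by (auto simp: null_sets_def)
  have tr: "(\<integral>\<^sup>+x. indicator N (x + t *\<^sub>R w) \<partial>lborel) = (0::ennreal)" for t
  proof -
    have "(\<integral>\<^sup>+x. indicator N (x + t *\<^sub>R w) \<partial>lborel) = (\<integral>\<^sup>+x. indicator {x. x + t *\<^sub>R w \<in> N} x \<partial>lborel)"
      by (intro nn_integral_cong) (auto simp: indicator_def)
    also have "\<dots> = emeasure lborel {x. x + t *\<^sub>R w \<in> N}" by (subst nn_integral_indicator) auto
    also have "\<dots> = 0" using N by (simp add: emeasure_lborel_translate null_sets_def)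
    finally show ?thesis .
  qed
  have "(\<integral>\<^sup>+x. \<integral>\<^sup>+t. indicator N (x + t *\<^sub>R w) \<partial>lborel \<partial>lborel) = (\<integral>\<^sup>+t. \<integral>\<^sup>+x. indicator N (x + t *\<^sub>R w) \<partial>lborel \<partial>(lborel :: real measure))"
    by (rule lborel_pair.Fubini'[symmetric]) measurable
  then show ?thesis by (simp add: tr)
qed

text \<open>For fixed \<open>x\<close> the points \<open>level v t x\<close> run through the line
  through \<open>x\<close> in direction \<open>v\<close> as \<open>t\<close> varies, so Fubini and a
  translation in \<open>t\<close> reduce this to lines meeting a null set.\<close>

lemma AE_level_null:
  fixes v :: "'a::euclidean_space"
  assumes N: "N \<in> null_sets lborel"
  shows "AE t in lborel. {x. level v t x \<in> N} \<in> null_sets lborel"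
proof -
  have [measurable]: "N \<in> sets borel" using N by (auto simp: null_sets_def)
  have line: "(\<integral>\<^sup>+t. indicator N (x + (t - c) *\<^sub>R v) \<partial>lborel) = (\<integral>\<^sup>+t. indicator N (x + t *\<^sub>R v) \<partial>lborel)"
    for x c by (subst (2) lborel_distr_plus[of "-c", symmetric]) (simp add: nn_integral_distr)
  have "(\<integral>\<^sup>+t. \<integral>\<^sup>+x. indicator N (level v t x) \<partial>lborel \<partial>lborel) = (\<integral>\<^sup>+x. \<integral>\<^sup>+t. indicator N (level v t x) \<partial>lborel \<partial>lborel)"
    unfolding level_def by (rule lborel_pair.Fubini'[symmetric]) measurable
  also have "\<dots> = (\<integral>\<^sup>+x. \<integral>\<^sup>+t. indicator N (x + t *\<^sub>R v) \<partial>lborel \<partial>lborel)"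
    by (simp add: level_def line)
  also have "\<dots> = 0" by (rule nn_integral_lines_null[OF N])
  finally have "(\<integral>\<^sup>+t. \<integral>\<^sup>+x. indicator N (level v t x) \<partial>lborel \<partial>lborel) = 0" .
  moreover have "(\<lambda>t. \<integral>\<^sup>+x. indicator N (level v t x) \<partial>lborel) \<in> borel_measurable lborel"
    unfolding level_def by measurable
  ultimately have "AE t in lborel. (\<integral>\<^sup>+x. indicator N (level v t x) \<partial>lborel) = 0"
    by (simp add: nn_integral_0_iff_AE)
  then show ?thesis
  proof eventually_elim
    case (elim t)
    have [measurable]: "{x. level v t x \<in> N} \<in> sets borel" by measurable
    have "emeasure lborel {x. level v t x \<in> N} = (\<integral>\<^sup>+x. indicator {x. level v t x \<in> N} x \<partial>lborel)"
      by (subst nn_integral_indicator) auto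
    also have "\<dots> = (\<integral>\<^sup>+x. indicator N (level v t x) \<partial>lborel)"
      by (intro nn_integral_cong) (auto simp: indicator_def)
    finally show ?case using elim by (simp add: null_sets_def)
  qed
qed

text \<open>A point of the cube is moved by \<open>j * (r / 2)\<close> along \<open>v\<close>, for
  one of four values of \<open>j\<close>, into the slab of height \<open>r / 2\<close> at the far
  end, and stays in the cylinder \<open>W\<close>. Hence four translates of the slab part cover the
  whole.\<close>

lemma cube_slabs:
  fixes e :: "'a::euclidean_space"
  assumes e: "e \<in> Basis" and v: "v = e \<or> v = - e" and r: "0 < r" and [measurable]: "W \<in> sets borel"
    and cyl: "\<And>x s. x \<in> W \<Longrightarrow> x + s *\<^sub>R v \<in> W"
  shows "emeasure lborel (cube z r \<inter> W) \<le> 4 * emeasure lborel {x \<in> cube z r \<inter> W. z \<bullet> v + r / 2 \<le> x \<bullet> v}"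
proof -
  let ?S = "{x \<in> cube z r \<inter> W. z \<bullet> v + r / 2 \<le> x \<bullet> v}"
  have [measurable]: "?S \<in> sets borel" by measurable
  have vb: "b \<in> Basis \<Longrightarrow> b \<noteq> e \<Longrightarrow> v \<bullet> b = 0" for b using v e by (auto simp: inner_Basis)
  have vv: "v \<bullet> v = 1" and ve: "\<bar>x \<bullet> e\<bar> = \<bar>x \<bullet> v\<bar>" for x using v e by (auto simp: inner_Basis)
  have cube_v: "x \<in> cube z r \<longleftrightarrow> \<bar>(x - z) \<bullet> v\<bar> \<le> r \<and> (\<forall>b\<in>Basis - {e}. \<bar>(x - z) \<bullet> b\<bar> \<le> r)" for x
    using e ve[of "x - z"] unfolding cube_def by auto
  have "cube z r \<inter> W \<subseteq> (\<Union>j\<in>{..<4::nat}. {x. x + (real j * (r / 2)) *\<^sub>R v \<in> ?S})"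
  proof
    fix x assume x: "x \<in> cube z r \<inter> W"
    define q where "q = (z - x) \<bullet> v"
    have q: "- r \<le> q" "q \<le> r" using x by (auto simp: cube_v q_def inner_diff_left)
    obtain j :: nat where j: "j < 4" "real j * (r / 2) - q \<le> r" "r / 2 \<le> real j * (r / 2) - q"
    proof -
      consider "q \<le> - r / 2" | "- r / 2 < q" "q \<le> 0" | "0 < q" "q \<le> r / 2" | "r / 2 < q" by linarith
      then show ?thesis
      proof cases
        case 1 then show ?thesis using q by (intro that[of 0]) auto
      next
        case 2 then show ?thesis using q by (intro that[of 1]) auto
      next
        case 3 then show ?thesis using q by (intro that[of 2]) auto
      next
        case 4 then show ?thesis using q by (intro that[of 3]) auto
      qed
    qed
    let ?y = "x + (real j * (r / 2)) *\<^sub>R v"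
    have yv: "(?y - z) \<bullet> v = real j * (r / 2) - q"
      by (simp add: q_def inner_diff_left inner_add_left vv)
    have "(?y - z) \<bullet> b = (x - z) \<bullet> b" if "b \<in> Basis - {e}" for b
      using vb[of b] that by (simp add: inner_diff_left inner_add_left)
    then have "?y \<in> cube z r" using x j r yv by (auto simp: cube_v)
    moreover have "?y \<in> W" using cyl x by blast
    moreover have "z \<bullet> v + r / 2 \<le> ?y \<bullet> v" using yv j by (simp add: inner_diff_left)
    ultimately show "x \<in> (\<Union>j\<in>{..<4::nat}. {x. x + (real j * (r / 2)) *\<^sub>R v \<in> ?S})" using j(1) by blast
  qed
  then have "emeasure lborel (cube z r \<inter> W) \<le> emeasure lborel (\<Union>j\<in>{..<4::nat}. {x. x + (real j * (r / 2)) *\<^sub>R v \<in> ?S})"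
    by (intro emeasure_mono) auto
  also have "\<dots> \<le> (\<Sum>j\<in>{..<4::nat}. emeasure lborel {x. x + (real j * (r / 2)) *\<^sub>R v \<in> ?S})"
    by (intro emeasure_subadditive_finite) auto
  also have "\<dots> = (\<Sum>j\<in>{..<4::nat}. emeasure lborel ?S)"
    by (intro sum.cong refl emeasure_lborel_translate) measurable
  finally show ?thesis by simp
qed

text \<open>If \<open>W\<close> is thin near \<open>z\<close> but contains the ray above \<open>z\<close>, the slice of \<open>W\<close> at a height slightly
  above \<open>z\<close> has density at most one half in the cube of radius \<open>r\<close>, but density one in tiny cubes;
  at some intermediate dyadic scale the isoperimetric inequality applies within the slice.\<close>

lemma slice_lower_density:
  fixes e :: "'a::euclidean_space"
  assumes e: "e \<in> Basis" and v: "v = e \<or> v = - e" and r: "0 < r" and t: "z \<bullet> v < t" "t < z \<bullet> v + r / 2"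
    and [measurable]: "W \<in> sets borel"
    and up: "\<And>x s. \<lbrakk>x \<in> cube z (2 * r); x \<in> W; 0 \<le> s; x + s *\<^sub>R v \<in> cube z (2 * r)\<rbrakk> \<Longrightarrow> x + s *\<^sub>R v \<in> W"
    and int: "level v t z \<in> interior W"
    and thin: "emeasure lborel (cube z r \<inter> W) < ennreal ((2 * r) ^ DIM('a) / 8)"
    and N: "\<And>i. i \<in> Basis \<Longrightarrow> {x. level v t x \<in> N i} \<in> null_sets lborel"
    and cross: "\<And>i x s. \<lbrakk>i \<in> Basis; x \<notin> N i; x \<in> cube z (2 * r); x + s *\<^sub>R i \<in> cube z (2 * r); x \<in> W; x + s *\<^sub>R i \<notin> W\<rbrakk>
      \<Longrightarrow> \<exists>\<tau>\<in>closed_segment 0 s. x + \<tau> *\<^sub>R i \<in> B"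
  defines "k \<equiv> DIM('a) - Suc 1"
  shows "DIM('a) \<noteq> 1" and
    "\<exists>\<rho>::real. 0 < \<rho> \<and> \<rho> \<le> r \<and> ennreal (((1/2) ^ (DIM('a) + 1))\<^sup>2 * 2 ^ k * unit_ball_vol k / (DIM('a) * 4 ^ k) * \<rho> ^ k)
       \<le> hausdorff_outer k (B \<inter> {x. x \<bullet> v = t} \<inter> cball (level v t z) (DIM('a) * \<rho>))"
proof -
  let ?d = "DIM('a)"
  have vb: "b \<in> Basis \<Longrightarrow> b \<noteq> e \<Longrightarrow> v \<bullet> b = 0" for b using v e by (auto simp: inner_Basis)
  have vv: "v \<bullet> v = 1" and ve: "\<bar>x \<bullet> e\<bar> = \<bar>x \<bullet> v\<bar>" for x using v e by (auto simp: inner_Basis)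
  have cube_v: "x \<in> cube y \<rho> \<longleftrightarrow> \<bar>(x - y) \<bullet> v\<bar> \<le> \<rho> \<and> (\<forall>b\<in>Basis - {e}. \<bar>(x - y) \<bullet> b\<bar> \<le> \<rho>)" for x y \<rho>
    using e ve[of "x - y"] unfolding cube_def by auto
  have lv: "level v t x \<bullet> v = t" for x by (simp add: level_def inner_add_left vv)
  have lb: "b \<in> Basis - {e} \<Longrightarrow> level v t x \<bullet> b = x \<bullet> b" for b x
    by (simp add: level_def inner_add_left vb)
  have l_cube: "level v t x \<in> cube (level v t z) \<rho>" if "x \<in> cube z \<rho>" "0 \<le> \<rho>" for x \<rho>
    using that by (auto simp: cube_v lv lb inner_diff_left)
  have l_cube2: "level v t x \<in> cube z (2 * r)" if "x \<in> cube z \<rho>" "\<rho> \<le> r" for x \<rho>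
  proof -
    have "\<bar>t - z \<bullet> v\<bar> \<le> 2 * r" using t r by linarith
    moreover have "\<bar>(x - z) \<bullet> b\<bar> \<le> 2 * r" if "b \<in> Basis - {e}" for b
    proof -
      have "\<bar>(x - z) \<bullet> b\<bar> \<le> \<rho>" using \<open>x \<in> cube z \<rho>\<close> that unfolding cube_v by blast
      then show ?thesis using \<open>\<rho> \<le> r\<close> r by linarith
    qed
    ultimately show ?thesis using lb by (auto simp: cube_v lv inner_diff_left)
  qed
  define Wt where "Wt = {x. level v t x \<in> W}"
  have [measurable]: "Wt \<in> sets borel" unfolding Wt_def by measurable
  have l_shift: "level v t (x + s *\<^sub>R v) = level v t x" for x s
    by (simp add: level_def inner_add_left vv algebra_simps)
  have cyl: "x + s *\<^sub>R v \<in> Wt" if "x \<in> Wt" for x s using that by (simp add: Wt_def l_shift)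
  \<comment> \<open>In the far slab of the cube the cylinder \<open>Wt\<close> lies inside
    \<open>W\<close>, by \<open>up\<close>, because the slab is beyond the level \<open>t\<close>.
    With the factor 4 of \<open>cube_slabs\<close> the threshold 1/8 for thinness becomes density at
    most 1/2 for the slice.\<close>
  have dens_r: "emeasure lborel (cube z r \<inter> Wt) \<le> ennreal ((2 * r) ^ ?d / 2)"
  proof -
    have "emeasure lborel (cube z r \<inter> Wt) \<le> 4 * emeasure lborel {x \<in> cube z r \<inter> Wt. z \<bullet> v + r / 2 \<le> x \<bullet> v}"
      by (rule cube_slabs[OF e v r]) (use cyl in auto)
    also have "\<dots> \<le> 4 * emeasure lborel (cube z r \<inter> W)"
    proof (intro mult_left_mono emeasure_mono)
      show "{x \<in> cube z r \<inter> Wt. z \<bullet> v + r / 2 \<le> x \<bullet> v} \<subseteq> cube z r \<inter> W"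
      proof safe
        fix x assume x: "x \<in> cube z r" "x \<in> Wt" "z \<bullet> v + r / 2 \<le> x \<bullet> v"
        have xe: "x = level v t x + (x \<bullet> v - t) *\<^sub>R v" by (simp add: level_def algebra_simps)
        have "x \<in> cube z (2 * r)" using x(1) r by (force simp: cube_def)
        then have "level v t x + (x \<bullet> v - t) *\<^sub>R v \<in> W"
          using x t l_cube2[OF x(1)] xe by (intro up) (auto simp: Wt_def)
        then show "x \<in> W" using xe by simp
      qed
    qed auto
    also have "\<dots> \<le> 4 * ennreal ((2 * r) ^ ?d / 8)" using thin by (intro mult_left_mono) auto
    also have "\<dots> = ennreal ((2 * r) ^ ?d / 2)"
      using r by (simp add: ennreal_numeral[symmetric] ennreal_mult[symmetric] del: ennreal_numeral)
    finally show ?thesis .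
  qed
  \<comment> \<open>More than half of the cube at dyadic scale \<open>r / 2 ^ q\<close> lies in
    \<open>Wt\<close>. This fails for \<open>q = 0\<close> and holds for tiny cubes, so there is a
    first success; the scale just before it is used.\<close>
  define P where "P q \<longleftrightarrow> ennreal ((2 * (r / 2 ^ q)) ^ ?d / 2) < emeasure lborel (cube z (r / 2 ^ q) \<inter> Wt)" for q :: nat
  have "\<exists>q. P q"
  proof -
    obtain \<epsilon> where \<epsilon>: "0 < \<epsilon>" "ball (level v t z) \<epsilon> \<subseteq> W"
      using int by (meson mem_interior)
    obtain q :: nat where q: "?d * r / \<epsilon> < 2 ^ q" using real_arch_pow[of 2 "?d * r / \<epsilon>"] by auto
    let ?\<rho> = "r / 2 ^ q"
    have \<rho>: "0 < ?\<rho>" "?d * ?\<rho> < \<epsilon>" using q r \<epsilon> by (auto simp: field_simps)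
    have "cube z ?\<rho> \<subseteq> Wt"
    proof
      fix x assume "x \<in> cube z ?\<rho>"
      then have "level v t x \<in> cball (level v t z) (?d * ?\<rho>)"
        using l_cube cube_subset_cball \<rho> by (meson less_imp_le subsetD)
      then have "level v t x \<in> ball (level v t z) \<epsilon>" using \<rho>(2) by auto
      then show "x \<in> Wt" using \<epsilon> by (auto simp: Wt_def)
    qed
    then have "emeasure lborel (cube z ?\<rho> \<inter> Wt) = ennreal ((2 * ?\<rho>) ^ ?d)"
      using \<rho> by (simp add: Int_absorb2 emeasure_cube)
    moreover have "ennreal ((2 * ?\<rho>) ^ ?d / 2) < ennreal ((2 * ?\<rho>) ^ ?d)"
      using \<rho> by (intro ennreal_lessI) auto
    ultimately have "P q" unfolding P_def by (simp only:)
    then show ?thesis ..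
  qed
  then obtain q where q: "P q" "\<And>p. p < q \<Longrightarrow> \<not> P p"
    using exists_least_iff[of P] by blast
  have "\<not> P 0" using dens_r by (simp add: P_def not_less)
  then obtain p where p: "q = Suc p" using q(1) by (cases q) auto
  define \<rho> where "\<rho> = r / 2 ^ p"
  have \<rho>: "0 < \<rho>" "\<rho> \<le> r" using r by (auto simp: \<rho>_def field_simps)
  have half: "r / 2 ^ q = \<rho> / 2" by (simp add: p \<rho>_def)
  \<comment> \<open>\<open>Wt\<close> fills more than half of the cube of half the size, whose
    volume is \<open>2^(-d)\<close> of the full one; the complement of \<open>Wt\<close> fills at
    least half of the full cube.\<close>
  define \<alpha> where "\<alpha> = (1/2 :: real) ^ (?d + 1)"
  have "\<alpha> \<le> (1/2) ^ 1" unfolding \<alpha>_def by (rule power_decreasing) auto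
  then have \<alpha>: "0 < \<alpha>" "\<alpha> \<le> 1/2" by (auto simp: \<alpha>_def)
  have d1: "ennreal (\<alpha> * (2 * \<rho>) ^ ?d) \<le> emeasure lborel (cube z \<rho> \<inter> Wt)"
  proof -
    have eq: "\<alpha> * (2 * \<rho>) ^ ?d = (2 * (\<rho> / 2)) ^ ?d / 2"
      by (simp add: \<alpha>_def power_mult_distrib power_divide field_simps)
    have "ennreal (\<alpha> * (2 * \<rho>) ^ ?d) \<le> emeasure lborel (cube z (\<rho> / 2) \<inter> Wt)"
      unfolding eq using q(1) unfolding P_def half by (rule less_imp_le)
    also have "\<dots> \<le> emeasure lborel (cube z \<rho> \<inter> Wt)"
      using \<rho> by (intro emeasure_mono) (force simp: cube_def)+
    finally show ?thesis .
  qed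
  have d2: "ennreal (\<alpha> * (2 * \<rho>) ^ ?d) \<le> emeasure lborel (cube z \<rho> - Wt)"
  proof -
    have "\<not> P p" using q(2) p by simp
    then have le: "emeasure lborel (cube z \<rho> \<inter> Wt) \<le> ennreal ((2 * \<rho>) ^ ?d / 2)" by (simp add: P_def \<rho>_def not_less)
    have sum: "ennreal ((2 * \<rho>) ^ ?d / 2) + ennreal ((2 * \<rho>) ^ ?d / 2) = ennreal ((2 * \<rho>) ^ ?d)"
      using \<rho> by (subst ennreal_plus[symmetric]) auto
    have "ennreal ((2 * \<rho>) ^ ?d) = emeasure lborel (cube z \<rho>)" using \<rho> by (simp add: emeasure_cube)
    also have "\<dots> = emeasure lborel (cube z \<rho> \<inter> Wt) + emeasure lborel (cube z \<rho> - Wt)"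
      by (subst plus_emeasure) (auto intro!: arg_cong[where f="emeasure lborel"])
    also have "\<dots> \<le> ennreal ((2 * \<rho>) ^ ?d / 2) + emeasure lborel (cube z \<rho> - Wt)"
      by (intro add_right_mono le)
    finally have "ennreal ((2 * \<rho>) ^ ?d / 2) + ennreal ((2 * \<rho>) ^ ?d / 2) \<le> ennreal ((2 * \<rho>) ^ ?d / 2) + emeasure lborel (cube z \<rho> - Wt)"
      by (simp only: sum)
    then have "ennreal ((2 * \<rho>) ^ ?d / 2) \<le> emeasure lborel (cube z \<rho> - Wt)"
      by (simp add: ennreal_add_left_cancel_le)
    moreover have "\<alpha> * (2 * \<rho>) ^ ?d \<le> (2 * \<rho>) ^ ?d / 2"
      using mult_right_mono[OF \<alpha>(2), of "(2 * \<rho>) ^ ?d"] \<rho> by simp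
    ultimately show ?thesis by (meson ennreal_leI order_trans)
  qed
  let ?B = "B \<inter> {x. x \<bullet> v = t} \<inter> cball (level v t z) (?d * \<rho>)"
  have inv': "x + s *\<^sub>R i \<in> Wt" if "i \<in> {e}" "x \<in> Wt" for i x s
  proof -
    have "x + s *\<^sub>R e = x + (if v = e then s else - s) *\<^sub>R v" using v by auto
    then show ?thesis using cyl that by auto
  qed
  \<comment> \<open>Horizontal moves commute with \<open>level\<close>, so the crossing point found
    on level \<open>t\<close> belongs to the slice of \<open>B\<close> and agrees with
    \<open>x\<close> in all coordinates except those of \<open>e\<close> and
    \<open>i\<close>.\<close>
  have cr: "\<exists>y\<in>?B. \<forall>b\<in>Basis - insert i {e}. x \<bullet> b = y \<bullet> b"
    if i: "i \<in> Basis - {e}" and x: "x \<in> cube z \<rho>" "x \<notin> {x. level v t x \<in> N i}" "x + s *\<^sub>R i \<in> cube z \<rho>" "x \<in> Wt" "x + s *\<^sub>R i \<notin> Wt"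
    for i x s
  proof -
    have iv: "i \<bullet> v = 0" using vb[of i] i by (simp add: inner_commute)
    have ls: "level v t (x + c *\<^sub>R i) = level v t x + c *\<^sub>R i" for c
      by (simp add: level_def inner_add_left iv)
    have "\<exists>\<tau>\<in>closed_segment 0 s. level v t x + \<tau> *\<^sub>R i \<in> B"
      using i x l_cube2[OF x(1) \<rho>(2)] l_cube2[OF x(3) \<rho>(2)]
      by (intro cross) (auto simp: ls Wt_def)
    then obtain \<tau> where \<tau>: "\<tau> \<in> closed_segment 0 s" "level v t x + \<tau> *\<^sub>R i \<in> B" by auto
    have "x + \<tau> *\<^sub>R i \<in> closed_segment x (x + s *\<^sub>R i)"
      using \<tau>(1) unfolding in_segment by (force simp: algebra_simps)
    then have "x + \<tau> *\<^sub>R i \<in> cube z \<rho>"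
      using x(1,3) closed_segment_subset[of x "cube z \<rho>" "x + s *\<^sub>R i"] by (auto simp: cube_eq_cbox)
    then have "level v t (x + \<tau> *\<^sub>R i) \<in> cball (level v t z) (?d * \<rho>)"
      using l_cube cube_subset_cball \<rho> by (meson less_imp_le subsetD)
    then have "level v t x + \<tau> *\<^sub>R i \<in> ?B" using \<tau>(2) lv[of "x + \<tau> *\<^sub>R i"] by (simp add: ls)
    moreover have "x \<bullet> b = (level v t x + \<tau> *\<^sub>R i) \<bullet> b" if "b \<in> Basis - insert i {e}" for b
      using that i lb[of b x] by (auto simp: inner_add_left inner_Basis)
    ultimately show ?thesis by blast
  qed
  have D: "{e} \<subseteq> Basis" using e by simp
  note low = cube_hausdorff_lower[where N="\<lambda>i. {x. level v t x \<in> N i}" and B="?B",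
      OF \<open>Wt \<in> sets borel\<close> D \<alpha>(1) \<rho>(1) N inv' cr d1 d2]
  \<comment> \<open>In dimension 1 there are no horizontal moves, so the cylinder \<open>Wt\<close>
    could not fill only part of a cube.\<close>
  have "{e} \<noteq> Basis" by (rule low(1)) auto
  then show "?d \<noteq> 1" using e by (metis card_1_singletonE singletonD)
  have "ennreal (\<alpha>\<^sup>2 * 2 ^ k * unit_ball_vol k / (?d * 4 ^ k) * \<rho> ^ k) \<le> hausdorff_outer k ?B"
    using low(2) by (simp add: k_def)
  then show "\<exists>\<rho>::real. 0 < \<rho> \<and> \<rho> \<le> r \<and> ennreal (((1/2) ^ (?d + 1))\<^sup>2 * 2 ^ k * unit_ball_vol k / (?d * 4 ^ k) * \<rho> ^ k)
       \<le> hausdorff_outer k (B \<inter> {x. x \<bullet> v = t} \<inter> cball (level v t z) (?d * \<rho>))"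
    unfolding \<alpha>_def using \<rho> by (intro exI[of _ \<rho>] conjI)
qed

text \<open>The values of these constants are immaterial; they depend on the dimension only.\<close>

definition slice_const :: "nat \<Rightarrow> real" where
  "slice_const d = ((1/2) ^ (d + 1))\<^sup>2 * 2 ^ (d - 2) * unit_ball_vol (d - 2) / (d * 4 ^ (d - 2)) / d ^ (d - 2)"

definition thin_const :: "nat \<Rightarrow> real" where
  "thin_const d = 4 * (unit_ball_vol (d - 1) * 6 ^ (d - 1) * (2 * real d)) * (4 * unit_ball_vol (d - 2) / unit_ball_vol (d - 1))
     / slice_const d"

text \<open>Every thin point sees, on almost every level slightly beyond it, a share of the slice of
  \<open>B\<close>. For fixed \<open>t\<close> this bounds the part of \<open>A\<close> in a layer
  just before that level by the measure of one slice; averaging over \<open>t\<close>, adding the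
  layers and applying Eilenberg's inequality bounds \<open>A\<close> by the measure of
  \<open>B\<close>.\<close>

lemma hausdorff_pre_thin_points:
  fixes e :: "'a::euclidean_space" and r :: real
  assumes e: "e \<in> Basis" and v: "v = e \<or> v = - e" and r: "0 < r"
    and W: "W \<in> sets borel" and B [measurable]: "B \<in> sets borel" and fin: "hausdorff_outer (DIM('a) - 1) B < \<infinity>"
    and N: "\<And>i. i \<in> Basis \<Longrightarrow> N i \<in> null_sets lborel"
    and up: "\<And>z x s. \<lbrakk>z \<in> A; x \<in> cube z (2 * r); x \<in> W; 0 \<le> s; x + s *\<^sub>R v \<in> cube z (2 * r)\<rbrakk> \<Longrightarrow> x + s *\<^sub>R v \<in> W"
    and int: "\<And>z s. \<lbrakk>z \<in> A; 0 < s; s < r / 2\<rbrakk> \<Longrightarrow> z + s *\<^sub>R v \<in> interior W"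
    and thin: "\<And>z. z \<in> A \<Longrightarrow> emeasure lborel (cube z r \<inter> W) < ennreal ((2 * r) ^ DIM('a) / 8)"
    and cross: "\<And>z i x s. \<lbrakk>z \<in> A; i \<in> Basis; x \<notin> N i; x \<in> cube z (2 * r); x + s *\<^sub>R i \<in> cube z (2 * r); x \<in> W; x + s *\<^sub>R i \<notin> W\<rbrakk>
      \<Longrightarrow> \<exists>\<tau>\<in>closed_segment 0 s. x + \<tau> *\<^sub>R i \<in> B"
  shows "hausdorff_pre (DIM('a) - 1) (11 * real DIM('a) * r) A \<le> ennreal (thin_const (DIM('a))) * hausdorff_outer (DIM('a) - 1) B"
proof -
  let ?d = "DIM('a)"
  define k where "k = ?d - Suc 1"
  have nv: "norm v = 1" using v e by auto
  have null: "AE t in lborel. \<forall>i\<in>Basis. {x. level v t x \<in> N i} \<in> null_sets lborel"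
    using AE_level_null[OF N] by (simp add: AE_ball_countable countable_finite)
  have slice: "?d \<noteq> 1 \<and> (\<exists>\<rho>::real. 0 < \<rho> \<and> \<rho> \<le> r \<and> ennreal (((1/2) ^ (?d + 1))\<^sup>2 * 2 ^ k * unit_ball_vol k / (?d * 4 ^ k) * \<rho> ^ k)
       \<le> hausdorff_outer k (B \<inter> {x. x \<bullet> v = t} \<inter> cball (level v t z) (?d * \<rho>)))"
    if z: "z \<in> A" and t: "z \<bullet> v < t" "t < z \<bullet> v + r / 2" and nt: "\<forall>i\<in>Basis. {x. level v t x \<in> N i} \<in> null_sets lborel"
    for z t
  proof -
    have il: "level v t z \<in> interior W" unfolding level_def using t by (intro int z) auto
    have nt': "{x. level v t x \<in> N i} \<in> null_sets lborel" if "i \<in> Basis" for i using nt that by blast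
    note * = slice_lower_density[OF e v r t W up[OF z] il thin[OF z] nt' cross[OF z]]
    show ?thesis unfolding k_def using *(1) *(2) by (intro conjI)
  qed
  show ?thesis
  \<comment> \<open>In dimension 1 there are no thin points: a single admissible level contradicts
    \<open>slice\<close>.\<close>
  proof (cases "?d = 1")
    case True
    have "A = {}"
    proof (rule ccontr)
      assume "A \<noteq> {}"
      then obtain z where z: "z \<in> A" by auto
      have "\<not> (\<forall>t\<in>{z \<bullet> v<..<z \<bullet> v + r / 2}. \<not> (\<forall>i\<in>Basis. {x. level v t x \<in> N i} \<in> null_sets lborel))"
      proof
        assume *: "\<forall>t\<in>{z \<bullet> v<..<z \<bullet> v + r / 2}. \<not> (\<forall>i\<in>Basis. {x. level v t x \<in> N i} \<in> null_sets lborel)"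
        from null have "AE t in lborel. t \<notin> {z \<bullet> v<..<z \<bullet> v + r / 2}"
          by eventually_elim (use * in blast)
        then have "emeasure lborel {z \<bullet> v<..<z \<bullet> v + r / 2} = 0"
          by (subst AE_iff_measurable[symmetric, where P="\<lambda>t. t \<notin> {z \<bullet> v<..<z \<bullet> v + r / 2}"]) auto
        then show False using r by simp
      qed
      then obtain t where "z \<bullet> v < t" "t < z \<bullet> v + r / 2" "\<forall>i\<in>Basis. {x. level v t x \<in> N i} \<in> null_sets lborel"
        by auto
      from slice[OF z this] True show False by blast
    qed
    then show ?thesis using r by (simp add: hausdorff_pre_empty)
  next
    case False
    have d0: "0 < ?d" by simp
    have dk: "?d = Suc (Suc k)" "?d - 1 = Suc k" "?d - 2 = k" using False d0 unfolding k_def by arith+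
    define c where "c = slice_const ?d"
    have ub: "0 < unit_ball_vol (real k)" "0 < unit_ball_vol (real (Suc k))" by (rule unit_ball_vol_pos; simp)+
    have c: "0 < c"
      unfolding c_def slice_const_def dk(3) using ub(1)
      by (intro divide_pos_pos mult_pos_pos zero_less_power) auto
    have c_eq: "((1/2) ^ (?d + 1))\<^sup>2 * 2 ^ k * unit_ball_vol k / (?d * 4 ^ k) * \<rho> ^ k = c * (real ?d * \<rho>) ^ k" for \<rho> :: real
      by (simp add: c_def slice_const_def dk(3) power_mult_distrib)
    define q where "q = unit_ball_vol (Suc k) * 6 ^ Suc k * (2 * real ?d)"
    have q: "0 < q" using ub by (simp add: q_def)
    define cE where "cE = 4 * unit_ball_vol k / unit_ball_vol (Suc k)"
    have cE: "0 < cE" using ub by (simp add: cE_def)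
    have "\<bar>x \<bullet> v - y \<bullet> v\<bar> \<le> dist x y" for x y :: 'a
      using Cauchy_Schwarz_ineq2[of "x - y" v] nv by (simp add: inner_diff_left dist_norm)
    then obtain F where F [measurable]: "F \<in> borel_measurable borel"
      and F1: "\<And>t. hausdorff_outer k (B \<inter> {x. x \<bullet> v = t}) \<le> F t"
      and F2: "(\<integral>\<^sup>+t. F t \<partial>lborel) \<le> ennreal cE * hausdorff_outer (Suc k) B"
      using eilenberg_inequality[of "\<lambda>x. x \<bullet> v" k B] fin unfolding dk(2) cE_def by blast
    \<comment> \<open>Layers of height \<open>r / 4\<close>, each paired with the interval of levels
      of the same length that follows it; then \<open>0 < t - z \<bullet> v\<close> and
      \<open>t - z \<bullet> v < r / 2\<close> for all points of the layer and all levels of the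
      interval at once. The intervals are disjoint, so their integrals add up to at most the
      integral of \<open>F\<close>.\<close>
    define I where "I j = {(real_of_int j + 1) * (r / 4)<..<(real_of_int j + 2) * (r / 4)}" for j :: int
    define Aj where "Aj j = {z\<in>A. real_of_int j * (r / 4) \<le> z \<bullet> v \<and> z \<bullet> v < (real_of_int j + 1) * (r / 4)}" for j :: int
    let ?\<delta> = "11 * real ?d * r"
    have cover: "A \<subseteq> (\<Union>j. Aj j)"
    proof
      fix z assume z: "z \<in> A"
      define j where "j = \<lfloor>z \<bullet> v / (r / 4)\<rfloor>"
      have "real_of_int j \<le> z \<bullet> v / (r / 4)" "z \<bullet> v / (r / 4) < real_of_int j + 1" unfolding j_def by linarith+
      then have "z \<in> Aj j" using z r by (simp add: Aj_def pos_le_divide_eq pos_divide_less_eq)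
      then show "z \<in> (\<Union>j. Aj j)" by blast
    qed
    have layer: "ennreal (c / 4) * hausdorff_pre (Suc k) ?\<delta> (Aj j) \<le> ennreal q * (\<integral>\<^sup>+t. F t * indicator (I j) t \<partial>lborel)" for j
    proof -
      let ?X = "ennreal c * hausdorff_pre (Suc k) ?\<delta> (Aj j)"
      have "AE t in lborel. ?X * indicator (I j) t \<le> ennreal (q * r) * (F t * indicator (I j) t)"
        using null
      proof eventually_elim
        case (elim t)
        show ?case
        proof (cases "t \<in> I j")
          case True
          have zt: "z \<bullet> v < t \<and> t < z \<bullet> v + r / 2" if "z \<in> Aj j" for z
            using that True by (auto simp: Aj_def I_def algebra_simps)
          have "?X \<le> ennreal (unit_ball_vol (Suc k) * 6 ^ Suc k * (2 * real ?d * r)) * hausdorff_outer k (B \<inter> {x. x \<bullet> v = t})"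
          proof (rule hausdorff_pre_le_slice[OF _ c nv r])
            show "B \<inter> {x. x \<bullet> v = t} \<in> sets borel" by measurable
            show "1 \<le> real ?d" by simp
            fix z assume z: "z \<in> Aj j"
            show "t - r < z \<bullet> v \<and> z \<bullet> v \<le> t" using zt[OF z] r by auto
            have zA: "z \<in> A" using z by (simp add: Aj_def)
            have "\<exists>\<rho>::real. 0 < \<rho> \<and> \<rho> \<le> r \<and> ennreal (c * (real ?d * \<rho>) ^ k)
               \<le> hausdorff_outer k (B \<inter> {x. x \<bullet> v = t} \<inter> cball (level v t z) (real ?d * \<rho>))"
              using slice[OF zA zt[OF z, THEN conjunct1] zt[OF z, THEN conjunct2] elim]
              unfolding c_eq by (rule conjunct2)
            then obtain \<rho> :: real where \<rho>: "0 < \<rho>" "\<rho> \<le> r" "ennreal (c * (real ?d * \<rho>) ^ k)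
               \<le> hausdorff_outer k (B \<inter> {x. x \<bullet> v = t} \<inter> cball (level v t z) (real ?d * \<rho>))"
              by (elim exE conjE)
            then show "\<exists>\<rho>::real. 0 < \<rho> \<and> \<rho> \<le> real ?d * r \<and> ennreal (c * \<rho> ^ k)
                \<le> hausdorff_outer k (B \<inter> {x. x \<bullet> v = t} \<inter> cball (z + (t - z \<bullet> v) *\<^sub>R v) \<rho>)"
              unfolding level_def by (intro exI[of _ "real ?d * \<rho>"]) auto
          qed
          also have "unit_ball_vol (Suc k) * 6 ^ Suc k * (2 * real ?d * r) = q * r" by (simp only: q_def mult_ac)
          also have "ennreal (q * r) * hausdorff_outer k (B \<inter> {x. x \<bullet> v = t}) \<le> ennreal (q * r) * F t"
            by (intro mult_left_mono F1) auto
          finally show ?thesis using True by simp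
        qed simp
      qed
      then have "(\<integral>\<^sup>+t. ?X * indicator (I j) t \<partial>lborel) \<le> (\<integral>\<^sup>+t. ennreal (q * r) * (F t * indicator (I j) t) \<partial>lborel)"
        by (rule nn_integral_mono_AE)
      also have "\<dots> = ennreal (q * r) * (\<integral>\<^sup>+t. F t * indicator (I j) t \<partial>lborel)"
        by (rule nn_integral_cmult) (simp add: I_def)
      also have "(\<integral>\<^sup>+t. ?X * indicator (I j) t \<partial>lborel) = ?X * ennreal (r / 4)"
      proof -
        have "(\<integral>\<^sup>+t. ?X * indicator (I j) t \<partial>lborel) = ?X * emeasure lborel (I j)"
          by (rule nn_integral_cmult_indicator) (simp add: I_def)
        also have "emeasure lborel (I j) = ennreal (r / 4)"
          using r by (simp add: I_def algebra_simps)
        finally show ?thesis .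
      qed
      finally have "?X * ennreal (r / 4) \<le> ennreal (q * r) * (\<integral>\<^sup>+t. F t * indicator (I j) t \<partial>lborel)" .
      moreover have "?X * ennreal (r / 4) = ennreal r * (ennreal (c / 4) * hausdorff_pre (Suc k) ?\<delta> (Aj j))"
      proof -
        have "ennreal c * ennreal (r / 4) = ennreal r * ennreal (c / 4)"
          using c r by (simp add: ennreal_mult[symmetric] mult.commute)
        then have "ennreal c * ennreal (r / 4) * y = ennreal r * ennreal (c / 4) * y" for y by simp
        from this[of "hausdorff_pre (Suc k) ?\<delta> (Aj j)"] show ?thesis by (simp only: mult_ac)
      qed
      moreover have "ennreal (q * r) = ennreal r * ennreal q"
        using q r by (simp add: ennreal_mult[symmetric] mult.commute)
      ultimately have "ennreal r * (ennreal (c / 4) * hausdorff_pre (Suc k) ?\<delta> (Aj j))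
          \<le> ennreal r * (ennreal q * (\<integral>\<^sup>+t. F t * indicator (I j) t \<partial>lborel))" by (simp add: mult.assoc)
      then show ?thesis using r by (subst (asm) ennreal_mult_le_mult_iff) auto
    qed
    have I_borel: "I j \<in> sets borel" for j by (simp add: I_def)
    have disj: "disjoint_family I"
      unfolding disjoint_family_on_def
    proof (intro ballI impI, rule ccontr)
      fix i j :: int assume ij: "i \<noteq> j" "I i \<inter> I j \<noteq> {}"
      then obtain t where t: "t \<in> I i" "t \<in> I j" by auto
      have "(real_of_int i + 1) * (r / 4) < (real_of_int j + 2) * (r / 4)"
        "(real_of_int j + 1) * (r / 4) < (real_of_int i + 2) * (r / 4)"
        using t by (auto simp: I_def intro: less_trans)
      then have "real_of_int i + 1 < real_of_int j + 2" "real_of_int j + 1 < real_of_int i + 2"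
        using r by (simp_all only: mult_less_cancel_right_pos zero_less_divide_iff zero_less_numeral simp_thms)
      then show False using ij(1) by linarith
    qed
    have "ennreal (c / 4) * hausdorff_pre (Suc k) ?\<delta> A
        \<le> ennreal (c / 4) * (\<integral>\<^sup>+j. hausdorff_pre (Suc k) ?\<delta> (Aj j) \<partial>count_space UNIV)"
      using r by (intro mult_left_mono order_trans[OF hausdorff_pre_mono[OF cover] hausdorff_pre_UN_countable_le]) auto
    also have "\<dots> = (\<integral>\<^sup>+j. ennreal (c / 4) * hausdorff_pre (Suc k) ?\<delta> (Aj j) \<partial>count_space UNIV)"
      by (rule nn_integral_cmult[symmetric]) auto
    also have "\<dots> \<le> (\<integral>\<^sup>+j. ennreal q * (\<integral>\<^sup>+t. F t * indicator (I j) t \<partial>lborel) \<partial>count_space UNIV)"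
      by (intro nn_integral_mono layer)
    also have "\<dots> = ennreal q * (\<integral>\<^sup>+j. (\<integral>\<^sup>+t. F t * indicator (I j) t \<partial>lborel) \<partial>count_space UNIV)"
      by (rule nn_integral_cmult) auto
    also have "(\<integral>\<^sup>+j. (\<integral>\<^sup>+t. F t * indicator (I j) t \<partial>lborel) \<partial>count_space UNIV)
        = (\<integral>\<^sup>+j. emeasure (density lborel F) (I j) \<partial>count_space UNIV)"
      by (intro nn_integral_cong) (simp add: emeasure_density I_def)
    also have "\<dots> = emeasure (density lborel F) (\<Union>j. I j)"
      by (rule emeasure_UN_countable[symmetric]) (use disj in \<open>simp_all add: I_borel\<close>)
    also have "\<dots> \<le> emeasure (density lborel F) UNIV"
      by (intro emeasure_mono) auto
    also have "\<dots> = (\<integral>\<^sup>+t. F t \<partial>lborel)" by (simp add: emeasure_density)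
    also note F2
    finally have 1: "ennreal (c / 4) * hausdorff_pre (Suc k) ?\<delta> A \<le> ennreal q * (ennreal cE * hausdorff_outer (Suc k) B)"
      by (simp add: mult_left_mono)
    have "hausdorff_pre (Suc k) ?\<delta> A = ennreal (4 / c) * (ennreal (c / 4) * hausdorff_pre (Suc k) ?\<delta> A)"
      using c by (simp add: mult.assoc[symmetric] ennreal_mult[symmetric])
    also have "\<dots> \<le> ennreal (4 / c) * (ennreal q * (ennreal cE * hausdorff_outer (Suc k) B))"
      by (intro mult_left_mono 1) auto
    also have "\<dots> = ennreal (4 / c * q * cE) * hausdorff_outer (Suc k) B"
      using c q cE by (simp add: mult.assoc[symmetric] ennreal_mult[symmetric])
    also have "4 / c * q * cE = thin_const ?d"
      unfolding thin_const_def c_def[symmetric] dk(2,3) q_def cE_def by simp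
    finally show ?thesis unfolding dk(2) .
  qed
qed

section \<open>Sets avoided by the crossings are null\<close>

lemma hausdorff_pre_Un_le: "0 \<le> \<delta> \<Longrightarrow> hausdorff_pre k \<delta> (A \<union> B) \<le> hausdorff_pre k \<delta> A + hausdorff_pre k \<delta> B"
proof -
  assume "0 \<le> \<delta>"
  then have "hausdorff_pre k \<delta> (\<Union>b::bool. if b then A else B)
      \<le> (\<integral>\<^sup>+b. hausdorff_pre k \<delta> (if b then A else B) \<partial>count_space UNIV)"
    by (intro hausdorff_pre_UN_countable_le) auto
  also have "\<dots> = hausdorff_pre k \<delta> A + hausdorff_pre k \<delta> B"
    by (simp add: nn_integral_count_space_finite UNIV_bool add.commute)
  also have "(\<Union>b::bool. if b then A else B) = A \<union> B" by (auto split: if_splits)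
  finally show ?thesis .
qed

text \<open>The bound of \<open>cube_hausdorff_lower\<close> for \<open>D = {}\<close> and
  \<open>\<alpha> = 1/8\<close>; the last divisor appears because a cube of half-side
  \<open>\<rho>\<close> is enclosed in a ball of radius \<open>d * \<rho>\<close>.\<close>

definition good_const :: "nat \<Rightarrow> real" where
  "good_const d = (1/8)\<^sup>2 * 2 ^ (d - 1) * unit_ball_vol (d - 1) / (d * 4 ^ (d - 1)) / d ^ (d - 1)"

text \<open>The neighbourhoods decrease to \<open>K\<close>, which is closed and misses
  \<open>B\<close>; continuity from above applies as \<open>B\<close> has finite measure.\<close>

lemma emeasure_hausdorff_nhds_tendsto_0:
  fixes K B :: "'a::euclidean_space set"
  assumes K: "compact K" and B: "B \<in> sets borel" and fin: "hausdorff_outer k B < \<infinity>" and KB: "K \<inter> B = {}"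
  shows "(\<lambda>n. hausdorff_outer k (B \<inter> (\<Union>z\<in>K. ball z (1 / real (Suc n))))) \<longlonglongrightarrow> 0"
proof -
  let ?V = "\<lambda>n. \<Union>z\<in>K. ball z (1 / real (Suc n))"
  have "open (?V n)" for n by auto
  then have m: "B \<inter> ?V n \<in> sets (hausdorff k)" for n
    using B by (intro borel_sets_hausdorff) auto
  have "(\<lambda>n. emeasure (hausdorff k) (B \<inter> ?V n)) \<longlonglongrightarrow> emeasure (hausdorff k) (\<Inter>n. B \<inter> ?V n)"
  proof (rule Lim_emeasure_decseq)
    show "range (\<lambda>n. B \<inter> ?V n) \<subseteq> sets (hausdorff k)" using m by auto
    show "decseq (\<lambda>n. B \<inter> ?V n)"
    proof (rule decseq_SucI)
      fix n
      have "1 / real (Suc (Suc n)) \<le> 1 / real (Suc n)" by (intro frac_le) auto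
      then have "ball z (1 / real (Suc (Suc n))) \<subseteq> ball z (1 / real (Suc n))" for z :: 'a
        by (rule subset_ball)
      then show "B \<inter> ?V (Suc n) \<subseteq> B \<inter> ?V n" by blast
    qed
    show "emeasure (hausdorff k) (B \<inter> ?V n) \<noteq> \<infinity>" for n
    proof -
      have "emeasure (hausdorff k) (B \<inter> ?V n) = hausdorff_outer k (B \<inter> ?V n)" by (rule emeasure_hausdorff[OF m])
      also have "\<dots> \<le> hausdorff_outer k B" by (rule hausdorff_outer_mono) auto
      also note fin
      finally show ?thesis by simp
    qed
  qed
  moreover have "(\<Inter>n. B \<inter> ?V n) = {}"
  proof (rule ccontr)
    assume "(\<Inter>n. B \<inter> ?V n) \<noteq> {}"
    then obtain x where x: "x \<in> B" "\<And>n. x \<in> ?V n" by blast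
    have "x \<in> closure K"
      unfolding closure_approachable
    proof (intro allI impI)
      fix e :: real assume "0 < e"
      then obtain n where n: "1 / real (Suc n) < e" using nat_approx_posE by blast
      obtain z where "z \<in> K" "x \<in> ball z (1 / real (Suc n))" using x(2)[of n] by blast
      then show "\<exists>y\<in>K. dist y x < e" using n by (intro bexI[of _ z]) auto
    qed
    then have "x \<in> K" using K by (simp add: compact_imp_closed)
    with x KB show False by blast
  qed
  ultimately show ?thesis using emeasure_hausdorff[OF m] by simp
qed

lemma ennreal_le_null_seq:
  fixes X :: ennreal
  assumes "\<And>n. n \<ge> n0 \<Longrightarrow> X \<le> ennreal c * f n" "f \<longlonglongrightarrow> 0"
  shows "X = 0"
proof -
  have "(\<lambda>n. ennreal c * f n) \<longlonglongrightarrow> ennreal c * 0"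
    using assms(2) by (intro ennreal_tendsto_cmult) auto
  then have "X \<le> 0"
    using assms(1) by (intro LIMSEQ_le_const) auto
  then show ?thesis by simp
qed

text \<open>The heart of the proof. The set \<open>B\<close> contains a boundary point on almost every coordinate line
  that leaves \<open>P\<close>, so a subset of the boundary avoiding \<open>B\<close> carries no surface measure: otherwise
  \<open>B\<close> would have positive density on it.\<close>

theorem hausdorff_null_of_crossings:
  fixes e :: "'a::euclidean_space"
  assumes e: "e \<in> Basis" and P [measurable]: "P \<in> sets borel" and K: "compact K" and O: "open G" "K \<subseteq> G"
    and B: "B \<in> sets borel" and fin: "hausdorff_outer (DIM('a) - 1) B < \<infinity>" and KB: "K \<inter> B = {}"
    and N: "\<And>i. i \<in> Basis \<Longrightarrow> N i \<in> null_sets lborel"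
    and cross: "\<And>i x s. \<lbrakk>i \<in> Basis; x \<notin> N i; closed_segment x (x + s *\<^sub>R i) \<subseteq> G; (x \<in> P) \<noteq> (x + s *\<^sub>R i \<in> P)\<rbrakk>
      \<Longrightarrow> \<exists>\<tau>\<in>closed_segment 0 s. x + \<tau> *\<^sub>R i \<in> B"
    and down: "\<And>x s. \<lbrakk>x \<in> P; x \<in> G; 0 \<le> s; x - s *\<^sub>R e \<in> G\<rbrakk> \<Longrightarrow> x - s *\<^sub>R e \<in> P"
    and int: "\<And>z s. \<lbrakk>z \<in> K; 0 < s; z + s *\<^sub>R e \<in> G\<rbrakk> \<Longrightarrow> z + s *\<^sub>R e \<in> interior (- P)"
      "\<And>z s. \<lbrakk>z \<in> K; 0 < s; z - s *\<^sub>R e \<in> G\<rbrakk> \<Longrightarrow> z - s *\<^sub>R e \<in> interior P"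
  shows "hausdorff_outer (DIM('a) - 1) K = 0"
proof -
  let ?d = "DIM('a)" and ?m = "DIM('a) - 1"
  define V where "V n = (\<Union>z\<in>K. ball z (1 / real (Suc n)))" for n
  define \<epsilon> where "\<epsilon> n = hausdorff_outer ?m (B \<inter> V n)" for n
  have \<epsilon>0: "\<epsilon> \<longlonglongrightarrow> 0"
    unfolding \<epsilon>_def V_def by (rule emeasure_hausdorff_nhds_tendsto_0[OF K B fin KB])
  have "open (V n)" for n by (auto simp: V_def)
  then have BV: "B \<inter> V n \<in> sets borel" for n using B by auto
  have BVfin: "hausdorff_outer ?m (B \<inter> V n) < \<infinity>" for n
    using hausdorff_outer_mono[of "B \<inter> V n" B ?m] fin by (auto intro: le_less_trans)
  obtain \<delta>0 where \<delta>0: "0 < \<delta>0" "(\<Union>z\<in>K. ball z \<delta>0) \<subseteq> G"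
    using compact_subset_open_imp_ball_epsilon_subset[OF K O] by blast
  obtain n0 where n0: "1 / real (Suc n0) < \<delta>0" using nat_approx_posE[OF \<delta>0(1)] by blast
  have VG: "V n \<subseteq> G" if "n0 \<le> n" for n
  proof -
    have "1 / real (Suc n) \<le> 1 / real (Suc n0)" using that by (intro frac_le) auto
    then have "1 / real (Suc n) \<le> \<delta>0" using n0 by linarith
    then have "ball z (1 / real (Suc n)) \<subseteq> ball z \<delta>0" for z :: 'a by (rule subset_ball)
    then show ?thesis using \<delta>0(2) unfolding V_def by blast
  qed
  have cubeV: "cube z \<rho> \<subseteq> V n" if "z \<in> K" "real ?d * \<rho> < 1 / real (Suc n)" for z n and \<rho> :: real
  proof
    fix x assume "x \<in> cube z \<rho>"
    then have "x \<in> cball z (real ?d * \<rho>)" using cube_subset_cball by blast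
    then have "x \<in> ball z (1 / real (Suc n))" using that(2) by auto
    then show "x \<in> V n" using that(1) by (auto simp: V_def)
  qed
  \<comment> \<open>Crossings between points of a small cube around a point of \<open>K\<close> lie
    in that cube, hence in \<open>V n\<close>. So \<open>B\<close> may be replaced by its part near
    \<open>K\<close>, whose measure tends to 0 with growing \<open>n\<close>.\<close>
  have hit: "\<exists>\<tau>\<in>closed_segment 0 s. x + \<tau> *\<^sub>R i \<in> B \<inter> cube z \<rho>"
    if z: "z \<in> K" "real ?d * \<rho> < 1 / real (Suc n)" "n0 \<le> n" and i: "i \<in> Basis" "x \<notin> N i"
      and x: "x \<in> cube z \<rho>" "x + s *\<^sub>R i \<in> cube z \<rho>" and PP: "(x \<in> P) \<noteq> (x + s *\<^sub>R i \<in> P)"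
    for z n i x s and \<rho> :: real
  proof -
    have seg: "closed_segment x (x + s *\<^sub>R i) \<subseteq> cube z \<rho>"
      using x closed_segment_subset[of x "cube z \<rho>" "x + s *\<^sub>R i"] by (simp add: cube_eq_cbox)
    then have "closed_segment x (x + s *\<^sub>R i) \<subseteq> G" using cubeV[OF z(1,2)] VG[OF z(3)] by blast
    from cross[OF i this PP] obtain \<tau> where \<tau>: "\<tau> \<in> closed_segment 0 s" "x + \<tau> *\<^sub>R i \<in> B" by blast
    have "x + \<tau> *\<^sub>R i \<in> closed_segment x (x + s *\<^sub>R i)"
      using \<tau>(1) unfolding in_segment by (force simp: algebra_simps)
    then have "x + \<tau> *\<^sub>R i \<in> cube z \<rho>" using seg by blast
    with \<tau> show ?thesis by blast
  qed
  let ?thick = "\<lambda>z (\<rho>::real) W. ennreal ((1/8) * (2 * \<rho>) ^ ?d) \<le> emeasure lborel (cube z \<rho> \<inter> W)"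
  \<comment> \<open>\<open>Kg\<close>: at arbitrarily small scales both \<open>P\<close> and its
    complement fill an eighth of the cube. \<open>Kb j\<close>: at every scale below
    \<open>1 / (j + 1)\<close> one of them does not. Together they exhaust \<open>K\<close>.\<close>
  define Kg where "Kg = {z\<in>K. \<forall>\<delta>>0. \<exists>\<rho>. 0 < \<rho> \<and> \<rho> < \<delta> \<and> ?thick z \<rho> P \<and> ?thick z \<rho> (- P)}"
  define Kb where "Kb j = {z\<in>K. \<forall>\<rho>. 0 < \<rho> \<and> \<rho> < 1 / real (Suc j) \<longrightarrow> \<not> ?thick z \<rho> P \<or> \<not> ?thick z \<rho> (- P)}" for j
  have "hausdorff_outer ?m Kg = 0"
  proof -
    define c where "c = good_const ?d"
    have c: "0 < c"
      unfolding c_def good_const_def using unit_ball_vol_pos[of "real ?m"]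
      by (intro divide_pos_pos mult_pos_pos zero_less_power) auto
    have "ennreal c * hausdorff_outer ?m Kg \<le> ennreal (unit_ball_vol ?m * 5 ^ ?m) * hausdorff_outer ?m (B \<inter> V n)"
      if n: "n0 \<le> n" for n
    proof (rule hausdorff_le_of_lower_density[OF BV c])
      fix z and \<delta> :: real assume z: "z \<in> Kg" and \<delta>: "0 < \<delta>"
      define \<delta>' where "\<delta>' = min \<delta> (1 / real (Suc n)) / real ?d"
      have "0 < \<delta>'" using \<delta> by (simp add: \<delta>'_def)
      then obtain \<rho> where \<rho>: "0 < \<rho>" "\<rho> < \<delta>'" "?thick z \<rho> P" "?thick z \<rho> (- P)"
        using z unfolding Kg_def by blast
      have "real ?d * \<rho> < min \<delta> (1 / real (Suc n))"
        using \<rho>(2) by (simp add: \<delta>'_def pos_less_divide_eq mult.commute)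
      then have d\<rho>: "real ?d * \<rho> < \<delta>" "real ?d * \<rho> < 1 / real (Suc n)" by auto
      have zK: "z \<in> K" using z by (simp add: Kg_def)
      let ?B = "(B \<inter> V n) \<inter> cball z (real ?d * \<rho>)"
      have diff: "cube z \<rho> \<inter> - P = cube z \<rho> - P" by auto
      have cr: "\<exists>y\<in>?B. \<forall>b\<in>Basis - insert i {}. x \<bullet> b = y \<bullet> b"
        if "i \<in> Basis - {}" "x \<in> cube z \<rho>" "x \<notin> N i" "x + s *\<^sub>R i \<in> cube z \<rho>" "x \<in> P" "x + s *\<^sub>R i \<notin> P" for i x s
      proof -
        have i: "i \<in> Basis" and PP: "(x \<in> P) \<noteq> (x + s *\<^sub>R i \<in> P)" using that by simp_all
        from hit[OF zK d\<rho>(2) n i that(3) that(2) that(4) PP]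
        obtain \<tau> where \<tau>: "x + \<tau> *\<^sub>R i \<in> B \<inter> cube z \<rho>" by (elim bexE)
        then have "x + \<tau> *\<^sub>R i \<in> ?B" using cubeV[OF zK d\<rho>(2)] cube_subset_cball by blast
        moreover have "x \<bullet> b = (x + \<tau> *\<^sub>R i) \<bullet> b" if "b \<in> Basis - insert i {}" for b
          using that \<open>i \<in> Basis - {}\<close> by (auto simp: inner_add_left inner_Basis)
        ultimately show ?thesis by blast
      qed
      have "ennreal ((1/8)\<^sup>2 * 2 ^ (?d - Suc (card ({}::'a set))) * unit_ball_vol (?d - Suc (card ({}::'a set)))
          / (?d * 4 ^ (?d - Suc (card ({}::'a set)))) * \<rho> ^ (?d - Suc (card ({}::'a set))))
          \<le> hausdorff_outer (?d - Suc (card ({}::'a set))) ?B"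
        by (rule cube_hausdorff_lower(2)[where W=P and z=z and N=N and D="{}" and \<alpha>="1/8" and \<rho>=\<rho>])
          (use \<rho> cr N diff in auto)
      then have "ennreal (c * (real ?d * \<rho>) ^ ?m) \<le> hausdorff_outer ?m ?B"
        by (simp add: c_def good_const_def power_mult_distrib mult.assoc)
      then show "\<exists>r. 0 < r \<and> r < \<delta> \<and> ennreal (c * r ^ ?m) \<le> hausdorff_outer ?m (B \<inter> V n \<inter> cball z r)"
        using d\<rho> \<rho>(1) by (intro exI[of _ "real ?d * \<rho>"]) auto
    qed
    then have "ennreal c * hausdorff_outer ?m Kg = 0"
      using \<epsilon>0 unfolding \<epsilon>_def by (intro ennreal_le_null_seq[of n0])
    then show ?thesis using c by simp
  qed
  moreover have "hausdorff_outer ?m (Kb j) = 0" for j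
  proof (rule ennreal_le_null_seq[OF _ \<epsilon>0, of n0])
    fix n assume n: "n0 \<le> n"
    show "hausdorff_outer ?m (Kb j) \<le> ennreal (2 * thin_const ?d) * \<epsilon> n"
      unfolding hausdorff_outer_def[of ?m "Kb j"]
    proof (rule SUP_least)
      fix \<delta> :: real assume "\<delta> \<in> {0<..}"
      \<comment> \<open>Small enough for three purposes: covers at scale
        \<open>11 * DIM('a) * r\<close> are admissible for \<open>\<delta>\<close>, the points of
        \<open>Kb j\<close> are thin on one side at scale \<open>r\<close>, and the doubled cubes
        lie in \<open>V n\<close>.\<close>
      define r where "r = min (min \<delta> (1 / real (Suc j))) (1 / real (Suc n)) / (11 * real ?d)"
      have r: "0 < r" using \<open>\<delta> \<in> {0<..}\<close> by (simp add: r_def)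
      have "11 * real ?d * r = min (min \<delta> (1 / real (Suc j))) (1 / real (Suc n))" by (simp add: r_def)
      then have r1: "11 * real ?d * r \<le> \<delta>" "11 * real ?d * r \<le> 1 / real (Suc j)" "11 * real ?d * r \<le> 1 / real (Suc n)"
        by auto
      have "1 * r \<le> real ?d * r" using r by (intro mult_right_mono) auto
      then have r2: "r < 1 / real (Suc j)" "real ?d * (2 * r) < 1 / real (Suc n)" using r1 r by linarith+
      \<comment> \<open>The two cases are mirror images: within \<open>G\<close>, \<open>P\<close>
        is closed under moving along \<open>- e\<close> and its complement under moving along
        \<open>e\<close>, and the corresponding ray from \<open>z\<close> runs in the
        interior.\<close>
      have half: "hausdorff_pre ?m (11 * real ?d * r) {z\<in>K. \<not> ?thick z r W} \<le> ennreal (thin_const ?d) * \<epsilon> n"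
        if W: "W = P \<and> v = - e \<or> W = - P \<and> v = e" for W v
        unfolding \<epsilon>_def
      proof (rule hausdorff_pre_thin_points[OF e _ r _ BV BVfin N])
        show "v = e \<or> v = - e" using W by auto
        show "W \<in> sets borel" using W by auto
        fix z assume "z \<in> {z\<in>K. \<not> ?thick z r W}"
        then have z: "z \<in> K" and nt: "\<not> ?thick z r W" by auto
        have cG: "cube z (2 * r) \<subseteq> G" using cubeV[OF z r2(2)] VG[OF n] by blast
        show "x + s *\<^sub>R v \<in> W" if "x \<in> cube z (2 * r)" "x \<in> W" "0 \<le> s" "x + s *\<^sub>R v \<in> cube z (2 * r)" for x s
          using W
        proof
          assume "W = P \<and> v = - e"
          then show ?thesis using down[of x s] that cG by auto
        next
          assume "W = - P \<and> v = e"
          then show ?thesis using down[of "x + s *\<^sub>R e" s] that cG by auto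
        qed
        show "z + s *\<^sub>R v \<in> interior W" if s: "0 < s" "s < r / 2" for s
        proof -
          have "norm v = 1" using W e by auto
          then have "\<bar>(s *\<^sub>R v) \<bullet> b\<bar> \<le> 2 * r" if "b \<in> Basis" for b
            using Basis_le_norm[OF that, of "s *\<^sub>R v"] s r by simp
          then have "z + s *\<^sub>R v \<in> G" using cG by (auto simp: cube_def)
          then show ?thesis using int[OF z s(1)] W by auto
        qed
        show "emeasure lborel (cube z r \<inter> W) < ennreal ((2 * r) ^ ?d / 8)"
          using nt by (simp add: not_le)
        fix i :: 'a and x s assume i: "i \<in> Basis" "x \<notin> N i" "x \<in> cube z (2 * r)" "x + s *\<^sub>R i \<in> cube z (2 * r)"
          and "x \<in> W" "x + s *\<^sub>R i \<notin> W"
        then have "(x \<in> P) \<noteq> (x + s *\<^sub>R i \<in> P)" using W by auto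
        from hit[OF z r2(2) n i this]
        show "\<exists>\<tau>\<in>closed_segment 0 s. x + \<tau> *\<^sub>R i \<in> B \<inter> V n" using cubeV[OF z r2(2)] by blast
      qed
      have "Kb j \<subseteq> {z\<in>K. \<not> ?thick z r P} \<union> {z\<in>K. \<not> ?thick z r (- P)}"
        using r r2(1) unfolding Kb_def by blast
      then have "hausdorff_pre ?m (11 * real ?d * r) (Kb j)
          \<le> hausdorff_pre ?m (11 * real ?d * r) {z\<in>K. \<not> ?thick z r P} + hausdorff_pre ?m (11 * real ?d * r) {z\<in>K. \<not> ?thick z r (- P)}"
        using r by (intro order_trans[OF hausdorff_pre_mono hausdorff_pre_Un_le]) auto
      also have "\<dots> \<le> ennreal (thin_const ?d) * \<epsilon> n + ennreal (thin_const ?d) * \<epsilon> n"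
        by (intro add_mono half[of P "- e"] half[of "- P" e]) auto
      also have "\<dots> = 2 * (ennreal (thin_const ?d) * \<epsilon> n)" by (simp add: mult_2)
      also have "\<dots> = ennreal (2 * thin_const ?d) * \<epsilon> n"
        by (simp add: ennreal_mult' mult.assoc)
      finally show "hausdorff_pre ?m \<delta> (Kb j) \<le> ennreal (2 * thin_const ?d) * \<epsilon> n"
        using hausdorff_pre_antimono[OF r1(1), of ?m "Kb j"] by (rule order_trans[rotated])
    qed
  qed
  moreover have "K \<subseteq> Kg \<union> (\<Union>j. Kb j)"
  proof
    fix z assume z: "z \<in> K"
    show "z \<in> Kg \<union> (\<Union>j. Kb j)"
    proof (rule ccontr)
      assume n: "z \<notin> Kg \<union> (\<Union>j. Kb j)"
      then obtain \<delta> where \<delta>: "0 < \<delta>" "\<not> (\<exists>\<rho>. 0 < \<rho> \<and> \<rho> < \<delta> \<and> ?thick z \<rho> P \<and> ?thick z \<rho> (- P))"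
        using z unfolding Kg_def by blast
      obtain j where j: "1 / real (Suc j) < \<delta>" using nat_approx_posE[OF \<delta>(1)] by blast
      have "z \<in> Kb j" unfolding Kb_def using z \<delta>(2) j by (auto intro: less_trans)
      with n show False by blast
    qed
  qed
  ultimately have "hausdorff_outer ?m K \<le> 0"
  proof -
    have "hausdorff_outer ?m K \<le> hausdorff_outer ?m (Kg \<union> (\<Union>j. Kb j))"
      by (rule hausdorff_outer_mono) fact
    also have "\<dots> \<le> hausdorff_outer ?m Kg + (\<Sum>j. hausdorff_outer ?m (Kb j))"
      by (rule order_trans[OF hausdorff_outer_Un_le add_left_mono[OF hausdorff_outer_UN_le]])
    also have "\<dots> = 0"
      using \<open>hausdorff_outer ?m Kg = 0\<close> \<open>\<And>j. hausdorff_outer ?m (Kb j) = 0\<close> by simp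
    finally show ?thesis .
  qed
  then show ?thesis by simp
qed

subsection \<open>Sobolev functions\<close>

lemma tendsto_0_ennrealI:
  fixes X :: "nat \<Rightarrow> ennreal"
  assumes "\<And>\<eta>. 0 < \<eta> \<Longrightarrow> \<forall>\<^sub>F n in sequentially. X n \<le> ennreal \<eta>"
  shows "X \<longlonglongrightarrow> 0"
proof (rule order_tendstoI)
  fix a :: ennreal assume "0 < a"
  then obtain b where b: "0 < b" "b < a" using dense by blast
  then have "b < top" using less_trans less_top by (metis top.not_eq_extremum)
  then obtain \<eta> where \<eta>: "b = ennreal \<eta>" "0 \<le> \<eta>" by (cases b) auto
  then have "0 < \<eta>" using b by auto
  from assms[OF this] show "\<forall>\<^sub>F n in sequentially. X n < a"
    by eventually_elim (use b \<eta> in auto)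
qed auto

text \<open>For finite \<open>p\<close> the elementary bound
  \<open>y \<le> \<epsilon> + \<epsilon> powr (1 - q) * y powr q\<close> replaces Hoelder's
  inequality: integrate over \<open>S\<close>, with \<open>\<epsilon>\<close> fixed small let
  \<open>n\<close> grow. For \<open>p = \<infinity>\<close> the essential supremum bounds the
  integrand directly.\<close>

lemma Lp_tendsto_L1_bounded:
  fixes f :: "nat \<Rightarrow> 'a \<Rightarrow> real"
  assumes p: "1 \<le> p" and f: "\<And>n. in_Lp p M (f n)" and lim: "(\<lambda>n. Lp_norm p M (f n)) \<longlonglongrightarrow> 0"
    and S: "S \<in> sets M" "emeasure M S < \<infinity>"
  shows "(\<lambda>n. \<integral>\<^sup>+x. indicator S x * ennreal \<bar>f n x\<bar> \<partial>M) \<longlonglongrightarrow> 0"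
proof -
  have fm [measurable]: "f n \<in> borel_measurable M" for n using f by (simp add: in_Lp_def)
  have [measurable]: "S \<in> sets M" by (rule S)
  define s where "s = measure M S"
  have s: "emeasure M S = ennreal s" "0 \<le> s"
    using S(2) by (auto simp: s_def emeasure_eq_ennreal_measure less_top)
  show ?thesis
  proof (cases "p = \<infinity>")
    case True
    have bd: "(\<integral>\<^sup>+x. indicator S x * ennreal \<bar>f n x\<bar> \<partial>M) \<le> ennreal (Lp_norm p M (f n)) * ennreal s" for n
    proof -
      let ?e = "esssup M (\<lambda>x. ennreal \<bar>f n x\<bar>)"
      have "?e < \<infinity>" using f[of n] True by (simp add: in_Lp_def)
      then have e: "?e = ennreal (Lp_norm p M (f n))" using True by (simp add: Lp_norm_def)
      have "AE x in M. ennreal \<bar>f n x\<bar> \<le> ?e" by (rule esssup_AE)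
      then have "(\<integral>\<^sup>+x. indicator S x * ennreal \<bar>f n x\<bar> \<partial>M) \<le> (\<integral>\<^sup>+x. ?e * indicator S x \<partial>M)"
        by (intro nn_integral_mono_AE) (auto simp: indicator_def elim: eventually_mono)
      also have "\<dots> = ?e * emeasure M S" by (rule nn_integral_cmult_indicator) (rule S)
      finally show ?thesis by (simp add: e s)
    qed
    have "(\<lambda>n. ennreal (Lp_norm p M (f n)) * ennreal s) \<longlonglongrightarrow> ennreal 0 * ennreal s"
      using lim by (intro tendsto_mult_ennreal tendsto_ennrealI tendsto_const) auto
    then have "(\<lambda>n. ennreal (Lp_norm p M (f n)) * ennreal s) \<longlonglongrightarrow> 0" by simp
    then show ?thesis
      by (rule tendsto_sandwich[rotated 3, OF _ always_eventually always_eventually tendsto_const]) (use bd in auto)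
  next
    case False
    define q where "q = enn2real p"
    have "p < top" using False by (simp add: less_top)
    then have pq: "p = ennreal q" "1 \<le> q"
      using p by (auto simp: q_def) (metis enn2real_1 enn2real_mono)
    have q0: "0 < q" using pq by simp
    define J where "J n = (LINT x|M. \<bar>f n x\<bar> powr q)" for n
    have Ji: "integrable M (\<lambda>x. \<bar>f n x\<bar> powr q)" for n using f[of n] False by (simp add: in_Lp_def q_def)
    have J0: "0 \<le> J n" for n unfolding J_def by (rule integral_nonneg_AE) auto
    have "(\<lambda>n. (Lp_norm p M (f n)) powr q) \<longlonglongrightarrow> 0 powr q"
      using lim q0 False by (intro tendsto_powr' tendsto_const) (auto simp: Lp_norm_def)
    moreover have "(Lp_norm p M (f n)) powr q = J n" for n
      using False q0 J0[of n] by (simp add: Lp_norm_def J_def q_def powr_powr)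
    ultimately have Jlim: "J \<longlonglongrightarrow> 0" using q0 by simp
    have bd: "(\<integral>\<^sup>+x. indicator S x * ennreal \<bar>f n x\<bar> \<partial>M) \<le> ennreal (\<epsilon> * s + \<epsilon> powr (1 - q) * J n)"
      if \<epsilon>: "0 < \<epsilon>" for n \<epsilon>
    proof -
      have pt: "y \<le> \<epsilon> + \<epsilon> powr (1 - q) * y powr q" if "0 \<le> y" for y :: real
      proof (cases "y \<le> \<epsilon>")
        case True
        then show ?thesis by (simp add: add_increasing2)
      next
        case F: False
        have "y = y powr (1 - q) * y powr q" using F \<epsilon> by (simp add: powr_add[symmetric])
        also have "\<dots> \<le> \<epsilon> powr (1 - q) * y powr q"
          using F \<epsilon> pq by (intro mult_right_mono powr_mono2') auto
        finally show ?thesis using \<epsilon> by simp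
      qed
      have "(\<integral>\<^sup>+x. indicator S x * ennreal \<bar>f n x\<bar> \<partial>M)
          \<le> (\<integral>\<^sup>+x. ennreal \<epsilon> * indicator S x + ennreal (\<epsilon> powr (1 - q)) * ennreal (\<bar>f n x\<bar> powr q) \<partial>M)"
      proof (rule nn_integral_mono)
        fix x
        have "ennreal \<bar>f n x\<bar> \<le> ennreal (\<epsilon> + \<epsilon> powr (1 - q) * \<bar>f n x\<bar> powr q)"
          by (rule ennreal_leI[OF pt]) simp
        also have "\<dots> = ennreal \<epsilon> + ennreal (\<epsilon> powr (1 - q)) * ennreal (\<bar>f n x\<bar> powr q)"
          using \<epsilon> by (simp add: ennreal_mult)
        finally show "indicator S x * ennreal \<bar>f n x\<bar>
            \<le> ennreal \<epsilon> * indicator S x + ennreal (\<epsilon> powr (1 - q)) * ennreal (\<bar>f n x\<bar> powr q)"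
          by (auto simp: indicator_def)
      qed
      also have "\<dots> = (\<integral>\<^sup>+x. ennreal \<epsilon> * indicator S x \<partial>M) + (\<integral>\<^sup>+x. ennreal (\<epsilon> powr (1 - q)) * ennreal (\<bar>f n x\<bar> powr q) \<partial>M)"
        by (rule nn_integral_add) auto
      also have "(\<integral>\<^sup>+x. ennreal \<epsilon> * indicator S x \<partial>M) = ennreal \<epsilon> * emeasure M S"
        by (rule nn_integral_cmult_indicator) (rule S)
      also have "(\<integral>\<^sup>+x. ennreal (\<epsilon> powr (1 - q)) * ennreal (\<bar>f n x\<bar> powr q) \<partial>M)
          = ennreal (\<epsilon> powr (1 - q)) * (\<integral>\<^sup>+x. ennreal (\<bar>f n x\<bar> powr q) \<partial>M)"
        by (rule nn_integral_cmult) auto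
      also have "(\<integral>\<^sup>+x. ennreal (\<bar>f n x\<bar> powr q) \<partial>M) = ennreal (J n)"
        unfolding J_def by (rule nn_integral_eq_integral[OF Ji]) auto
      also have "ennreal \<epsilon> * emeasure M S + ennreal (\<epsilon> powr (1 - q)) * ennreal (J n) = ennreal (\<epsilon> * s + \<epsilon> powr (1 - q) * J n)"
        using \<epsilon> s J0[of n] by (simp add: ennreal_mult)
      finally show ?thesis .
    qed
    show ?thesis
    proof (rule tendsto_0_ennrealI)
      fix \<eta> :: real assume \<eta>: "0 < \<eta>"
      \<comment> \<open>\<open>S\<close> may be a null set, so its measure is increased by 1 before
        dividing.\<close>
      define t where "t = s + 1"
      have t: "0 < t" "s \<le> t" using s by (auto simp: t_def)
      define \<epsilon> where "\<epsilon> = \<eta> / (2 * t)"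
      have \<epsilon>: "0 < \<epsilon>" using \<eta> t by (simp add: \<epsilon>_def)
      have "\<epsilon> * s \<le> \<epsilon> * t" using \<epsilon> t by simp
      also have "\<dots> = \<eta> / 2" using t by (simp add: \<epsilon>_def)
      finally have es: "\<epsilon> * s \<le> \<eta> / 2" .
      have "(\<lambda>n. \<epsilon> powr (1 - q) * J n) \<longlonglongrightarrow> \<epsilon> powr (1 - q) * 0" by (intro tendsto_intros Jlim)
      then have "\<forall>\<^sub>F n in sequentially. \<epsilon> powr (1 - q) * J n < \<eta> / 2"
        using \<eta> by (intro order_tendstoD(2)[where y="\<epsilon> powr (1 - q) * 0"]) auto
      then show "\<forall>\<^sub>F n in sequentially. (\<integral>\<^sup>+x. indicator S x * ennreal \<bar>f n x\<bar> \<partial>M) \<le> ennreal \<eta>"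
      proof eventually_elim
        case (elim n)
        then have "\<epsilon> * s + \<epsilon> powr (1 - q) * J n \<le> \<eta>" using es by linarith
        from ennreal_leI[OF this] show ?case by (rule order_trans[OF bd[OF \<epsilon>]])
      qed
    qed
  qed
qed

text \<open>\<open>locally_integrable\<close> speaks about compact subsets only; an exhaustion of
  \<open>\<Omega>\<close> by compact sets yields measurability on all of it as a pointwise
  limit.\<close>

lemma locally_integrable_imp_measurable:
  fixes \<Omega> :: "'a::euclidean_space set"
  assumes \<Omega>: "open \<Omega>" and v: "locally_integrable lebesgue \<Omega> v"
  shows "(\<lambda>x. indicator \<Omega> x * v x) \<in> borel_measurable lebesgue"
proof -
  obtain C where C: "\<And>n. compact (C n)" "\<And>n. C n \<subseteq> \<Omega>" "\<And>n. C n \<subseteq> interior (C (Suc n))" "\<Union>(range C) = \<Omega>"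
    using open_Union_compact_subsets[OF \<Omega>] by metis
  have mono: "C m \<subseteq> C n" if "m \<le> n" for m n
  proof (rule lift_Suc_mono_le[of C, OF _ that])
    show "C n \<subseteq> C (Suc n)" for n using C(3)[of n] interior_subset by blast
  qed
  show ?thesis
  proof (rule borel_measurable_LIMSEQ_real)
    show "(\<lambda>x. indicator (C n) x * v x) \<in> borel_measurable lebesgue" for n
      using v C(1,2)[of n] unfolding locally_integrable_def set_integrable_def
      by (auto dest: borel_measurable_integrable)
    fix x :: 'a
    show "(\<lambda>n. indicator (C n) x * v x) \<longlonglongrightarrow> indicator \<Omega> x * v x"
    proof (cases "x \<in> \<Omega>")
      case True
      then obtain m where xm: "x \<in> C m" using C(4) by blast
      have "\<forall>\<^sub>F n in sequentially. indicator (C n) x * v x = indicator \<Omega> x * v x"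
        using eventually_ge_at_top[of m]
      proof eventually_elim
        case (elim n)
        then have "x \<in> C n" using mono xm by blast
        then show ?case using True by simp
      qed
      then show ?thesis by (rule tendsto_eventually)
    next
      case False
      then have "x \<notin> C n" for n using C(2) by blast
      then show ?thesis using False by simp
    qed
  qed
qed

section \<open>Borel representatives of weak derivatives and changes of coordinates\<close>

lemma test_function_facts:
  assumes "test_function \<Omega> \<psi>"
  shows "\<psi> \<in> borel_measurable borel" "b \<in> Basis \<Longrightarrow> continuous_on UNIV (\<lambda>x. frechet_derivative \<psi> (at x) b)"
    "(\<psi> has_derivative frechet_derivative \<psi> (at x)) (at x)"
    "x \<notin> closure {x. \<psi> x \<noteq> 0} \<Longrightarrow> \<psi> x = 0"
    "x \<notin> closure {x. \<psi> x \<noteq> 0} \<Longrightarrow> frechet_derivative \<psi> (at x) w = 0"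
    "continuous_on UNIV \<psi>"
proof -
  have C: "Ck k \<psi>" for k using assms by (simp add: test_function_def)
  show c: "continuous_on UNIV \<psi>" using C[of 0] by simp
  then show "\<psi> \<in> borel_measurable borel" by (rule borel_measurable_continuous_onI)
  show "b \<in> Basis \<Longrightarrow> continuous_on UNIV (\<lambda>x. frechet_derivative \<psi> (at x) b)"
    using Ck_SucD(2)[OF C, of b 0] by simp
  show "(\<psi> has_derivative frechet_derivative \<psi> (at x)) (at x)"
    using Ck_SucD(1)[OF C[of "Suc 0"]] .
  show z: "\<psi> x = 0" if "x \<notin> closure {x. \<psi> x \<noteq> 0}" for x
    using that closure_subset[of "{x. \<psi> x \<noteq> 0}"] by blast
  show "frechet_derivative \<psi> (at x) w = 0" if x: "x \<notin> closure {x. \<psi> x \<noteq> 0}"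
  proof -
    have "((\<lambda>x. 0) has_derivative (\<lambda>h. 0)) (at x)" by simp
    then have "(\<psi> has_derivative (\<lambda>h. 0)) (at x)"
    proof (rule has_derivative_transform_within_open[where s="- closure {x. \<psi> x \<noteq> 0}"])
      show "open (- closure {x. \<psi> x \<noteq> 0})" by (simp add: open_Compl)
      show "x \<in> - closure {x. \<psi> x \<noteq> 0}" using x by simp
      show "0 = \<psi> y" if "y \<in> - closure {x. \<psi> x \<noteq> 0}" for y using z[of y] that by simp
    qed
    from frechet_derivative_at[OF this, symmetric] show ?thesis by simp
  qed
qed

text \<open>Only the derivative is changed on a null set. The function \<open>u\<close> is left as
  it is, its continuity making it Borel on \<open>\<Omega>\<close>, since the values at individual
  boundary points will matter.\<close>

lemma weak_dir_of_has_weak_partial: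
  fixes \<Omega> :: "'a::euclidean_space set"
  assumes \<Omega>: "open \<Omega>" and u: "continuous_on \<Omega> u" and b: "b \<in> Basis" and v: "has_weak_partial \<Omega> u b v"
  obtains V where "weak_dir \<Omega> u b V" "AE x in lebesgue. x \<in> \<Omega> \<longrightarrow> V x = v x"
proof -
  have li: "locally_integrable lebesgue \<Omega> v" using v by (simp add: has_weak_partial_def)
  obtain V where V [measurable]: "V \<in> borel_measurable lborel" and "AE x in lborel. indicator \<Omega> x * v x = V x"
    using completion_ex_borel_measurable_real[OF locally_integrable_imp_measurable[OF \<Omega> li]] by blast
  then have "AE x in lebesgue. indicator \<Omega> x * v x = V x" by (intro AE_completion)
  then have AE: "AE x in lebesgue. x \<in> \<Omega> \<longrightarrow> V x = v x" by eventually_elim auto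
  have \<Omega>m [measurable]: "\<Omega> \<in> sets borel" using \<Omega> by auto
  have leb: "f \<in> borel_measurable lebesgue" if "f \<in> borel_measurable borel" for f :: "'a \<Rightarrow> real"
    using measurable_completion[of f lborel borel] that by simp
  have "weak_dir \<Omega> u b V"
    unfolding weak_dir_def
  proof (intro conjI allI impI)
    show "V \<in> borel_measurable borel" using V by simp
    fix K assume K: "compact K \<and> K \<subseteq> \<Omega>"
    then have [measurable]: "K \<in> sets borel" by (simp add: borel_closed compact_imp_closed)
    have "integrable lebesgue (\<lambda>x. indicator K x *\<^sub>R v x)"
      using li K by (simp add: locally_integrable_def set_integrable_def)
    then have "integrable lebesgue (\<lambda>x. indicator K x *\<^sub>R V x)"
    proof (rule integrable_cong_AE_imp)
      show "(\<lambda>x. indicator K x *\<^sub>R V x) \<in> borel_measurable lebesgue"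
        by (rule leb) measurable
      show "AE x in lebesgue. indicator K x *\<^sub>R v x = indicator K x *\<^sub>R V x"
        using AE by eventually_elim (use K in \<open>auto simp: indicator_def\<close>)
    qed
    then show "set_integrable lborel K V"
      unfolding set_integrable_def by (subst integrable_completion[symmetric]) auto
  next
    fix \<psi> assume t: "test_function \<Omega> \<psi>"
    note tf = test_function_facts[OF t]
    have [measurable]: "\<psi> \<in> borel_measurable borel" by (rule tf)
    have [measurable]: "(\<lambda>x. frechet_derivative \<psi> (at x) b) \<in> borel_measurable borel"
      by (rule borel_measurable_continuous_onI[OF tf(2)[OF b]])
    have [measurable]: "(\<lambda>x. indicator \<Omega> x *\<^sub>R u x) \<in> borel_measurable borel"
      by (rule borel_measurable_continuous_on_indicator[OF \<Omega>m u])
    have "(LINT x:\<Omega>|lborel. u x * frechet_derivative \<psi> (at x) b)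
        = (LINT x:\<Omega>|lebesgue. u x * frechet_derivative \<psi> (at x) b)"
    proof -
      have eq: "(\<lambda>x. indicator \<Omega> x *\<^sub>R (u x * frechet_derivative \<psi> (at x) b))
          = (\<lambda>x. (indicator \<Omega> x *\<^sub>R u x) * frechet_derivative \<psi> (at x) b)" by (auto simp: fun_eq_iff)
      have "(\<lambda>x. indicator \<Omega> x *\<^sub>R (u x * frechet_derivative \<psi> (at x) b)) \<in> borel_measurable lborel"
        unfolding eq by measurable
      then show ?thesis unfolding set_lebesgue_integral_def by (rule integral_completion[symmetric])
    qed
    also have "\<dots> = (LINT x|lebesgue_on \<Omega>. u x * frechet_derivative \<psi> (at x) b)"
      unfolding set_lebesgue_integral_def by (subst integral_restrict_space) auto
    also have "\<dots> = - (LINT x|lebesgue_on \<Omega>. v x * \<psi> x)"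
      using v t by (simp add: has_weak_partial_def)
    also have "(LINT x|lebesgue_on \<Omega>. v x * \<psi> x) = (LINT x:\<Omega>|lebesgue. v x * \<psi> x)"
      unfolding set_lebesgue_integral_def by (subst integral_restrict_space) auto
    also have "\<dots> = (LINT x|lebesgue. (indicator \<Omega> x * v x) * \<psi> x)"
      unfolding set_lebesgue_integral_def by (simp add: mult.assoc)
    also have "\<dots> = (LINT x|lebesgue. (indicator \<Omega> x * V x) * \<psi> x)"
    proof (rule integral_cong_AE)
      have "\<psi> \<in> borel_measurable lebesgue" by (rule leb) measurable
      then show "(\<lambda>x. indicator \<Omega> x * v x * \<psi> x) \<in> borel_measurable lebesgue"
        by (intro borel_measurable_times locally_integrable_imp_measurable[OF \<Omega> li])
      show "AE x in lebesgue. indicator \<Omega> x * v x * \<psi> x = indicator \<Omega> x * V x * \<psi> x"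
        using AE by eventually_elim (auto simp: indicator_def)
      show "(\<lambda>x. indicator \<Omega> x * V x * \<psi> x) \<in> borel_measurable lebesgue" by (rule leb) measurable
    qed
    also have "\<dots> = (LINT x|lborel. (indicator \<Omega> x * V x) * \<psi> x)"
      by (rule integral_completion) measurable
    also have "\<dots> = (LINT x:\<Omega>|lborel. V x * \<psi> x)"
      unfolding set_lebesgue_integral_def by (simp add: mult.assoc)
    finally show "(LINT x:\<Omega>|lborel. u x * frechet_derivative \<psi> (at x) b) = - (LINT x:\<Omega>|lborel. V x * \<psi> x)" .
  qed
  with AE show ?thesis using that by blast
qed

text \<open>Directions other than basis vectors are needed because a rotated chart differentiates
  along the vectors \<open>Q b\<close>. The identity reflects that the derivative of a test function
  is linear in the direction.\<close>

lemma weak_dir_linear: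
  fixes \<Omega> :: "'a::euclidean_space set"
  assumes \<Omega>: "open \<Omega>" and u: "continuous_on \<Omega> u" and V: "\<And>b. b \<in> Basis \<Longrightarrow> weak_dir \<Omega> u b (V b)"
  shows "weak_dir \<Omega> u w (\<lambda>x. \<Sum>b\<in>Basis. (w \<bullet> b) * V b x)"
  unfolding weak_dir_def
proof (intro conjI allI impI)
  have Vm [measurable]: "b \<in> Basis \<Longrightarrow> V b \<in> borel_measurable borel" for b using V by (simp add: weak_dir_def)
  show "(\<lambda>x. \<Sum>b\<in>Basis. (w \<bullet> b) * V b x) \<in> borel_measurable borel"
    using Vm by (intro borel_measurable_sum borel_measurable_times) auto
  have Vi: "integrable lborel (\<lambda>x. indicator K x * V b x)" if "b \<in> Basis" "compact K" "K \<subseteq> \<Omega>" for K b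
    using V[OF that(1)] that by (simp add: weak_dir_def set_integrable_def)
  show "set_integrable lborel K (\<lambda>x. \<Sum>b\<in>Basis. (w \<bullet> b) * V b x)" if K: "compact K \<and> K \<subseteq> \<Omega>" for K
  proof -
    have "integrable lborel (\<lambda>x. \<Sum>b\<in>Basis. (w \<bullet> b) * (indicator K x * V b x))"
      using Vi K by (intro Bochner_Integration.integrable_sum integrable_mult_right) auto
    then show ?thesis by (simp add: set_integrable_def sum_distrib_left mult_ac)
  qed
  fix \<psi> assume t: "test_function \<Omega> \<psi>"
  note tf = test_function_facts[OF t]
  have [measurable]: "\<psi> \<in> borel_measurable borel" by (rule tf)
  let ?K = "closure {x. \<psi> x \<noteq> 0}" and ?D = "\<lambda>x. frechet_derivative \<psi> (at x)"
  have K: "compact ?K" "?K \<subseteq> \<Omega>" using t by (auto simp: test_function_def)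
  have D: "?D x w = (\<Sum>b\<in>Basis. (w \<bullet> b) * ?D x b)" for x
    by (intro linear_eq_sum_Basis has_derivative_linear[OF tf(3)])
  have i1: "integrable lborel (\<lambda>x. indicator \<Omega> x * (u x * ?D x b))" if b: "b \<in> Basis" for b
  proof -
    have "integrable lborel (\<lambda>x. indicator ?K x *\<^sub>R (u x * ?D x b))"
      using K b by (intro borel_integrable_compact continuous_intros continuous_on_subset[OF u] continuous_on_subset[OF tf(2)]) auto
    moreover have "indicator ?K x *\<^sub>R (u x * ?D x b) = indicator \<Omega> x * (u x * ?D x b)" for x
      using K(2) tf(5)[of x b] by (cases "x \<in> ?K") (auto simp: subset_eq)
    ultimately show ?thesis by (simp only:)
  qed
  have "\<exists>C. \<forall>x. \<bar>\<psi> x\<bar> \<le> C"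
  proof -
    have "bounded (\<psi> ` ?K)"
      by (intro compact_imp_bounded compact_continuous_image continuous_on_subset[OF tf(6)] K) auto
    then obtain C where "\<forall>y\<in>\<psi> ` ?K. norm y \<le> C" unfolding bounded_iff by blast
    then have "\<bar>\<psi> x\<bar> \<le> max C 0" for x using tf(4)[of x] by (cases "x \<in> ?K") (auto simp: le_max_iff_disj)
    then show ?thesis by blast
  qed
  then obtain C where C: "\<And>x. \<bar>\<psi> x\<bar> \<le> C" by blast
  have i2: "integrable lborel (\<lambda>x. indicator \<Omega> x * (V b x * \<psi> x))" if b: "b \<in> Basis" for b
  proof -
    have "integrable lborel (\<lambda>x. C * (indicator ?K x * V b x))" using Vi[OF b K] by simp
    then have "integrable lborel (\<lambda>x. (indicator ?K x * V b x) * \<psi> x)"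
    proof (rule Bochner_Integration.integrable_bound)
      show "AE x in lborel. norm (indicator ?K x * V b x * \<psi> x) \<le> norm (C * (indicator ?K x * V b x))"
      proof (rule AE_I2)
        fix x
        have "\<bar>indicator ?K x * V b x\<bar> * \<bar>\<psi> x\<bar> \<le> \<bar>indicator ?K x * V b x\<bar> * \<bar>C\<bar>"
          using C[of x] by (intro mult_left_mono) auto
        then show "norm (indicator ?K x * V b x * \<psi> x) \<le> norm (C * (indicator ?K x * V b x))"
          by (simp add: abs_mult mult_ac)
      qed
      have [measurable]: "?K \<in> sets borel" by simp
      show "(\<lambda>x. indicator ?K x * V b x * \<psi> x) \<in> borel_measurable lborel" using Vm[OF b] by measurable
    qed
    moreover have "(indicator ?K x * V b x) * \<psi> x = indicator \<Omega> x * (V b x * \<psi> x)" for x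
      using K(2) tf(4)[of x] by (cases "x \<in> ?K") (auto simp: subset_eq)
    ultimately show ?thesis by (simp only:)
  qed
  have "(LINT x:\<Omega>|lborel. u x * ?D x w) = (LINT x|lborel. (\<Sum>b\<in>Basis. (w \<bullet> b) * (indicator \<Omega> x * (u x * ?D x b))))"
    unfolding set_lebesgue_integral_def D by (simp add: sum_distrib_left mult_ac)
  also have "\<dots> = (\<Sum>b\<in>Basis. (w \<bullet> b) * (LINT x|lborel. indicator \<Omega> x * (u x * ?D x b)))"
    using i1 by (subst Bochner_Integration.integral_sum) auto
  also have "\<dots> = (\<Sum>b\<in>Basis. (w \<bullet> b) * - (LINT x|lborel. indicator \<Omega> x * (V b x * \<psi> x)))"
  proof (intro sum.cong refl arg_cong2[where f="(*)"])
    fix b :: 'a assume b: "b \<in> Basis"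
    show "(LINT x|lborel. indicator \<Omega> x * (u x * ?D x b)) = - (LINT x|lborel. indicator \<Omega> x * (V b x * \<psi> x))"
      using V[OF b] t by (simp add: weak_dir_def set_lebesgue_integral_def)
  qed
  also have "\<dots> = - (LINT x|lborel. (\<Sum>b\<in>Basis. (w \<bullet> b) * (indicator \<Omega> x * (V b x * \<psi> x))))"
    using i2 by (subst Bochner_Integration.integral_sum) (auto simp: sum_negf)
  also have "(LINT x|lborel. (\<Sum>b\<in>Basis. (w \<bullet> b) * (indicator \<Omega> x * (V b x * \<psi> x))))
      = (LINT x:\<Omega>|lborel. (\<Sum>b\<in>Basis. (w \<bullet> b) * V b x) * \<psi> x)"
    unfolding set_lebesgue_integral_def by (simp add: sum_distrib_left sum_distrib_right mult_ac)
  finally show "(LINT x:\<Omega>|lborel. u x * ?D x w) = - (LINT x:\<Omega>|lborel. (\<Sum>b\<in>Basis. (w \<bullet> b) * V b x) * \<psi> x)" .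
qed

text \<open>Test functions are transported by the inverse of the rigid motion \<open>T\<close>; by
  the chain rule the derivative of \<open>\<psi> (T y)\<close> along \<open>b\<close> is that of
  \<open>\<psi>\<close> along \<open>Q b\<close>, and \<open>T\<close> preserves Lebesgue
  measure.\<close>

lemma weak_dir_pullback:
  fixes \<Omega> :: "'a::euclidean_space set" and a :: 'a and Q :: "'a \<Rightarrow> 'a"
  assumes Q: "orthogonal_transformation Q" and \<Omega>: "open \<Omega>" and u: "continuous_on \<Omega> u"
    and b: "b \<in> Basis" and V: "weak_dir \<Omega> u (Q b) V"
  defines "T \<equiv> \<lambda>y. a + Q y"
  shows "weak_dir (T -` \<Omega>) (\<lambda>y. u (T y)) b (\<lambda>y. V (T y))"
proof -
  have Vm [measurable]: "V \<in> borel_measurable borel" using V by (simp add: weak_dir_def)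
  have lQ: "linear Q" using Q by (simp add: orthogonal_transformation_def)
  have cQ: "continuous_on X Q" for X using lQ by (simp add: linear_continuous_on linear_conv_bounded_linear)
  then have [measurable]: "Q \<in> borel_measurable borel" by (intro borel_measurable_continuous_onI)
  have cT: "continuous_on X T" for X unfolding T_def by (intro continuous_intros cQ)
  then have [measurable]: "T \<in> borel_measurable borel" by (intro borel_measurable_continuous_onI)
  have bijQ: "bij Q" by (rule orthogonal_transformation_bij[OF Q])
  then have injQ: "inj Q" by (rule bij_is_inj)
  have injT: "inj T" using injQ by (auto simp: T_def inj_def)
  have TT: "distr lborel borel T = (lborel :: 'a measure)"
    unfolding T_def by (rule lborel_distr_rigid[OF Q])
  have subst: "(LINT y|lborel. f (T y)) = (LINT x|lborel. f x)" if [measurable]: "f \<in> borel_measurable borel" for f :: "'a \<Rightarrow> real"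
    by (subst (2) TT[symmetric]) (simp add: integral_distr)
  have substi: "integrable lborel (\<lambda>y. f (T y))" if "integrable lborel f" for f :: "'a \<Rightarrow> real"
  proof -
    have [measurable]: "f \<in> borel_measurable borel" using that by auto
    have "integrable (distr lborel borel T) f" using that by (simp add: TT)
    then show ?thesis by (subst (asm) integrable_distr_eq) auto
  qed
  have \<Omega>m [measurable]: "\<Omega> \<in> sets borel" using \<Omega> by auto
  show ?thesis
    unfolding weak_dir_def
  proof (intro conjI allI impI)
    show "(\<lambda>y. V (T y)) \<in> borel_measurable borel" by measurable
    fix K assume K: "compact K \<and> K \<subseteq> T -` \<Omega>"
    then have "compact (T ` K)" "T ` K \<subseteq> \<Omega>" using compact_continuous_image[OF cT] by auto
    then have "integrable lborel (\<lambda>x. indicator (T ` K) x *\<^sub>R V x)"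
      using V by (simp add: weak_dir_def set_integrable_def)
    from substi[OF this] show "set_integrable lborel K (\<lambda>y. V (T y))"
      unfolding set_integrable_def using injT by (simp add: indicator_def inj_image_mem_iff)
  next
    fix \<psi>' assume t: "test_function (T -` \<Omega>) \<psi>'"
    obtain R where R: "linear R" "\<And>x. R (Q x) = x" "\<And>x. Q (R x) = x"
    proof
      show "linear (inv Q)" using Q by (metis orthogonal_transformation_inv orthogonal_transformation_linear)
      show "inv Q (Q x) = x" for x using injQ by simp
      show "Q (inv Q x) = x" for x using bijQ by (simp add: bij_def surj_f_inv_f)
    qed
    define \<psi> where "\<psi> x = \<psi>' (R x + - R a)" for x
    have \<psi>T: "\<psi> (T y) = \<psi>' y" for y
      using R by (simp add: \<psi>_def T_def linear_add)
    have T_surj: "\<exists>y. x = T y" for x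
      by (intro exI[of _ "R (x - a)"]) (simp add: T_def R)
    have C: "Ck k \<psi>'" for k using t by (simp add: test_function_def)
    have supp: "closure {x. \<psi> x \<noteq> 0} \<subseteq> T ` closure {y. \<psi>' y \<noteq> 0}"
    proof (rule closure_minimal)
      show "{x. \<psi> x \<noteq> 0} \<subseteq> T ` closure {y. \<psi>' y \<noteq> 0}"
      proof
        fix x assume "x \<in> {x. \<psi> x \<noteq> 0}"
        moreover obtain y where "x = T y" using T_surj by blast
        ultimately show "x \<in> T ` closure {y. \<psi>' y \<noteq> 0}"
          using \<psi>T closure_subset[of "{y. \<psi>' y \<noteq> 0}"] by auto
      qed
      show "closed (T ` closure {y. \<psi>' y \<noteq> 0})"
        using t by (intro compact_imp_closed compact_continuous_image cT) (simp add: test_function_def)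
    qed
    have cs: "compact (T ` closure {y. \<psi>' y \<noteq> 0})" "T ` closure {y. \<psi>' y \<noteq> 0} \<subseteq> \<Omega>"
      using t by (auto simp: test_function_def intro!: compact_continuous_image cT)
    have test: "test_function \<Omega> \<psi>"
      unfolding test_function_def
    proof (intro conjI allI)
      show "Ck k \<psi>" for k unfolding \<psi>_def[abs_def] by (rule Ck_affine[OF R(1) C])
      show "compact (closure {x. \<psi> x \<noteq> 0})"
        using bounded_subset[OF compact_imp_bounded[OF cs(1)] supp] by (simp add: compact_eq_bounded_closed)
      show "closure {x. \<psi> x \<noteq> 0} \<subseteq> \<Omega>" using supp cs(2) by (rule order_trans)
    qed
    note tf = test_function_facts[OF test] and tf' = test_function_facts[OF t]
    have D: "frechet_derivative \<psi> (at (T y)) (Q b) = frechet_derivative \<psi>' (at y) b" for y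
    proof -
      have "(T has_derivative Q) (at y)"
        unfolding T_def using has_derivative_add_const[OF linear_imp_has_derivative[OF lQ], of a] by (simp add: add.commute)
      from has_derivative_compose[OF this tf(3)]
      have "(\<psi>' has_derivative (\<lambda>h. frechet_derivative \<psi> (at (T y)) (Q h))) (at y)"
        by (simp add: \<psi>T)
      from frechet_derivative_at[OF this] show ?thesis by metis
    qed
    have [measurable]: "(\<lambda>x. indicator \<Omega> x *\<^sub>R u x) \<in> borel_measurable borel"
      by (rule borel_measurable_continuous_on_indicator[OF \<Omega>m u])
    have [measurable]: "\<psi> \<in> borel_measurable borel" by (rule tf)
    have [measurable]: "(\<lambda>x. frechet_derivative \<psi> (at x) (Q b)) \<in> borel_measurable borel"
    proof -
      have "frechet_derivative \<psi> (at x) (Q b) = (\<Sum>c\<in>Basis. (Q b \<bullet> c) * frechet_derivative \<psi> (at x) c)" for x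
        by (intro linear_eq_sum_Basis has_derivative_linear[OF tf(3)])
      moreover have "(\<lambda>x. \<Sum>c\<in>Basis. (Q b \<bullet> c) * frechet_derivative \<psi> (at x) c) \<in> borel_measurable borel"
        by (intro borel_measurable_continuous_onI continuous_intros tf(2))
      ultimately show ?thesis by simp
    qed
    have "(LINT y:T -` \<Omega>|lborel. u (T y) * frechet_derivative \<psi>' (at y) b)
        = (LINT y|lborel. (indicator \<Omega> (T y) *\<^sub>R u (T y)) * frechet_derivative \<psi> (at (T y)) (Q b))"
      unfolding set_lebesgue_integral_def by (intro Bochner_Integration.integral_cong) (auto simp: D indicator_def)
    also have "\<dots> = (LINT x|lborel. (indicator \<Omega> x *\<^sub>R u x) * frechet_derivative \<psi> (at x) (Q b))"
      by (rule subst[where f="\<lambda>x. (indicator \<Omega> x *\<^sub>R u x) * frechet_derivative \<psi> (at x) (Q b)"]) measurable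
    also have "\<dots> = (LINT x:\<Omega>|lborel. u x * frechet_derivative \<psi> (at x) (Q b))"
      unfolding set_lebesgue_integral_def by (simp add: mult.assoc)
    also have "\<dots> = - (LINT x:\<Omega>|lborel. V x * \<psi> x)"
      using V test by (simp add: weak_dir_def)
    also have "(LINT x:\<Omega>|lborel. V x * \<psi> x) = (LINT y|lborel. indicator \<Omega> (T y) *\<^sub>R (V (T y) * \<psi> (T y)))"
      unfolding set_lebesgue_integral_def
      by (rule subst[where f="\<lambda>x. indicator \<Omega> x *\<^sub>R (V x * \<psi> x)", symmetric]) measurable
    also have "\<dots> = (LINT y:T -` \<Omega>|lborel. V (T y) * \<psi>' y)"
      unfolding set_lebesgue_integral_def by (intro Bochner_Integration.integral_cong) (auto simp: \<psi>T indicator_def)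
    finally show "(LINT y:T -` \<Omega>|lborel. u (T y) * frechet_derivative \<psi>' (at y) b)
        = - (LINT y:T -` \<Omega>|lborel. V (T y) * \<psi>' y)" .
  qed
qed

subsection \<open>Null sequences on the boundary\<close>

lemma ennreal_suminf_tendsto_0:
  fixes f :: "nat \<Rightarrow> ennreal"
  assumes "(\<Sum>n. f n) < \<infinity>"
  shows "f \<longlonglongrightarrow> 0"
proof -
  define q where "q n = enn2real (f n)" for n
  have fq: "f n = ennreal (q n)" for n
    using assms ennreal_suminf_lessD[of f \<infinity> n] by (simp add: q_def less_top)
  have q0: "0 \<le> q n" for n by (simp add: q_def)
  have "summable q" using assms q0 by (intro summable_suminf_not_top) (auto simp: fq)
  then have "q \<longlonglongrightarrow> 0" by (rule summable_LIMSEQ_zero)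
  then have "(\<lambda>n. ennreal (q n)) \<longlonglongrightarrow> ennreal 0" by (rule tendsto_ennrealI)
  moreover have "f = (\<lambda>n. ennreal (q n))" using fq by (rule ext)
  ultimately show ?thesis by (simp only: ennreal_0)
qed

lemma AE_lines_not_null:
  fixes w :: "'a::euclidean_space"
  assumes N: "N \<in> null_sets lborel"
  shows "AE x in lborel. AE \<tau> in lborel. x + \<tau> *\<^sub>R w \<notin> N"
proof -
  have [measurable]: "N \<in> sets borel" using N by (auto simp: null_sets_def)
  note nn_integral_lines_null[OF N, of w]
  moreover have "(\<lambda>x. \<integral>\<^sup>+t. indicator N (x + t *\<^sub>R w) \<partial>lborel) \<in> borel_measurable lborel" by measurable
  ultimately have "AE x in lborel. (\<integral>\<^sup>+t. indicator N (x + t *\<^sub>R w) \<partial>lborel) = 0"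
    by (simp add: nn_integral_0_iff_AE)
  then show ?thesis
  proof eventually_elim
    case (elim x)
    then have "AE t in lborel. indicator N (x + t *\<^sub>R w) = (0::ennreal)"
      by (subst (asm) nn_integral_0_iff_AE) auto
    then show ?case by eventually_elim (auto simp: indicator_def split: if_splits)
  qed
qed

lemma AE_real_in_interval:
  fixes \<alpha> \<beta> :: real
  assumes "AE \<tau> in lborel. P \<tau>" "\<alpha> < \<beta>"
  shows "\<exists>\<tau>. \<alpha> < \<tau> \<and> \<tau> < \<beta> \<and> P \<tau>"
proof (rule ccontr)
  assume n: "\<not> ?thesis"
  have "AE \<tau> in lborel. \<tau> \<notin> {\<alpha><..<\<beta>}"
    using assms(1) by eventually_elim (use n in auto)
  then have "emeasure lborel {\<alpha><..<\<beta>} = 0"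
    by (subst AE_iff_measurable[symmetric, where P="\<lambda>\<tau>. \<tau> \<notin> {\<alpha><..<\<beta>}"]) auto
  then show False using assms(2) by simp
qed

lemma AE_suminf_finite:
  fixes g :: "nat \<Rightarrow> 'a \<Rightarrow> ennreal"
  assumes [measurable]: "\<And>n. g n \<in> borel_measurable M" and "(\<Sum>n. \<integral>\<^sup>+x. g n x \<partial>M) < \<infinity>"
  shows "AE x in M. (\<Sum>n. g n x) < \<infinity>"
proof -
  have "(\<integral>\<^sup>+x. (\<Sum>n. g n x) \<partial>M) = (\<Sum>n. \<integral>\<^sup>+x. g n x \<partial>M)" by (rule nn_integral_suminf) auto
  then have "AE x in M. (\<Sum>n. g n x) \<noteq> \<infinity>"
    using assms(2) by (intro nn_integral_noteq_infinite) auto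
  then show ?thesis by eventually_elim (simp add: less_top)
qed

lemma nn_integral_lines:
  fixes w :: "'a::euclidean_space"
  assumes [measurable]: "h \<in> borel_measurable borel"
  shows "(\<integral>\<^sup>+x. \<integral>\<^sup>+t. indicator {- c..c} t * h (x + t *\<^sub>R w) \<partial>lborel \<partial>lborel) = emeasure lborel {- c..c} * (\<integral>\<^sup>+x. h x \<partial>lborel)"
proof -
  have tr: "(\<integral>\<^sup>+x. h (x + t *\<^sub>R w) \<partial>lborel) = (\<integral>\<^sup>+x. h x \<partial>lborel)" for t
    by (subst (2) lborel_distr_plus[of "t *\<^sub>R w", symmetric]) (simp add: nn_integral_distr add.commute)
  have "(\<integral>\<^sup>+x. \<integral>\<^sup>+t. indicator {- c..c} t * h (x + t *\<^sub>R w) \<partial>lborel \<partial>lborel)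
      = (\<integral>\<^sup>+t. \<integral>\<^sup>+x. indicator {- c..c} t * h (x + t *\<^sub>R w) \<partial>lborel \<partial>(lborel :: real measure))"
    by (rule lborel_pair.Fubini'[symmetric]) measurable
  also have "\<dots> = (\<integral>\<^sup>+t. indicator {- c..c} t * (\<integral>\<^sup>+x. h x \<partial>lborel) \<partial>(lborel :: real measure))"
    by (simp add: nn_integral_cmult tr)
  also have "\<dots> = emeasure lborel {- c..c} * (\<integral>\<^sup>+x. h x \<partial>lborel)"
    by (subst nn_integral_multc) auto
  finally show ?thesis .
qed

text \<open>Summability of the norms gives convergence on almost every line, uniformly on each interval of the
  line inside \<open>S\<close>, hence also at its end points, where the functions are still continuous.\<close>

lemma null_sequence_at_line_ends:
  fixes \<Omega> :: "'a::euclidean_space set" and u V :: "nat \<Rightarrow> 'a \<Rightarrow> real"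
  assumes w: "w \<in> Basis" and \<Omega>: "open \<Omega>" and S: "open S" "S \<subseteq> \<Omega>"
    and u: "\<And>n. continuous_on (closure \<Omega>) (u n)" and V: "\<And>n. weak_dir \<Omega> (u n) w (V n)"
    and su: "(\<Sum>n. \<integral>\<^sup>+x. indicator S x * ennreal \<bar>u n x\<bar> \<partial>lborel) < \<infinity>"
    and sV: "(\<Sum>n. \<integral>\<^sup>+x. indicator S x * ennreal \<bar>V n x\<bar> \<partial>lborel) < \<infinity>"
  shows "AE x in lborel. \<forall>\<alpha> \<beta>. \<alpha> < \<beta> \<longrightarrow> (\<forall>\<tau>\<in>{\<alpha><..<\<beta>}. x + \<tau> *\<^sub>R w \<in> S) \<longrightarrow>
      (\<forall>\<gamma>\<in>{\<alpha>, \<beta>}. (\<lambda>n. u n (x + \<gamma> *\<^sub>R w)) \<longlonglongrightarrow> 0)"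
proof -
  have Sm [measurable]: "S \<in> sets borel" using S by auto
  have Vm [measurable]: "V n \<in> borel_measurable borel" for n using V[of n] by (simp add: weak_dir_def)
  have uS: "continuous_on S (u n)" and u\<Omega>: "continuous_on \<Omega> (u n)" for n
    using S closure_subset by (auto intro: continuous_on_subset[OF u])
  have um: "(\<lambda>x. indicator S x * ennreal \<bar>u n x\<bar>) \<in> borel_measurable borel" for n
  proof -
    have [measurable]: "(\<lambda>x. indicator S x *\<^sub>R u n x) \<in> borel_measurable borel"
      by (rule borel_measurable_continuous_on_indicator[OF Sm uS])
    have "(\<lambda>x. indicator S x * ennreal \<bar>u n x\<bar>) = (\<lambda>x. ennreal \<bar>indicator S x *\<^sub>R u n x\<bar>)"
      by (auto simp: fun_eq_iff indicator_def)
    moreover have "(\<lambda>x. ennreal \<bar>indicator S x *\<^sub>R u n x\<bar>) \<in> borel_measurable borel" by measurable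
    ultimately show ?thesis by (simp only:)
  qed
  let ?good = "\<lambda>x. (\<Sum>n. indicator S x * ennreal \<bar>u n x\<bar>) < \<infinity> \<and>
     (\<forall>n. \<forall>s>0. (\<forall>\<tau>\<in>{0..s}. x + \<tau> *\<^sub>R w \<in> \<Omega>) \<longrightarrow>
       ennreal \<bar>u n (x + s *\<^sub>R w) - u n x\<bar> \<le> (\<integral>\<^sup>+\<tau>. indicator {0..s} \<tau> * ennreal \<bar>V n (x + \<tau> *\<^sub>R w)\<bar> \<partial>lborel))"
  have A1: "AE x in lborel. (\<Sum>n. indicator S x * ennreal \<bar>u n x\<bar>) < \<infinity>"
    by (rule AE_suminf_finite[OF _ su]) (simp add: um)
  have A2: "AE x in lborel. \<forall>n. \<forall>s>0. (\<forall>\<tau>\<in>{0..s}. x + \<tau> *\<^sub>R w \<in> \<Omega>) \<longrightarrow>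
       ennreal \<bar>u n (x + s *\<^sub>R w) - u n x\<bar> \<le> (\<integral>\<^sup>+\<tau>. indicator {0..s} \<tau> * ennreal \<bar>V n (x + \<tau> *\<^sub>R w)\<bar> \<partial>lborel)"
    by (subst AE_all_countable) (intro allI weak_dir_segment_AE[OF w V \<Omega> u\<Omega>])
  define good where "good x \<longleftrightarrow> ?good x" for x
  from A1 A2 have "AE x in lborel. good x"
    unfolding good_def by eventually_elim (rule conjI)
  \<comment> \<open>The estimates are available for segments starting off \<open>N\<close>. On
    almost every line the parameters of points in \<open>N\<close> form a null set, so admissible
    starting points are dense on it.\<close>
  then obtain N where "N \<in> null_sets lborel" "{x. \<not> good x} \<subseteq> N"
    unfolding eventually_ae_filter by auto
  then have N: "N \<in> null_sets lborel" "\<And>x. x \<notin> N \<Longrightarrow> ?good x"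
    unfolding good_def[symmetric] by blast+
  \<comment> \<open>The base points \<open>x\<close> range over the whole space and not over a
    hyperplane, so each line is counted infinitely often; restricting the parameter to
    \<open>{- real k..real k}\<close> keeps the double integral finite.\<close>
  have lines: "AE x in lborel. \<forall>k::nat. (\<Sum>n. \<integral>\<^sup>+t. indicator {- real k..real k} t * (indicator S (x + t *\<^sub>R w) * ennreal \<bar>V n (x + t *\<^sub>R w)\<bar>) \<partial>lborel) < \<infinity>"
  proof (subst AE_all_countable, rule allI, rule AE_suminf_finite)
    fix k :: nat
    have "(\<Sum>n. \<integral>\<^sup>+x. \<integral>\<^sup>+t. indicator {- real k..real k} t * (indicator S (x + t *\<^sub>R w) * ennreal \<bar>V n (x + t *\<^sub>R w)\<bar>) \<partial>lborel \<partial>lborel)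
        = (\<Sum>n. emeasure lborel {- real k..real k} * (\<integral>\<^sup>+x. indicator S x * ennreal \<bar>V n x\<bar> \<partial>lborel))"
      by (intro suminf_cong nn_integral_lines) measurable
    also have "\<dots> = emeasure lborel {- real k..real k} * (\<Sum>n. \<integral>\<^sup>+x. indicator S x * ennreal \<bar>V n x\<bar> \<partial>lborel)" by simp
    also have "\<dots> < \<infinity>" using sV by (simp add: ennreal_mult_less_top)
    finally show "(\<Sum>n. \<integral>\<^sup>+x. \<integral>\<^sup>+t. indicator {- real k..real k} t * (indicator S (x + t *\<^sub>R w) * ennreal \<bar>V n (x + t *\<^sub>R w)\<bar>) \<partial>lborel \<partial>lborel) < \<infinity>" .
  qed measurable
  from lines AE_lines_not_null[OF N(1), of w] show ?thesis
  proof eventually_elim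
    case (elim x)
    show ?case
    proof (intro allI impI ballI)
      fix \<alpha> \<beta> \<gamma> :: real
      assume ab: "\<alpha> < \<beta>" and J: "\<forall>\<tau>\<in>{\<alpha><..<\<beta>}. x + \<tau> *\<^sub>R w \<in> S" and \<gamma>: "\<gamma> \<in> {\<alpha>, \<beta>}"
      let ?g = "\<lambda>\<tau>. \<alpha> < \<tau> \<and> \<tau> < \<beta> \<and> x + \<tau> *\<^sub>R w \<notin> N"
      obtain k :: nat where k: "max \<bar>\<alpha>\<bar> \<bar>\<beta>\<bar> \<le> real k" using real_arch_simple by blast
      define I where "I n = (\<integral>\<^sup>+t. indicator {- real k..real k} t * (indicator S (x + t *\<^sub>R w) * ennreal \<bar>V n (x + t *\<^sub>R w)\<bar>) \<partial>lborel)" for n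
      have I0: "I \<longlonglongrightarrow> 0" unfolding I_def using elim(1) by (intro ennreal_suminf_tendsto_0) blast
      have step: "ennreal \<bar>u n (x + \<tau>' *\<^sub>R w) - u n (x + \<tau> *\<^sub>R w)\<bar> \<le> I n" if \<tau>: "?g \<tau>" and \<tau>': "\<tau> < \<tau>'" "\<tau>' < \<beta>" for \<tau> \<tau>' n
      proof -
        let ?y = "x + \<tau> *\<^sub>R w"
        have gy: "?good ?y" using \<tau> by (intro N(2)) simp
        have seg: "?y + \<sigma> *\<^sub>R w \<in> S" if "\<sigma> \<in> {0..\<tau>' - \<tau>}" for \<sigma>
        proof -
          have "x + (\<tau> + \<sigma>) *\<^sub>R w \<in> S" using J that \<tau> \<tau>' by auto
          then show ?thesis by (simp add: scaleR_add_left add.assoc)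
        qed
        have "ennreal \<bar>u n (?y + (\<tau>' - \<tau>) *\<^sub>R w) - u n ?y\<bar>
            \<le> (\<integral>\<^sup>+\<sigma>. indicator {0..\<tau>' - \<tau>} \<sigma> * ennreal \<bar>V n (?y + \<sigma> *\<^sub>R w)\<bar> \<partial>lborel)"
        proof -
          have "\<forall>\<sigma>\<in>{0..\<tau>' - \<tau>}. ?y + \<sigma> *\<^sub>R w \<in> \<Omega>" using seg S(2) by blast
          with gy[THEN conjunct2, rule_format, of "\<tau>' - \<tau>" n] \<tau>'(1) show ?thesis by simp
        qed
        also have "\<dots> = (\<integral>\<^sup>+\<sigma>. indicator {0..\<tau>' - \<tau>} (- \<tau> + \<sigma>) * ennreal \<bar>V n (?y + (- \<tau> + \<sigma>) *\<^sub>R w)\<bar> \<partial>lborel)"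
          by (subst lborel_distr_plus[of "- \<tau>", symmetric]) (simp add: nn_integral_distr)
        also have "\<dots> \<le> I n"
          unfolding I_def
        proof (rule nn_integral_mono)
          fix \<sigma> :: real
          show "indicator {0..\<tau>' - \<tau>} (- \<tau> + \<sigma>) * ennreal \<bar>V n (?y + (- \<tau> + \<sigma>) *\<^sub>R w)\<bar>
              \<le> indicator {- real k..real k} \<sigma> * (indicator S (x + \<sigma> *\<^sub>R w) * ennreal \<bar>V n (x + \<sigma> *\<^sub>R w)\<bar>)"
          proof (cases "- \<tau> + \<sigma> \<in> {0..\<tau>' - \<tau>}")
            case True
            have e: "?y + (- \<tau> + \<sigma>) *\<^sub>R w = x + \<sigma> *\<^sub>R w" by (simp add: algebra_simps)
            have "x + \<sigma> *\<^sub>R w \<in> S" using seg[OF True] unfolding e .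
            moreover have "\<sigma> \<in> {- real k..real k}" using True \<tau> \<tau>' k by auto
            ultimately show ?thesis using True unfolding e by simp
          qed simp
        qed
        finally show ?thesis by (simp add: algebra_simps)
      qed
      obtain \<tau>0 where \<tau>0: "?g \<tau>0" using AE_real_in_interval[OF elim(2) ab] by blast
      have x0: "x + \<tau>0 *\<^sub>R w \<in> S" using J \<tau>0 by auto
      have "?good (x + \<tau>0 *\<^sub>R w)" using \<tau>0 by (intro N(2)) simp
      then have "(\<Sum>n. indicator S (x + \<tau>0 *\<^sub>R w) * ennreal \<bar>u n (x + \<tau>0 *\<^sub>R w)\<bar>) < \<infinity>" by (rule conjunct1)
      then have u0: "(\<lambda>n. ennreal \<bar>u n (x + \<tau>0 *\<^sub>R w)\<bar>) \<longlonglongrightarrow> 0"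
        using x0 by (intro ennreal_suminf_tendsto_0) simp
      define A where "A n = ennreal \<bar>u n (x + \<tau>0 *\<^sub>R w)\<bar> + I n" for n
      have A0: "A \<longlonglongrightarrow> 0" unfolding A_def using tendsto_add[OF u0 I0] by simp
      \<comment> \<open>The bound \<open>A n\<close> is the same for all admissible
        \<open>\<tau>\<close>. As \<open>u n\<close> is continuous on the closure of
        \<open>\<Omega>\<close>, the bound therefore extends to the end points of the
        interval.\<close>
      have bd: "ennreal \<bar>u n (x + \<tau> *\<^sub>R w)\<bar> \<le> A n" if \<tau>: "?g \<tau>" for \<tau> n
      proof -
        have "ennreal \<bar>u n (x + \<tau> *\<^sub>R w) - u n (x + \<tau>0 *\<^sub>R w)\<bar> \<le> I n"
          using step[OF \<tau>, of \<tau>0 n] step[OF \<tau>0, of \<tau> n] \<tau> \<tau>0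
          by (cases \<tau> \<tau>0 rule: linorder_cases) (auto simp: abs_minus_commute)
        moreover have "ennreal \<bar>u n (x + \<tau> *\<^sub>R w)\<bar>
            \<le> ennreal (\<bar>u n (x + \<tau>0 *\<^sub>R w)\<bar> + \<bar>u n (x + \<tau> *\<^sub>R w) - u n (x + \<tau>0 *\<^sub>R w)\<bar>)"
          by (rule ennreal_leI) simp
        ultimately show ?thesis unfolding A_def by (simp add: order_trans[OF _ add_left_mono])
      qed
      let ?G = "{\<tau>. ?g \<tau>}"
      have cl: "\<gamma> \<in> closure ?G"
        unfolding closure_approachable
      proof (intro allI impI)
        fix e :: real assume e: "0 < e"
        have "max \<alpha> (\<gamma> - e) < min \<beta> (\<gamma> + e)" using \<gamma> ab e by auto
        from AE_real_in_interval[OF elim(2) this] obtain \<tau> where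
          "max \<alpha> (\<gamma> - e) < \<tau>" "\<tau> < min \<beta> (\<gamma> + e)" "x + \<tau> *\<^sub>R w \<notin> N" by blast
        then show "\<exists>y\<in>?G. dist y \<gamma> < e" by (intro bexI[of _ \<tau>]) (auto simp: dist_real_def)
      qed
      have sub: "(\<lambda>\<tau>. x + \<tau> *\<^sub>R w) ` closure ?G \<subseteq> closure \<Omega>"
      proof (rule image_closure_subset)
        show "continuous_on (closure ?G) (\<lambda>\<tau>. x + \<tau> *\<^sub>R w)" by (intro continuous_intros)
        show "(\<lambda>\<tau>. x + \<tau> *\<^sub>R w) ` ?G \<subseteq> closure \<Omega>"
          using J S(2) closure_subset[of \<Omega>] by (auto simp: subset_eq)
      qed simp
      have end_bd: "ennreal \<bar>u n (x + \<gamma> *\<^sub>R w)\<bar> \<le> A n" for n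
      proof (cases "A n")
        case (real c)
        have "\<bar>u n (x + \<gamma> *\<^sub>R w)\<bar> \<le> c"
        proof (rule continuous_le_on_closure[OF _ cl])
          show "continuous_on (closure ?G) (\<lambda>\<tau>. \<bar>u n (x + \<tau> *\<^sub>R w)\<bar>)"
            using sub by (intro continuous_intros continuous_on_compose2[OF u]) auto
          show "\<bar>u n (x + \<tau> *\<^sub>R w)\<bar> \<le> c" if "\<tau> \<in> ?G" for \<tau>
            using bd[of \<tau> n] that real by (auto simp: ennreal_le_iff)
        qed
        then show ?thesis using real by (simp add: ennreal_leI)
      qed simp
      show "(\<lambda>n. u n (x + \<gamma> *\<^sub>R w)) \<longlonglongrightarrow> 0"
      proof (rule tendstoI)
        fix e :: real assume e: "0 < e"
        then have "\<forall>\<^sub>F n in sequentially. A n < ennreal e"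
          by (intro order_tendstoD(2)[OF A0]) simp
        then show "\<forall>\<^sub>F n in sequentially. dist (u n (x + \<gamma> *\<^sub>R w)) 0 < e"
        proof eventually_elim
          case (elim n)
          then have "ennreal \<bar>u n (x + \<gamma> *\<^sub>R w)\<bar> < ennreal e" using end_bd[of n] by (rule le_less_trans[rotated])
          then show ?case using e by (simp add: ennreal_less_iff)
        qed
      qed
    qed
  qed
qed

section \<open>From Sobolev norms to integrals over bounded sets\<close>

lemma Lp_norm_nonneg: "0 \<le> Lp_norm p M f"
  by (simp add: Lp_norm_def)

lemma Lp_norm_cong_AE:
  assumes [measurable]: "f \<in> borel_measurable M" "g \<in> borel_measurable M" and eq: "AE x in M. f x = g x"
  shows "Lp_norm p M f = Lp_norm p M g"
proof -
  have "AE x in M. ennreal \<bar>f x\<bar> = ennreal \<bar>g x\<bar>"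
    using eq by eventually_elim simp
  then have "esssup M (\<lambda>x. ennreal \<bar>f x\<bar>) = esssup M (\<lambda>x. ennreal \<bar>g x\<bar>)"
    by (intro esssup_AE_cong) auto
  moreover have "(LINT x|M. \<bar>f x\<bar> powr enn2real p) = (LINT x|M. \<bar>g x\<bar> powr enn2real p)"
    using eq by (intro integral_cong_AE) auto
  ultimately show ?thesis by (simp add: Lp_norm_def)
qed

lemma sobolev_null_sequence:
  fixes \<Omega> :: "'a::euclidean_space set" and f :: "nat \<Rightarrow> 'a \<Rightarrow> real"
  assumes \<Omega>: "open \<Omega>" and p: "1 \<le> p" and W: "\<And>n. in_W1p p \<Omega> (f n)" and c: "\<And>n. continuous_on \<Omega> (f n)"
    and lim: "(\<lambda>n. W1p_norm p \<Omega> (f n)) \<longlonglongrightarrow> 0" and S: "S \<in> sets borel" "S \<subseteq> \<Omega>" "bounded S"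
  obtains V where "\<And>n b. b \<in> Basis \<Longrightarrow> weak_dir \<Omega> (f n) b (V n b)"
    "(\<lambda>n. \<integral>\<^sup>+x. indicator S x * ennreal \<bar>f n x\<bar> \<partial>lborel) \<longlonglongrightarrow> 0"
    "\<And>b. b \<in> Basis \<Longrightarrow> (\<lambda>n. \<integral>\<^sup>+x. indicator S x * ennreal \<bar>V n b x\<bar> \<partial>lborel) \<longlonglongrightarrow> 0"
proof -
  let ?M = "lebesgue_on \<Omega>"
  have \<Omega>s [simp]: "\<Omega> \<in> sets lebesgue" by (intro sets_completionI_sets) (simp add: \<Omega>)
  have Lf: "(\<lambda>n. Lp_norm p ?M (f n)) \<longlonglongrightarrow> 0"
    by (rule tendsto_sandwich[OF _ _ tendsto_const lim])
      (auto simp: W1p_norm_def Lp_norm_nonneg intro!: always_eventually sum_nonneg)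
  have Lw: "(\<lambda>n. Lp_norm p ?M (weak_partial \<Omega> (f n) b)) \<longlonglongrightarrow> 0" if b: "b \<in> Basis" for b
  proof (rule tendsto_sandwich[OF _ _ tendsto_const lim])
    show "\<forall>\<^sub>F n in sequentially. 0 \<le> Lp_norm p ?M (weak_partial \<Omega> (f n) b)"
      by (simp add: Lp_norm_nonneg)
    have "Lp_norm p ?M (weak_partial \<Omega> (f n) b) \<le> W1p_norm p \<Omega> (f n)" for n
    proof -
      have "Lp_norm p ?M (weak_partial \<Omega> (f n) b) \<le> (\<Sum>b\<in>Basis. Lp_norm p ?M (weak_partial \<Omega> (f n) b))"
        using b by (intro member_le_sum) (auto simp: Lp_norm_nonneg)
      then show ?thesis using Lp_norm_nonneg[of p ?M "f n"] by (simp add: W1p_norm_def)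
    qed
    then show "\<forall>\<^sub>F n in sequentially. Lp_norm p ?M (weak_partial \<Omega> (f n) b) \<le> W1p_norm p \<Omega> (f n)" by simp
  qed
  \<comment> \<open>Three versions of one derivative: \<open>weak_partial\<close>, in terms of which
    the norm is defined, \<open>v\<close>, known to lie in the Lebesgue space, and the Borel
    function \<open>V\<close>, which can be integrated along lines. All agree almost everywhere on
    \<open>\<Omega>\<close>.\<close>
  define R where "R n b v V \<longleftrightarrow> weak_dir \<Omega> (f n) b V \<and> (AE x in lebesgue. x \<in> \<Omega> \<longrightarrow> V x = v x) \<and> in_Lp p ?M v
      \<and> Lp_norm p ?M v = Lp_norm p ?M (weak_partial \<Omega> (f n) b)" for n b v V
  have "\<exists>v V. b \<in> Basis \<longrightarrow> R n b v V" for n b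
  proof (cases "b \<in> Basis")
    case b: True
    then obtain v where v: "has_weak_partial \<Omega> (f n) b v" "in_Lp p ?M v"
      using W[of n] by (auto simp: in_W1p_def)
    have v': "has_weak_partial \<Omega> (f n) b (weak_partial \<Omega> (f n) b)"
      unfolding weak_partial_def by (rule someI[of "has_weak_partial \<Omega> (f n) b"]) (rule v)
    obtain V where V: "weak_dir \<Omega> (f n) b V" "AE x in lebesgue. x \<in> \<Omega> \<longrightarrow> V x = v x"
      by (rule weak_dir_of_has_weak_partial[OF \<Omega> c b v(1)])
    obtain V' where V': "weak_dir \<Omega> (f n) b V'" "AE x in lebesgue. x \<in> \<Omega> \<longrightarrow> V' x = weak_partial \<Omega> (f n) b x"
      by (rule weak_dir_of_has_weak_partial[OF \<Omega> c b v'])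
    have "AE x in lebesgue. x \<in> \<Omega> \<longrightarrow> V x = V' x"
      by (rule AE_completion[OF weak_dir_unique[OF \<Omega> V(1) V'(1)]])
    with V(2) V'(2) have "AE x in lebesgue. x \<in> \<Omega> \<longrightarrow> v x = weak_partial \<Omega> (f n) b x"
      by eventually_elim auto
    then have eq: "AE x in ?M. v x = weak_partial \<Omega> (f n) b x"
      by (subst AE_restrict_space_iff) auto
    have m: "v \<in> borel_measurable ?M" using v(2) by (simp add: in_Lp_def)
    have "(\<lambda>x. indicator \<Omega> x * weak_partial \<Omega> (f n) b x) \<in> borel_measurable lebesgue"
      using v' by (intro locally_integrable_imp_measurable[OF \<Omega>]) (simp add: has_weak_partial_def)
    then have m': "weak_partial \<Omega> (f n) b \<in> borel_measurable ?M"
      by (subst borel_measurable_restrict_space_iff) (auto simp: mult.commute)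
    have "R n b v V" using V v(2) Lp_norm_cong_AE[OF m m' eq, of p] unfolding R_def by blast
    then show ?thesis by blast
  qed simp
  then have "\<forall>q. \<exists>h. snd q \<in> Basis \<longrightarrow> R (fst q) (snd q) (fst h) (snd h)"
    by (intro allI) simp
  from choice[OF this] obtain h where
    h: "\<forall>q. snd q \<in> Basis \<longrightarrow> R (fst q) (snd q) (fst (h q)) (snd (h q))" ..
  define v V where "v n b = fst (h (n, b))" and "V n b = snd (h (n, b))" for n b
  have R: "R n b (v n b) (V n b)" if "b \<in> Basis" for n b
    using h[rule_format, of "(n, b)"] that by (simp add: v_def V_def)
  have vV: "weak_dir \<Omega> (f n) b (V n b)" "AE x in lebesgue. x \<in> \<Omega> \<longrightarrow> V n b x = v n b x"
    "in_Lp p ?M (v n b)" "Lp_norm p ?M (v n b) = Lp_norm p ?M (weak_partial \<Omega> (f n) b)"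
    if "b \<in> Basis" for n b
    using R[OF that, of n] unfolding R_def by blast+
  have SM: "S \<in> sets ?M" using S \<Omega> by (auto simp: sets_restrict_space_iff)
  have "emeasure ?M S = emeasure lborel S"
    using S by (subst emeasure_restrict_space) auto
  then have Sfin: "emeasure ?M S < \<infinity>"
    using emeasure_bounded_finite[OF S(3)] by simp
  have conv: "(\<integral>\<^sup>+x. indicator S x * ennreal \<bar>h x\<bar> \<partial>?M) = (\<integral>\<^sup>+x. indicator S x * ennreal \<bar>h' x\<bar> \<partial>lborel)"
    if "AE x in lebesgue. x \<in> \<Omega> \<longrightarrow> h' x = h x" for h h' :: "'a \<Rightarrow> real"
  proof -
    have "(\<integral>\<^sup>+x. indicator S x * ennreal \<bar>h x\<bar> \<partial>?M) = (\<integral>\<^sup>+x. indicator S x * ennreal \<bar>h x\<bar> * indicator \<Omega> x \<partial>lebesgue)"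
      by (rule nn_integral_restrict_space) simp
    also have "\<dots> = (\<integral>\<^sup>+x. indicator S x * ennreal \<bar>h' x\<bar> \<partial>lebesgue)"
      using that by (intro nn_integral_cong_AE, eventually_elim) (use S(2) in \<open>auto simp: indicator_def\<close>)
    finally show ?thesis by (simp add: nn_integral_completion)
  qed
  show thesis
  proof (rule that)
    show "weak_dir \<Omega> (f n) b (V n b)" if "b \<in> Basis" for n b by (rule vV(1)[OF that])
    have "(\<lambda>n. \<integral>\<^sup>+x. indicator S x * ennreal \<bar>f n x\<bar> \<partial>?M) \<longlonglongrightarrow> 0"
      by (rule Lp_tendsto_L1_bounded[OF p _ Lf SM Sfin]) (use W in \<open>simp add: in_W1p_def\<close>)
    moreover have "(\<integral>\<^sup>+x. indicator S x * ennreal \<bar>f n x\<bar> \<partial>?M) = (\<integral>\<^sup>+x. indicator S x * ennreal \<bar>f n x\<bar> \<partial>lborel)" for n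
      by (rule conv) simp
    ultimately show "(\<lambda>n. \<integral>\<^sup>+x. indicator S x * ennreal \<bar>f n x\<bar> \<partial>lborel) \<longlonglongrightarrow> 0" by simp
    fix b :: 'a assume b: "b \<in> Basis"
    have "(\<lambda>n. Lp_norm p ?M (v n b)) \<longlonglongrightarrow> 0" using Lw[OF b] by (simp add: vV(4)[OF b])
    then have "(\<lambda>n. \<integral>\<^sup>+x. indicator S x * ennreal \<bar>v n b x\<bar> \<partial>?M) \<longlonglongrightarrow> 0"
      by (intro Lp_tendsto_L1_bounded[OF p _ _ SM Sfin] vV(3)[OF b])
    moreover have "(\<integral>\<^sup>+x. indicator S x * ennreal \<bar>v n b x\<bar> \<partial>?M) = (\<integral>\<^sup>+x. indicator S x * ennreal \<bar>V n b x\<bar> \<partial>lborel)" for n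
      by (rule conv[OF vV(2)[OF b]])
    ultimately show "(\<lambda>n. \<integral>\<^sup>+x. indicator S x * ennreal \<bar>V n b x\<bar> \<partial>lborel) \<longlonglongrightarrow> 0" by simp
  qed
qed

text \<open>Inner regularity of finite Borel measures on Euclidean space. The Hausdorff measure need
  not be finite and may have further measurable sets, so it is first restricted to the Borel sets
  and cut down to \<open>E\<close>.\<close>

lemma hausdorff_null_if_compact_null:
  fixes E :: "'a::euclidean_space set"
  assumes E: "E \<in> sets borel" and fin: "hausdorff_outer k E < \<infinity>"
    and null: "\<And>K. compact K \<Longrightarrow> K \<subseteq> E \<Longrightarrow> hausdorff_outer k K = 0"
  shows "hausdorff_outer k E = 0"
proof -
  define M where "M = restr_to_subalg (hausdorff k) (borel :: 'a measure)"
  have sub: "subalgebra (hausdorff k) (borel :: 'a measure)"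
    by (auto simp: subalgebra_def borel_sets_hausdorff)
  have sM: "sets M = sets borel" unfolding M_def by (rule sets_restr_to_subalg[OF sub])
  have eM: "emeasure M A = hausdorff_outer k A" if "A \<in> sets borel" for A
    unfolding M_def using that borel_sets_hausdorff[OF that]
    by (simp add: emeasure_restr_to_subalg[OF sub] emeasure_hausdorff)
  define D where "D = density M (indicator E)"
  have sD: "sets D = sets borel" by (simp add: D_def sM)
  have eD: "emeasure D A = hausdorff_outer k (E \<inter> A)" if "A \<in> sets borel" for A
  proof -
    have "emeasure D A = emeasure M (E \<inter> A)"
      unfolding D_def using E that borel_measurable_indicator[of E M]
      by (subst emeasure_density) (simp_all add: sM indicator_inter_arith[symmetric])
    then show ?thesis using E that by (simp add: eM)
  qed
  have "space D = UNIV" using sets_eq_imp_space_eq[OF sD] by simp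
  then have "emeasure D (space D) \<noteq> \<infinity>" using fin by (simp add: eD)
  from inner_regular[OF sD this E] have "emeasure D E = (SUP K\<in>{K. K \<subseteq> E \<and> compact K}. emeasure D K)" .
  also have "\<dots> \<le> 0"
  proof (rule SUP_least)
    fix K assume "K \<in> {K. K \<subseteq> E \<and> compact K}"
    then have "K \<subseteq> E" "compact K" by auto
    then show "emeasure D K \<le> 0"
      using null by (simp add: eD Int_absorb1 borel_compact)
  qed
  finally show ?thesis using E by (simp add: eD)
qed

text \<open>Quantifies over \<open>nat\<close> only, so that the set where a sequence of Borel
  functions tends to 0 is visibly Borel.\<close>

lemma LIMSEQ_0_iff_nat:
  fixes f :: "nat \<Rightarrow> real"
  shows "f \<longlonglongrightarrow> 0 \<longleftrightarrow> (\<forall>k::nat. \<exists>N. \<forall>n. N \<le> n \<longrightarrow> \<bar>f n\<bar> < 1 / real (Suc k))"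
proof
  assume "f \<longlonglongrightarrow> 0"
  then show "\<forall>k::nat. \<exists>N. \<forall>n. N \<le> n \<longrightarrow> \<bar>f n\<bar> < 1 / real (Suc k)"
    unfolding LIMSEQ_def dist_real_def by (metis diff_0_right of_nat_0_less_iff zero_less_Suc zero_less_divide_1_iff)
next
  assume *: "\<forall>k::nat. \<exists>N. \<forall>n. N \<le> n \<longrightarrow> \<bar>f n\<bar> < 1 / real (Suc k)"
  show "f \<longlonglongrightarrow> 0"
  proof (rule LIMSEQ_I)
    fix r :: real assume "0 < r"
    then obtain k where k: "1 / real (Suc k) < r" using nat_approx_posE by blast
    obtain N where "\<forall>n. N \<le> n \<longrightarrow> \<bar>f n\<bar> < 1 / real (Suc k)" using * by blast
    then show "\<exists>no. \<forall>n\<ge>no. norm (f n - 0) < r" using k by (intro exI[of _ N]) (auto intro: less_trans)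
  qed
qed

text \<open>\<open>B\<close> consists of the boundary points in \<open>G\<close> where the functions
  tend to 0. A coordinate segment in \<open>G\<close> that changes sides and starts off the
  exceptional null set contains an interval in \<open>\<Omega>\<close> ending at a boundary point,
  and that point belongs to \<open>B\<close>. So compact subsets of the remaining set
  \<open>E\<close> are null, and \<open>E\<close> is null by inner regularity.\<close>

lemma null_sequence_on_graph:
  fixes \<Omega> :: "'a::euclidean_space set" and u :: "nat \<Rightarrow> 'a \<Rightarrow> real"
  assumes e: "e \<in> Basis" and \<Omega>: "open \<Omega>" and G: "open G"
    and down: "\<And>x s. \<lbrakk>x \<in> \<Omega>; x \<in> G; 0 \<le> s; x - s *\<^sub>R e \<in> G\<rbrakk> \<Longrightarrow> x - s *\<^sub>R e \<in> \<Omega>"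
    and graph: "\<And>z s. \<lbrakk>z \<in> frontier \<Omega>; z \<in> G; 0 < s; z + s *\<^sub>R e \<in> G\<rbrakk> \<Longrightarrow> z + s *\<^sub>R e \<notin> closure \<Omega>"
      "\<And>z s. \<lbrakk>z \<in> frontier \<Omega>; z \<in> G; 0 < s; z - s *\<^sub>R e \<in> G\<rbrakk> \<Longrightarrow> z - s *\<^sub>R e \<in> \<Omega>"
    and fin: "hausdorff_outer (DIM('a) - 1) (frontier \<Omega> \<inter> G) < \<infinity>"
    and u: "\<And>n. continuous_on (closure \<Omega>) (u n)" and V: "\<And>n i. i \<in> Basis \<Longrightarrow> weak_dir \<Omega> (u n) i (V n i)"
    and su: "(\<Sum>n. \<integral>\<^sup>+x. indicator (\<Omega> \<inter> G) x * ennreal \<bar>u n x\<bar> \<partial>lborel) < \<infinity>"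
    and sV: "\<And>i. i \<in> Basis \<Longrightarrow> (\<Sum>n. \<integral>\<^sup>+x. indicator (\<Omega> \<inter> G) x * ennreal \<bar>V n i x\<bar> \<partial>lborel) < \<infinity>"
  shows "hausdorff_outer (DIM('a) - 1) {z \<in> frontier \<Omega> \<inter> G. \<not> (\<lambda>n. u n z) \<longlonglongrightarrow> 0} = 0"
proof -
  let ?\<Gamma> = "frontier \<Omega>" and ?m = "DIM('a) - 1"
  define B where "B = {z \<in> ?\<Gamma> \<inter> G. (\<lambda>n. u n z) \<longlonglongrightarrow> 0}"
  define E where "E = {z \<in> ?\<Gamma> \<inter> G. \<not> (\<lambda>n. u n z) \<longlonglongrightarrow> 0}"
  have \<Gamma>m [measurable]: "?\<Gamma> \<in> sets borel" by (simp add: borel_closed frontier_closed)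
  have [measurable]: "G \<in> sets borel" using G by simp
  have [measurable]: "(\<lambda>x. indicator ?\<Gamma> x *\<^sub>R u n x) \<in> borel_measurable borel" for n
    by (rule borel_measurable_continuous_on_indicator[OF \<Gamma>m])
      (auto intro: continuous_on_subset[OF u] simp: frontier_def)
  have Bm: "B \<in> sets borel"
  proof -
    have "B = ?\<Gamma> \<inter> G \<inter> {x. \<forall>k::nat. \<exists>N. \<forall>n. N \<le> n \<longrightarrow> \<bar>indicator ?\<Gamma> x *\<^sub>R u n x\<bar> < 1 / real (Suc k)}"
      by (auto simp: B_def LIMSEQ_0_iff_nat)
    moreover have "{x. \<forall>k::nat. \<exists>N. \<forall>n. N \<le> n \<longrightarrow> \<bar>indicator ?\<Gamma> x *\<^sub>R u n x\<bar> < 1 / real (Suc k)} \<in> sets borel"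
      by measurable
    ultimately show ?thesis by (simp only:) (intro sets.Int \<Gamma>m \<open>G \<in> sets borel\<close>)
  qed
  have "E = ?\<Gamma> \<inter> G - B" by (auto simp: E_def B_def)
  then have Em: "E \<in> sets borel" using Bm by auto
  have finB: "hausdorff_outer ?m B < \<infinity>" and finE: "hausdorff_outer ?m E < \<infinity>"
    using hausdorff_outer_mono[of B "?\<Gamma> \<inter> G" ?m] hausdorff_outer_mono[of E "?\<Gamma> \<inter> G" ?m] fin
    by (auto simp: B_def E_def intro: le_less_trans)
  let ?ends = "\<lambda>i x. \<forall>\<alpha> \<beta>. \<alpha> < \<beta> \<longrightarrow> (\<forall>\<tau>\<in>{\<alpha><..<\<beta>}. x + \<tau> *\<^sub>R i \<in> \<Omega> \<inter> G) \<longrightarrow>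
      (\<forall>\<gamma>\<in>{\<alpha>, \<beta>}. (\<lambda>n. u n (x + \<gamma> *\<^sub>R i)) \<longlonglongrightarrow> 0)"
  have "\<exists>N. i \<in> Basis \<longrightarrow> N \<in> null_sets lborel \<and> (\<forall>x. x \<notin> N \<longrightarrow> ?ends i x)" for i
  proof (cases "i \<in> Basis")
    case True
    define P where "P x \<longleftrightarrow> ?ends i x" for x
    have "AE x in lborel. P x"
      unfolding P_def using \<Omega> G
      by (intro null_sequence_at_line_ends[where V="\<lambda>n. V n i", OF True \<Omega> _ _ u V[OF True] su sV[OF True]]) auto
    then obtain N where "N \<in> null_sets lborel" "{x. \<not> P x} \<subseteq> N"
      unfolding eventually_ae_filter by auto
    then have "N \<in> null_sets lborel \<and> (\<forall>x. x \<notin> N \<longrightarrow> P x)" by blast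
    then show ?thesis unfolding P_def by blast
  qed simp
  then have "\<forall>i. \<exists>N. i \<in> Basis \<longrightarrow> N \<in> null_sets lborel \<and> (\<forall>x. x \<notin> N \<longrightarrow> ?ends i x)" by (rule allI)
  from choice[OF this] obtain N where "\<forall>i. i \<in> Basis \<longrightarrow> N i \<in> null_sets lborel \<and> (\<forall>x. x \<notin> N i \<longrightarrow> ?ends i x)" ..
  then have N: "\<And>i. i \<in> Basis \<Longrightarrow> N i \<in> null_sets lborel" "\<And>i x. i \<in> Basis \<Longrightarrow> x \<notin> N i \<Longrightarrow> ?ends i x"
    by blast+
  have front: "z \<in> ?\<Gamma>" if "z \<in> closure \<Omega>" "z \<notin> \<Omega>" for z
    using that \<Omega> by (simp add: frontier_def interior_open)
  have cross: "\<exists>\<tau>\<in>closed_segment 0 s. x + \<tau> *\<^sub>R i \<in> B"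
    if i: "i \<in> Basis" and xN: "x \<notin> N i" and seg: "closed_segment x (x + s *\<^sub>R i) \<subseteq> G"
      and PP: "(x \<in> \<Omega>) \<noteq> (x + s *\<^sub>R i \<in> \<Omega>)" for i x s
  proof -
    define a b where "a = min 0 s" and "b = max 0 s"
    have cs: "closed_segment 0 s = {a..b}" by (auto simp: closed_segment_eq_real_ivl a_def b_def)
    let ?\<phi> = "\<lambda>\<tau>. x + \<tau> *\<^sub>R i"
    have c\<phi>: "continuous_on X ?\<phi>" for X by (intro continuous_intros)
    have inG: "?\<phi> \<tau> \<in> G" if "\<tau> \<in> {a..b}" for \<tau>
    proof -
      have "\<tau> \<in> closed_segment 0 s" using that cs by simp
      then have "?\<phi> \<tau> \<in> closed_segment x (x + s *\<^sub>R i)"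
        unfolding in_segment by (force simp: algebra_simps)
      then show ?thesis using seg by blast
    qed
    have "s \<noteq> 0" using PP by auto
    then have ab: "a < b" by (auto simp: a_def b_def)
    have ends: "(?\<phi> a \<in> \<Omega>) \<noteq> (?\<phi> b \<in> \<Omega>)" using PP by (cases "0 \<le> s") (auto simp: a_def b_def)
    \<comment> \<open>The parameters outside \<open>\<Omega>\<close>, a closed set. If the lower end
      lies in \<open>\<Omega>\<close>, the infimum is the first exit; otherwise the upper end does,
      and the supremum is the last entrance.\<close>
    define Y where "Y = {a..b} \<inter> ?\<phi> -` (- \<Omega>)"
    have Yc: "closed Y" unfolding Y_def
      using \<Omega> by (intro continuous_closed_preimage c\<phi>) auto
    have Yb: "bdd_below Y" "bdd_above Y" by (auto simp: Y_def)
    have "a \<in> Y \<or> b \<in> Y" using ends ab by (auto simp: Y_def)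
    then have Yne: "Y \<noteq> {}" by blast
    have hit: "?\<phi> \<gamma> \<in> B" if JJ: "\<alpha> < \<beta>" "a \<le> \<alpha>" "\<beta> \<le> b" "\<And>\<tau>. \<alpha> < \<tau> \<Longrightarrow> \<tau> < \<beta> \<Longrightarrow> ?\<phi> \<tau> \<in> \<Omega>"
      and \<gamma>: "\<gamma> \<in> {\<alpha>, \<beta>}" "?\<phi> \<gamma> \<notin> \<Omega>" for \<alpha> \<beta> \<gamma>
    proof -
      have "?\<phi> \<tau> \<in> \<Omega> \<inter> G" if "\<tau> \<in> {\<alpha><..<\<beta>}" for \<tau> using JJ inG that by auto
      then have lim: "(\<lambda>n. u n (?\<phi> \<gamma>)) \<longlonglongrightarrow> 0" using N(2)[OF i xN] JJ(1) \<gamma>(1) by blast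
      have "?\<phi> ` closure {\<alpha><..<\<beta>} \<subseteq> closure \<Omega>"
        by (rule image_closure_subset[OF c\<phi>]) (use JJ(4) closure_subset[of \<Omega>] in auto)
      moreover have "\<gamma> \<in> closure {\<alpha><..<\<beta>}" using \<gamma>(1) JJ(1) by auto
      ultimately have "?\<phi> \<gamma> \<in> closure \<Omega>" by blast
      then have "?\<phi> \<gamma> \<in> ?\<Gamma>" using \<gamma>(2) by (rule front)
      moreover have "?\<phi> \<gamma> \<in> G" using \<gamma>(1) JJ by (intro inG) auto
      ultimately show ?thesis using lim by (simp add: B_def)
    qed
    show ?thesis
    proof (cases "?\<phi> a \<in> \<Omega>")
      case True
      define \<beta> where "\<beta> = Inf Y"
      have \<beta>Y: "\<beta> \<in> Y" unfolding \<beta>_def by (rule closed_contains_Inf[OF Yne Yb(1) Yc])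
      have lo: "\<beta> \<le> \<tau>" if "\<tau> \<in> Y" for \<tau> unfolding \<beta>_def by (rule cInf_lower[OF that Yb(1)])
      have "\<beta> \<noteq> a" using \<beta>Y True by (auto simp: Y_def)
      then have a\<beta>: "a < \<beta>" "\<beta> \<le> b" "?\<phi> \<beta> \<notin> \<Omega>" using \<beta>Y by (auto simp: Y_def)
      have "?\<phi> \<tau> \<in> \<Omega>" if "a < \<tau>" "\<tau> < \<beta>" for \<tau>
        using lo[of \<tau>] that a\<beta> by (auto simp: Y_def)
      then have "?\<phi> \<beta> \<in> B" using a\<beta> by (intro hit[of a \<beta>]) auto
      then show ?thesis using a\<beta> cs by (intro bexI[of _ \<beta>]) auto
    next
      case False
      then have "?\<phi> b \<in> \<Omega>" using ends by simp
      define \<alpha> where "\<alpha> = Sup Y"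
      have \<alpha>Y: "\<alpha> \<in> Y" unfolding \<alpha>_def by (rule closed_contains_Sup[OF Yne Yb(2) Yc])
      have up: "\<tau> \<le> \<alpha>" if "\<tau> \<in> Y" for \<tau> unfolding \<alpha>_def by (rule cSup_upper[OF that Yb(2)])
      have "\<alpha> \<noteq> b" using \<alpha>Y \<open>?\<phi> b \<in> \<Omega>\<close> by (auto simp: Y_def)
      then have a\<alpha>: "a \<le> \<alpha>" "\<alpha> < b" "?\<phi> \<alpha> \<notin> \<Omega>" using \<alpha>Y by (auto simp: Y_def)
      have "?\<phi> \<tau> \<in> \<Omega>" if "\<alpha> < \<tau>" "\<tau> < b" for \<tau>
        using up[of \<tau>] that a\<alpha> by (auto simp: Y_def)
      then have "?\<phi> \<alpha> \<in> B" using a\<alpha> by (intro hit[of \<alpha> b]) auto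
      then show ?thesis using a\<alpha> cs by (intro bexI[of _ \<alpha>]) auto
    qed
  qed
  have "hausdorff_outer ?m E = 0"
  proof (rule hausdorff_null_if_compact_null[OF Em finE])
    fix K assume K: "compact K" "K \<subseteq> E"
    have KG: "K \<subseteq> G" "K \<inter> B = {}" "K \<subseteq> ?\<Gamma>" using K(2) by (auto simp: E_def B_def)
    show "hausdorff_outer ?m K = 0"
    proof (rule hausdorff_null_of_crossings[OF e _ K(1) G KG(1) Bm finB KG(2) N(1) cross down])
      show "\<Omega> \<in> sets borel" using \<Omega> by simp
      show "z + s *\<^sub>R e \<in> interior (- \<Omega>)" if "z \<in> K" "0 < s" "z + s *\<^sub>R e \<in> G" for z s
        using graph(1)[of z s] that KG by (auto simp: interior_complement)
      show "z - s *\<^sub>R e \<in> interior \<Omega>" if "z \<in> K" "0 < s" "z - s *\<^sub>R e \<in> G" for z s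
        using graph(2)[of z s] that KG \<Omega> by (auto simp: interior_open)
    qed
  qed
  then show ?thesis by (simp add: E_def)
qed

section \<open>Local coordinates and the conclusion\<close>

lemma summable_subsequence_ennreal:
  fixes X :: "nat \<Rightarrow> ennreal"
  assumes "X \<longlonglongrightarrow> 0"
  obtains s where "strict_mono s" "(\<Sum>k. X (s k)) < \<infinity>"
proof -
  have "\<exists>N. \<forall>n\<ge>N. X n < ennreal ((1/2) ^ k)" for k
    using order_tendstoD(2)[OF assms, of "ennreal ((1/2) ^ k)"] by (simp add: eventually_sequentially)
  then obtain N where N: "\<And>k n. N k \<le> n \<Longrightarrow> X n < ennreal ((1/2) ^ k)" by metis
  \<comment> \<open>\<open>s k\<close> is at least \<open>N k\<close> and exceeds its predecessor,
    so the terms are dominated by a geometric series.\<close>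
  define s where "s = rec_nat (N 0) (\<lambda>k m. max (N (Suc k)) (Suc m))"
  have s_Suc: "s (Suc k) = max (N (Suc k)) (Suc (s k))" for k by (simp add: s_def)
  have s: "strict_mono s" by (auto simp: strict_mono_Suc_iff s_Suc less_max_iff_disj)
  have "N k \<le> s k" for k by (cases k) (simp_all add: s_Suc, simp add: s_def)
  then have "(\<Sum>k. X (s k)) \<le> (\<Sum>k. ennreal ((1/2) ^ k))"
    using N by (intro suminf_le) (auto simp: less_imp_le)
  also have "\<dots> = ennreal (1 / (1 - 1/2))"
    by (rule suminf_ennreal_eq[OF _ geometric_sums]) auto
  also have "\<dots> < \<infinity>" by simp
  finally have "(\<Sum>k. X (s k)) < \<infinity>" .
  then show ?thesis by (rule that[OF s])
qed

text \<open>Turns the chart into three statements about moving along \<open>e\<close> in a ball of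
  local coordinates, the form in which the graph enters the measure-theoretic argument. Boundary
  points in the chart satisfy \<open>y \<bullet> e = g (\<pi> y)\<close>, so a point strictly above
  one is neither in \<open>\<Omega>\<close> nor on the boundary.\<close>

lemma subgraph_near_coordinates:
  fixes \<Omega> :: "'a::euclidean_space set"
  assumes \<Omega>: "open \<Omega>" and sg: "subgraph_near \<Omega> z"
  obtains Q :: "'a \<Rightarrow> 'a" and a e y0 and \<rho> :: real
  where "orthogonal_transformation Q" "e \<in> Basis" "a + Q y0 = z" "0 < \<rho>"
    "\<And>y s. \<lbrakk>y \<in> ball y0 \<rho>; a + Q y \<in> \<Omega>; 0 \<le> s; y - s *\<^sub>R e \<in> ball y0 \<rho>\<rbrakk> \<Longrightarrow> a + Q (y - s *\<^sub>R e) \<in> \<Omega>"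
    "\<And>y s. \<lbrakk>y \<in> ball y0 \<rho>; a + Q y \<in> frontier \<Omega>; 0 < s; y + s *\<^sub>R e \<in> ball y0 \<rho>\<rbrakk> \<Longrightarrow> a + Q (y + s *\<^sub>R e) \<notin> closure \<Omega>"
    "\<And>y s. \<lbrakk>y \<in> ball y0 \<rho>; a + Q y \<in> frontier \<Omega>; 0 < s; y - s *\<^sub>R e \<in> ball y0 \<rho>\<rbrakk> \<Longrightarrow> a + Q (y - s *\<^sub>R e) \<in> \<Omega>"
proof -
  obtain Q a c r H e g where e: "e \<in> Basis" and Q: "orthogonal_transformation Q"
    and zR: "z \<in> (\<lambda>y. a + Q y) ` {x + t *\<^sub>R e |x t. x \<in> base_cube e c r \<and> - H < t \<and> t < H}"
    and R\<Omega>: "(\<lambda>y. a + Q y) ` {x + t *\<^sub>R e |x t. x \<in> base_cube e c r \<and> - H < t \<and> t < H} \<inter> \<Omega>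
      = (\<lambda>y. a + Q y) ` {x + t *\<^sub>R e |x t. x \<in> base_cube e c r \<and> - H < t \<and> t < H \<and> t < (g :: 'a \<Rightarrow> real) x}"
    and R\<Gamma>: "(\<lambda>y. a + Q y) ` {x + t *\<^sub>R e |x t. x \<in> base_cube e c r \<and> - H < t \<and> t < H} \<inter> frontier \<Omega>
      = (\<lambda>y. a + Q y) ` {x + g x *\<^sub>R e |x. x \<in> base_cube e c r}"
    using sg unfolding subgraph_near_def Let_def by (elim exE bexE conjE) (rule that)
  define T where "T y = a + Q y" for y
  define D where "D = {x + t *\<^sub>R e |x t. x \<in> base_cube e c r \<and> - H < t \<and> t < H}"
  have "inj Q" using orthogonal_transformation_inj[OF Q] .
  then have T_eq: "T x = T y \<longleftrightarrow> x = y" for x y by (auto simp: T_def inj_def)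
  note zR' = zR[folded T_def D_def] and R\<Omega>' = R\<Omega>[folded T_def D_def] and R\<Gamma>' = R\<Gamma>[folded T_def D_def]
  define \<pi> where "\<pi> y = y - (y \<bullet> e) *\<^sub>R e" for y
  have base: "x \<bullet> e = 0" if "x \<in> base_cube e c r" for x using that by (simp add: base_cube_def)
  have ee: "e \<bullet> e = 1" using e by simp
  have \<pi>_add: "\<pi> (x + t *\<^sub>R e) = x" "(x + t *\<^sub>R e) \<bullet> e = t" if "x \<in> base_cube e c r" for x t
    using base[OF that] by (simp_all add: \<pi>_def inner_add_left ee)
  have D_iff: "y \<in> D \<longleftrightarrow> \<pi> y \<in> base_cube e c r \<and> - H < y \<bullet> e \<and> y \<bullet> e < H" for y
  proof
    assume "y \<in> D"
    then show "\<pi> y \<in> base_cube e c r \<and> - H < y \<bullet> e \<and> y \<bullet> e < H"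
      using \<pi>_add by (auto simp: D_def)
  next
    assume "\<pi> y \<in> base_cube e c r \<and> - H < y \<bullet> e \<and> y \<bullet> e < H"
    then show "y \<in> D" unfolding D_def
      by (intro CollectI exI[of _ "\<pi> y"] exI[of _ "y \<bullet> e"]) (simp add: \<pi>_def)
  qed
  have in\<Omega>: "T y \<in> \<Omega> \<longleftrightarrow> y \<bullet> e < g (\<pi> y)" if y: "y \<in> D" for y
  proof
    assume "T y \<in> \<Omega>"
    then have "T y \<in> T ` D \<inter> \<Omega>" using y by blast
    then obtain x t where "T y = T (x + t *\<^sub>R e)" "x \<in> base_cube e c r" "t < g x"
      unfolding R\<Omega>' by blast
    then show "y \<bullet> e < g (\<pi> y)" using \<pi>_add by (auto simp: T_eq)
  next
    assume l: "y \<bullet> e < g (\<pi> y)"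
    have "y = \<pi> y + (y \<bullet> e) *\<^sub>R e" by (simp add: \<pi>_def)
    then have "T y \<in> T ` {x + t *\<^sub>R e |x t. x \<in> base_cube e c r \<and> - H < t \<and> t < H \<and> t < g x}"
      using l y[unfolded D_iff] by blast
    then show "T y \<in> \<Omega>" unfolding R\<Omega>'[symmetric] by blast
  qed
  have in\<Gamma>: "y \<bullet> e = g (\<pi> y)" if y: "y \<in> D" "T y \<in> frontier \<Omega>" for y
  proof -
    have "T y \<in> T ` D \<inter> frontier \<Omega>" using y by blast
    then obtain x where "T y = T (x + g x *\<^sub>R e)" "x \<in> base_cube e c r" unfolding R\<Gamma>' by blast
    then show ?thesis using \<pi>_add by (auto simp: T_eq)
  qed
  have \<pi>_shift: "\<pi> (y + s *\<^sub>R e) = \<pi> y" "\<pi> (y - s *\<^sub>R e) = \<pi> y" "(y + s *\<^sub>R e) \<bullet> e = y \<bullet> e + s" "(y - s *\<^sub>R e) \<bullet> e = y \<bullet> e - s" for y s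
    by (simp_all add: \<pi>_def inner_add_left inner_diff_left ee algebra_simps)
  \<comment> \<open>Written as a finite intersection of open slabs, the chart domain is seen to be
    open, so it contains a ball around the coordinates of \<open>z\<close>.\<close>
  have "D = (\<Inter>b\<in>Basis - {e}. {y. \<bar>y \<bullet> b - c \<bullet> b\<bar> < r}) \<inter> {y. - H < y \<bullet> e} \<inter> {y. y \<bullet> e < H}"
  proof (rule set_eqI)
    fix y
    have "\<pi> y \<bullet> b = y \<bullet> b" if "b \<in> Basis - {e}" for b
      using that e by (auto simp: \<pi>_def inner_diff_left inner_Basis)
    then have "\<pi> y \<in> base_cube e c r \<longleftrightarrow> (\<forall>b\<in>Basis - {e}. \<bar>y \<bullet> b - c \<bullet> b\<bar> < r)"
      by (simp add: base_cube_def) (simp add: \<pi>_def inner_diff_left ee)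
    then show "y \<in> D \<longleftrightarrow> y \<in> (\<Inter>b\<in>Basis - {e}. {y. \<bar>y \<bullet> b - c \<bullet> b\<bar> < r}) \<inter> {y. - H < y \<bullet> e} \<inter> {y. y \<bullet> e < H}"
      by (auto simp: D_iff)
  qed
  moreover have "open \<dots>"
    by (intro open_Int open_INT ballI open_Collect_less continuous_intros) auto
  ultimately have "open D" by simp
  obtain y0 where y0: "y0 \<in> D" "z = T y0" using zR' by blast
  obtain \<rho> where \<rho>: "0 < \<rho>" "ball y0 \<rho> \<subseteq> D" using \<open>open D\<close> y0(1) open_contains_ball by blast
  show ?thesis
  proof (rule that[OF Q e _ \<rho>(1)])
    show "a + Q y0 = z" using y0 by (simp add: T_def)
    show "a + Q (y - s *\<^sub>R e) \<in> \<Omega>"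
      if "y \<in> ball y0 \<rho>" "a + Q y \<in> \<Omega>" "0 \<le> s" "y - s *\<^sub>R e \<in> ball y0 \<rho>" for y s
    proof -
      have "y \<in> D" "y - s *\<^sub>R e \<in> D" using that \<rho>(2) by blast+
      then show ?thesis using in\<Omega>[of y] in\<Omega>[of "y - s *\<^sub>R e"] that by (simp add: T_def \<pi>_shift)
    qed
    show "a + Q (y - s *\<^sub>R e) \<in> \<Omega>"
      if "y \<in> ball y0 \<rho>" "a + Q y \<in> frontier \<Omega>" "0 < s" "y - s *\<^sub>R e \<in> ball y0 \<rho>" for y s
    proof -
      have "y \<in> D" "y - s *\<^sub>R e \<in> D" using that \<rho>(2) by blast+
      then show ?thesis using in\<Gamma>[of y] in\<Omega>[of "y - s *\<^sub>R e"] that by (simp add: T_def \<pi>_shift)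
    qed
    show "a + Q (y + s *\<^sub>R e) \<notin> closure \<Omega>"
      if "y \<in> ball y0 \<rho>" "a + Q y \<in> frontier \<Omega>" "0 < s" "y + s *\<^sub>R e \<in> ball y0 \<rho>" for y s
    proof -
      have D: "y \<in> D" "y + s *\<^sub>R e \<in> D" using that \<rho>(2) by blast+
      have ye: "y \<bullet> e = g (\<pi> y)" using in\<Gamma>[of y] D that by (simp add: T_def)
      have "T (y + s *\<^sub>R e) \<notin> \<Omega>" using in\<Omega>[OF D(2)] ye that(3) by (simp add: \<pi>_shift)
      moreover have "T (y + s *\<^sub>R e) \<notin> frontier \<Omega>" using in\<Gamma>[OF D(2)] ye that(3) by (auto simp: \<pi>_shift)
      ultimately show ?thesis using \<Omega> by (simp add: T_def frontier_def interior_open)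
    qed
  qed
qed

text \<open>Along a subsequence the boundary values converge almost everywhere to
  \<open>\<phi>\<close> near \<open>z\<close>, by convergence in \<open>L^1\<close>; along a further
  one the integrals of the functions and their derivatives are summable, and the boundary values
  tend to 0 almost everywhere. The two limits coincide.\<close>

lemma approximative_trace_zero_locally:
  fixes \<Omega> :: "'a::euclidean_space set" and f :: "nat \<Rightarrow> 'a \<Rightarrow> real"
  assumes \<Omega>: "open \<Omega>" and cb: "continuous_boundary \<Omega>" and p: "1 \<le> p" and z: "z \<in> bd_loc \<Omega>"
    and \<phi>: "L1loc_bd \<Omega> \<phi>" and W: "\<And>n. in_W1p p \<Omega> (f n)" and c: "\<And>n. continuous_on (closure \<Omega>) (f n)"
    and L: "\<And>n. L1loc_bd \<Omega> (f n)" and lim: "(\<lambda>n. W1p_norm p \<Omega> (f n)) \<longlonglongrightarrow> 0" and tr: "L1loc_bd_tendsto \<Omega> f \<phi>"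
  shows "\<exists>\<delta>>0. AE x in surface_measure. x \<in> frontier \<Omega> \<inter> ball z \<delta> \<longrightarrow> \<phi> x = 0"
proof -
  let ?m = "DIM('a) - 1"
  have z\<Gamma>: "z \<in> frontier \<Omega>" using z by (simp add: bd_loc_def)
  obtain r0 where r0: "0 < r0" "hausdorff_outer ?m (frontier \<Omega> \<inter> ball z r0) < \<infinity>"
    using z by (auto simp: bd_loc_def)
  have sg: "subgraph_near \<Omega> z" using cb z\<Gamma> by (simp add: continuous_boundary_def)
  obtain Q :: "'a \<Rightarrow> 'a" and a e y0 \<rho>1
    where Q: "orthogonal_transformation Q" and e: "e \<in> Basis" and y0: "a + Q y0 = z" and \<rho>1: "0 < \<rho>1"
    and down: "\<And>y s. \<lbrakk>y \<in> ball y0 \<rho>1; a + Q y \<in> \<Omega>; 0 \<le> s; y - s *\<^sub>R e \<in> ball y0 \<rho>1\<rbrakk> \<Longrightarrow> a + Q (y - s *\<^sub>R e) \<in> \<Omega>"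
    and g1: "\<And>y s. \<lbrakk>y \<in> ball y0 \<rho>1; a + Q y \<in> frontier \<Omega>; 0 < s; y + s *\<^sub>R e \<in> ball y0 \<rho>1\<rbrakk> \<Longrightarrow> a + Q (y + s *\<^sub>R e) \<notin> closure \<Omega>"
    and g2: "\<And>y s. \<lbrakk>y \<in> ball y0 \<rho>1; a + Q y \<in> frontier \<Omega>; 0 < s; y - s *\<^sub>R e \<in> ball y0 \<rho>1\<rbrakk> \<Longrightarrow> a + Q (y - s *\<^sub>R e) \<in> \<Omega>"
    by (rule subgraph_near_coordinates[OF \<Omega> sg]) (rule that)
  \<comment> \<open>Half of \<open>r0\<close>, so that the closed ball in \<open>K0\<close> below
    still lies in the ball where the boundary has finite measure.\<close>
  define \<rho> where "\<rho> = min \<rho>1 (r0 / 2)"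
  have \<rho>: "0 < \<rho>" "\<rho> \<le> \<rho>1" "\<rho> < r0" using \<rho>1 r0(1) by (auto simp: \<rho>_def)
  have sub: "y \<in> ball y0 \<rho>1" if "y \<in> ball y0 \<rho>" for y using that \<rho>(2) by auto
  define T where "T y = a + Q y" for y
  have lQ: "linear Q" using Q by (simp add: orthogonal_transformation_def)
  have dT: "dist (T x) (T y) = dist x y" for x y
  proof -
    have "Q x - Q y = Q (x - y)" using lQ by (simp add: linear_diff)
    then show ?thesis using Q by (simp add: T_def dist_norm orthogonal_transformation)
  qed
  have bQ: "bij Q" by (rule orthogonal_transformation_bij[OF Q])
  have T_surj: "\<exists>y. T y = x" for x
    using bij_is_surj[OF bQ] by (intro exI[of _ "inv Q (x - a)"]) (simp add: T_def surj_f_inv_f)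
  have cT: "continuous_on X T" for X
    unfolding continuous_on_iff using dT by metis
  have [measurable]: "T \<in> borel_measurable borel" by (intro borel_measurable_continuous_onI cT)
  have TT: "distr lborel borel T = (lborel :: 'a measure)"
    unfolding T_def[abs_def] by (rule lborel_distr_rigid[OF Q])
  define \<Omega>' where "\<Omega>' = T -` \<Omega>"
  have \<Omega>'o: "open \<Omega>'" unfolding \<Omega>'_def by (rule open_vimage[OF \<Omega> cT])
  have cl: "closure \<Omega>' = T -` closure \<Omega>"
  proof (rule set_eqI)
    fix y
    show "y \<in> closure \<Omega>' \<longleftrightarrow> y \<in> T -` closure \<Omega>"
      unfolding \<Omega>'_def vimage_eq closure_approachable
      by (metis (no_types, lifting) T_surj dT vimage_eq)
  qed
  have fr: "frontier \<Omega>' = T -` frontier \<Omega>"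
    using \<Omega> \<Omega>'o by (auto simp: frontier_def interior_open cl) (simp_all add: \<Omega>'_def)
  define S where "S = \<Omega> \<inter> ball z \<rho>"
  have So: "open S" using \<Omega> by (auto simp: S_def)
  have S: "S \<in> sets borel" "S \<subseteq> \<Omega>" "bounded S"
    using So bounded_subset[OF bounded_ball, of S z \<rho>] by (auto simp: S_def)
  have ballT: "y \<in> ball y0 \<rho> \<longleftrightarrow> T y \<in> ball z \<rho>" for y
    using dT[of y0 y] y0 by (simp add: T_def)
  have S': "\<Omega>' \<inter> ball y0 \<rho> = T -` S" using ballT by (auto simp: \<Omega>'_def S_def)
  have c\<Omega>: "continuous_on \<Omega> (f n)" for n using continuous_on_subset[OF c closure_subset] .
  obtain V where V: "\<And>n b. b \<in> Basis \<Longrightarrow> weak_dir \<Omega> (f n) b (V n b)"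
    and limf: "(\<lambda>n. \<integral>\<^sup>+x. indicator S x * ennreal \<bar>f n x\<bar> \<partial>lborel) \<longlonglongrightarrow> 0"
    and limV: "\<And>b. b \<in> Basis \<Longrightarrow> (\<lambda>n. \<integral>\<^sup>+x. indicator S x * ennreal \<bar>V n b x\<bar> \<partial>lborel) \<longlonglongrightarrow> 0"
    by (rule sobolev_null_sequence[OF \<Omega> p W c\<Omega> lim S]) (rule that)
  define K0 where "K0 = frontier \<Omega> \<inter> cball z \<rho>"
  have K0c: "compact K0" unfolding K0_def by (intro closed_Int_compact frontier_closed compact_cball)
  have K0loc: "K0 \<subseteq> bd_loc \<Omega>"
  proof
    fix x assume x: "x \<in> K0"
    have d: "0 < r0 - dist z x" using x \<rho>(3) by (simp add: K0_def)
    have "ball x (r0 - dist z x) \<subseteq> ball z r0"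
    proof
      fix y assume "y \<in> ball x (r0 - dist z x)"
      then show "y \<in> ball z r0" using dist_triangle[of z y x] by simp
    qed
    then have "hausdorff_outer ?m (frontier \<Omega> \<inter> ball x (r0 - dist z x)) \<le> hausdorff_outer ?m (frontier \<Omega> \<inter> ball z r0)"
      by (intro hausdorff_outer_mono) blast
    also note r0(2)
    finally show "x \<in> bd_loc \<Omega>" using d x unfolding bd_loc_def
      by (intro CollectI conjI exI[of _ "r0 - dist z x"]) (auto simp: K0_def)
  qed
  have si: "set_integrable surface_measure K0 h" if "L1loc_bd \<Omega> h" for h
    using that K0c K0loc by (simp add: L1loc_bd_def locally_integrable_def)
  have lim1: "(\<lambda>n. LINT x|surface_measure. norm (indicator K0 x *\<^sub>R (f n x - \<phi> x))) \<longlonglongrightarrow> 0"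
  proof -
    have "(\<lambda>n. LINT x:K0|surface_measure. \<bar>f n x - \<phi> x\<bar>) \<longlonglongrightarrow> 0"
      using tr K0c K0loc by (simp add: L1loc_bd_tendsto_def)
    then show ?thesis by (simp add: set_lebesgue_integral_def abs_mult)
  qed
  have int1: "integrable surface_measure (\<lambda>x. indicator K0 x *\<^sub>R (f n x - \<phi> x))" for n
    using set_integral_diff(1)[OF si[OF L] si[OF \<phi>], of n] by (simp add: set_integrable_def)
  obtain r1 :: "nat \<Rightarrow> nat" where r1: "strict_mono r1"
    and ae1: "AE x in surface_measure. (\<lambda>n. indicator K0 x *\<^sub>R (f (r1 n) x - \<phi> x)) \<longlonglongrightarrow> 0"
    using tendsto_L1_AE_subseq[OF int1 lim1] by blast
  \<comment> \<open>All integrals are added up first, so that one subsequence makes every series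
    converge.\<close>
  define X where "X n = (\<integral>\<^sup>+x. indicator S x * ennreal \<bar>f n x\<bar> \<partial>lborel)
      + (\<Sum>b\<in>Basis. \<integral>\<^sup>+x. indicator S x * ennreal \<bar>V n b x\<bar> \<partial>lborel)" for n
  have "X \<longlonglongrightarrow> 0 + (\<Sum>b\<in>(Basis::'a set). 0)"
    unfolding X_def by (intro tendsto_add limf tendsto_sum limV)
  then have "(\<lambda>n. X (r1 n)) \<longlonglongrightarrow> 0" using LIMSEQ_subseq_LIMSEQ[OF _ r1] by (auto simp: comp_def)
  then obtain r2 where r2: "strict_mono r2" "(\<Sum>k. X (r1 (r2 k))) < \<infinity>"
    by (rule summable_subsequence_ennreal)
  define \<sigma> where "\<sigma> k = r1 (r2 k)" for k
  define u where "u k y = f (\<sigma> k) (T y)" for k y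
  \<comment> \<open>The derivative of the pulled-back function along \<open>i\<close> is the
    derivative along \<open>Q i\<close>, a combination of the partial derivatives.\<close>
  define V' where "V' k i y = (\<Sum>b\<in>Basis. (Q i \<bullet> b) * V (\<sigma> k) b (T y))" for k i y
  have Vm [measurable]: "V n b \<in> borel_measurable borel" if "b \<in> Basis" for n b
    using V[OF that, of n] by (simp add: weak_dir_def)
  have T_subst: "(\<integral>\<^sup>+y. h (T y) \<partial>lborel) = (\<integral>\<^sup>+x. h x \<partial>lborel)" if [measurable]: "h \<in> borel_measurable borel" for h :: "'a \<Rightarrow> ennreal"
    by (subst (2) TT[symmetric]) (simp add: nn_integral_distr)
  have [measurable]: "S \<in> sets borel" by (rule S)
  have fm: "(\<lambda>x. indicator S x * ennreal \<bar>f n x\<bar>) \<in> borel_measurable borel" for n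
  proof -
    have [measurable]: "(\<lambda>x. indicator S x *\<^sub>R f n x) \<in> borel_measurable borel"
      by (rule borel_measurable_continuous_on_indicator[OF S(1) continuous_on_subset[OF c\<Omega> S(2)]])
    have "(\<lambda>x. indicator S x * ennreal \<bar>f n x\<bar>) = (\<lambda>x. ennreal \<bar>indicator S x *\<^sub>R f n x\<bar>)"
      by (auto simp: fun_eq_iff indicator_def)
    moreover have "(\<lambda>x. ennreal \<bar>indicator S x *\<^sub>R f n x\<bar>) \<in> borel_measurable borel" by measurable
    ultimately show ?thesis by (simp only:)
  qed
  have su: "(\<Sum>k. \<integral>\<^sup>+y. indicator (\<Omega>' \<inter> ball y0 \<rho>) y * ennreal \<bar>u k y\<bar> \<partial>lborel) < \<infinity>"
  proof -
    have "(\<integral>\<^sup>+y. indicator (\<Omega>' \<inter> ball y0 \<rho>) y * ennreal \<bar>u k y\<bar> \<partial>lborel) \<le> X (\<sigma> k)" for k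
    proof -
      have "(\<integral>\<^sup>+y. indicator (\<Omega>' \<inter> ball y0 \<rho>) y * ennreal \<bar>u k y\<bar> \<partial>lborel)
          = (\<integral>\<^sup>+y. indicator S (T y) * ennreal \<bar>f (\<sigma> k) (T y)\<bar> \<partial>lborel)"
        unfolding S' u_def by (intro nn_integral_cong) (auto simp: indicator_def)
      also have "\<dots> = (\<integral>\<^sup>+x. indicator S x * ennreal \<bar>f (\<sigma> k) x\<bar> \<partial>lborel)" by (rule T_subst[OF fm])
      also have "\<dots> \<le> X (\<sigma> k)" by (simp add: X_def)
      finally show ?thesis .
    qed
    then have "(\<Sum>k. \<integral>\<^sup>+y. indicator (\<Omega>' \<inter> ball y0 \<rho>) y * ennreal \<bar>u k y\<bar> \<partial>lborel) \<le> (\<Sum>k. X (\<sigma> k))"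
      by (intro suminf_le) auto
    also have "\<dots> < \<infinity>" using r2(2) by (simp add: \<sigma>_def)
    finally show ?thesis .
  qed
  have sV: "(\<Sum>k. \<integral>\<^sup>+y. indicator (\<Omega>' \<inter> ball y0 \<rho>) y * ennreal \<bar>V' k i y\<bar> \<partial>lborel) < \<infinity>" for i
  proof -
    define C where "C = (\<Sum>b\<in>Basis. ennreal \<bar>Q i \<bullet> b\<bar>)"
    have Cfin: "C < \<infinity>" by (simp add: C_def)
    have "(\<integral>\<^sup>+y. indicator (\<Omega>' \<inter> ball y0 \<rho>) y * ennreal \<bar>V' k i y\<bar> \<partial>lborel) \<le> C * X (\<sigma> k)" for k
    proof -
      have "(\<integral>\<^sup>+y. indicator (\<Omega>' \<inter> ball y0 \<rho>) y * ennreal \<bar>V' k i y\<bar> \<partial>lborel)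
          \<le> (\<integral>\<^sup>+y. (\<Sum>b\<in>Basis. ennreal \<bar>Q i \<bullet> b\<bar> * (indicator S (T y) * ennreal \<bar>V (\<sigma> k) b (T y)\<bar>)) \<partial>lborel)"
      proof (rule nn_integral_mono)
        fix y
        have "ennreal \<bar>V' k i y\<bar> \<le> ennreal (\<Sum>b\<in>Basis. \<bar>Q i \<bullet> b\<bar> * \<bar>V (\<sigma> k) b (T y)\<bar>)"
          unfolding V'_def by (intro ennreal_leI order_trans[OF sum_abs]) (simp add: abs_mult)
        also have "\<dots> = (\<Sum>b\<in>Basis. ennreal \<bar>Q i \<bullet> b\<bar> * ennreal \<bar>V (\<sigma> k) b (T y)\<bar>)"
          by (subst sum_ennreal[symmetric]) (auto simp: ennreal_mult)
        finally have "ennreal \<bar>V' k i y\<bar> \<le> (\<Sum>b\<in>Basis. ennreal \<bar>Q i \<bullet> b\<bar> * ennreal \<bar>V (\<sigma> k) b (T y)\<bar>)" .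
        then show "indicator (\<Omega>' \<inter> ball y0 \<rho>) y * ennreal \<bar>V' k i y\<bar>
            \<le> (\<Sum>b\<in>Basis. ennreal \<bar>Q i \<bullet> b\<bar> * (indicator S (T y) * ennreal \<bar>V (\<sigma> k) b (T y)\<bar>))"
          unfolding S' by (cases "T y \<in> S") auto
      qed
      also have "\<dots> = (\<Sum>b\<in>Basis. \<integral>\<^sup>+y. ennreal \<bar>Q i \<bullet> b\<bar> * (indicator S (T y) * ennreal \<bar>V (\<sigma> k) b (T y)\<bar>) \<partial>lborel)"
        by (rule nn_integral_sum) measurable
      also have "\<dots> = (\<Sum>b\<in>Basis. ennreal \<bar>Q i \<bullet> b\<bar> * (\<integral>\<^sup>+x. indicator S x * ennreal \<bar>V (\<sigma> k) b x\<bar> \<partial>lborel))"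
      proof (rule sum.cong[OF refl])
        fix b :: 'a assume [measurable]: "b \<in> Basis"
        have [measurable]: "V (\<sigma> k) b \<in> borel_measurable borel" by (rule Vm) fact
        have "(\<integral>\<^sup>+y. ennreal \<bar>Q i \<bullet> b\<bar> * (indicator S (T y) * ennreal \<bar>V (\<sigma> k) b (T y)\<bar>) \<partial>lborel)
            = ennreal \<bar>Q i \<bullet> b\<bar> * (\<integral>\<^sup>+y. indicator S (T y) * ennreal \<bar>V (\<sigma> k) b (T y)\<bar> \<partial>lborel)"
          by (rule nn_integral_cmult) measurable
        also have "(\<integral>\<^sup>+y. indicator S (T y) * ennreal \<bar>V (\<sigma> k) b (T y)\<bar> \<partial>lborel) = (\<integral>\<^sup>+x. indicator S x * ennreal \<bar>V (\<sigma> k) b x\<bar> \<partial>lborel)"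
          by (rule T_subst[where h="\<lambda>x. indicator S x * ennreal \<bar>V (\<sigma> k) b x\<bar>"]) measurable
        finally show "(\<integral>\<^sup>+y. ennreal \<bar>Q i \<bullet> b\<bar> * (indicator S (T y) * ennreal \<bar>V (\<sigma> k) b (T y)\<bar>) \<partial>lborel)
            = ennreal \<bar>Q i \<bullet> b\<bar> * (\<integral>\<^sup>+x. indicator S x * ennreal \<bar>V (\<sigma> k) b x\<bar> \<partial>lborel)" .
      qed
      also have "\<dots> \<le> (\<Sum>b\<in>Basis. ennreal \<bar>Q i \<bullet> b\<bar> * X (\<sigma> k))"
      proof (intro sum_mono mult_left_mono)
        fix b :: 'a assume b: "b \<in> Basis"
        have "(\<integral>\<^sup>+x. indicator S x * ennreal \<bar>V (\<sigma> k) b x\<bar> \<partial>lborel)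
            \<le> (\<Sum>b\<in>Basis. \<integral>\<^sup>+x. indicator S x * ennreal \<bar>V (\<sigma> k) b x\<bar> \<partial>lborel)"
          using b by (intro member_le_sum) auto
        then show "(\<integral>\<^sup>+x. indicator S x * ennreal \<bar>V (\<sigma> k) b x\<bar> \<partial>lborel) \<le> X (\<sigma> k)"
          by (simp add: X_def add_increasing)
      qed auto
      also have "\<dots> = C * X (\<sigma> k)" by (simp only: C_def sum_distrib_right)
      finally show ?thesis .
    qed
    then have "(\<Sum>k. \<integral>\<^sup>+y. indicator (\<Omega>' \<inter> ball y0 \<rho>) y * ennreal \<bar>V' k i y\<bar> \<partial>lborel) \<le> (\<Sum>k. C * X (\<sigma> k))"
      by (intro suminf_le) auto
    also have "\<dots> = C * (\<Sum>k. X (\<sigma> k))" by simp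
    also have "\<dots> < \<infinity>" using r2(2) Cfin by (simp add: \<sigma>_def ennreal_mult_less_top)
    finally show ?thesis .
  qed
  have wd: "weak_dir \<Omega>' (u k) i (V' k i)" if i: "i \<in> Basis" for k i
    unfolding \<Omega>'_def u_def V'_def T_def
    by (rule weak_dir_pullback[OF Q \<Omega> c\<Omega> i weak_dir_linear[OF \<Omega> c\<Omega> V]])
  have cu: "continuous_on (closure \<Omega>') (u k)" for k
    unfolding u_def cl by (intro continuous_on_compose2[OF c cT]) auto
  have fin: "hausdorff_outer ?m (frontier \<Omega>' \<inter> ball y0 \<rho>) < \<infinity>"
  proof -
    \<comment> \<open>An inverse of \<open>T\<close>, again an isometry; it transports finiteness of
      the boundary measure to local coordinates.\<close>
    define R where "R x = (SOME y. T y = x)" for x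
    have TR: "T (R x) = x" for x unfolding R_def by (rule someI_ex[OF T_surj])
    have dR: "dist (R x) (R y) = dist x y" for x y using dT[of "R x" "R y"] by (simp add: TR)
    have "frontier \<Omega>' \<inter> ball y0 \<rho> \<subseteq> R ` (frontier \<Omega> \<inter> ball z r0)"
    proof
      fix y assume y: "y \<in> frontier \<Omega>' \<inter> ball y0 \<rho>"
      have "dist y (R (T y)) = 0" using dT[of y "R (T y)"] by (simp add: TR)
      then have "y = R (T y)" by simp
      moreover have "T y \<in> frontier \<Omega> \<inter> ball z r0" using y ballT[of y] \<rho>(3) by (auto simp: fr)
      ultimately show "y \<in> R ` (frontier \<Omega> \<inter> ball z r0)" by blast
    qed
    then have "hausdorff_outer ?m (frontier \<Omega>' \<inter> ball y0 \<rho>) \<le> hausdorff_outer ?m (R ` (frontier \<Omega> \<inter> ball z r0))"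
      by (rule hausdorff_outer_mono)
    also have "\<dots> \<le> hausdorff_outer ?m (frontier \<Omega> \<inter> ball z r0)" by (rule hausdorff_outer_isometry[OF dR])
    also note r0(2)
    finally show ?thesis .
  qed
  have "hausdorff_outer ?m {y \<in> frontier \<Omega>' \<inter> ball y0 \<rho>. \<not> (\<lambda>k. u k y) \<longlonglongrightarrow> 0} = 0"
  proof (rule null_sequence_on_graph[OF e \<Omega>'o open_ball _ _ _ fin cu wd su sV])
    show "x - s *\<^sub>R e \<in> \<Omega>'" if "x \<in> \<Omega>'" "x \<in> ball y0 \<rho>" "0 \<le> s" "x - s *\<^sub>R e \<in> ball y0 \<rho>" for x s
      using down[OF sub _ _ sub] that by (simp add: \<Omega>'_def T_def)
    show "x + s *\<^sub>R e \<notin> closure \<Omega>'" if "x \<in> frontier \<Omega>'" "x \<in> ball y0 \<rho>" "0 < s" "x + s *\<^sub>R e \<in> ball y0 \<rho>" for x s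
      using g1[OF sub _ _ sub] that by (simp add: cl fr T_def)
    show "x - s *\<^sub>R e \<in> \<Omega>'" if "x \<in> frontier \<Omega>'" "x \<in> ball y0 \<rho>" "0 < s" "x - s *\<^sub>R e \<in> ball y0 \<rho>" for x s
      using g2[OF sub _ _ sub] that unfolding fr by (simp add: \<Omega>'_def T_def)
  qed
  then have "hausdorff_outer ?m (T ` {y \<in> frontier \<Omega>' \<inter> ball y0 \<rho>. \<not> (\<lambda>k. u k y) \<longlonglongrightarrow> 0}) = 0"
    using hausdorff_outer_isometry[OF dT, of ?m "{y \<in> frontier \<Omega>' \<inter> ball y0 \<rho>. \<not> (\<lambda>k. u k y) \<longlonglongrightarrow> 0}"] by simp
  then have "T ` {y \<in> frontier \<Omega>' \<inter> ball y0 \<rho>. \<not> (\<lambda>k. u k y) \<longlonglongrightarrow> 0} \<in> null_sets surface_measure"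
    by (rule null_sets_hausdorff)
  then have "AE x in surface_measure. x \<notin> T ` {y \<in> frontier \<Omega>' \<inter> ball y0 \<rho>. \<not> (\<lambda>k. u k y) \<longlonglongrightarrow> 0}"
    by (rule AE_not_in)
  with ae1 have "AE x in surface_measure. x \<in> frontier \<Omega> \<inter> ball z \<rho> \<longrightarrow> \<phi> x = 0"
  proof eventually_elim
    case (elim x)
    show ?case
    proof
      assume x: "x \<in> frontier \<Omega> \<inter> ball z \<rho>"
      obtain y where y: "T y = x" using T_surj by blast
      have "y \<in> frontier \<Omega>' \<inter> ball y0 \<rho>" using x y ballT[of y] by (simp add: fr)
      then have "(\<lambda>k. u k y) \<longlonglongrightarrow> 0" using elim(2) y by blast
      then have 0: "(\<lambda>k. f (r1 (r2 k)) x) \<longlonglongrightarrow> 0" by (simp add: u_def y \<sigma>_def)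
      have "x \<in> K0" using x by (auto simp: K0_def)
      then have "(\<lambda>n. f (r1 n) x - \<phi> x) \<longlonglongrightarrow> 0" using elim(1) by simp
      then have "(\<lambda>n. f (r1 n) x) \<longlonglongrightarrow> \<phi> x" by (simp add: LIM_zero_iff)
      then have "(\<lambda>k. f (r1 (r2 k)) x) \<longlonglongrightarrow> \<phi> x" using LIMSEQ_subseq_LIMSEQ[OF _ r2(1)] by (fastforce simp: comp_def)
      with 0 show "\<phi> x = 0" by (rule LIMSEQ_unique[rotated])
    qed
  qed
  with \<rho>(1) show ?thesis by blast
qed

theorem theorem4p11:
  fixes \<Omega> :: "'a::euclidean_space set" and p :: ennreal
  assumes "open \<Omega>" and "\<Omega> \<noteq> {}"
    and "continuous_boundary \<Omega>"
    and "1 \<le> p"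
  shows "unique_approximative_trace p \<Omega>"
  unfolding unique_approximative_trace_def
proof (intro allI impI)
  fix \<phi> :: "'a \<Rightarrow> real"
  assume "approximative_trace p \<Omega> (\<lambda>x. 0) \<phi>"
  then obtain f :: "nat \<Rightarrow> 'a \<Rightarrow> real" where \<phi>: "L1loc_bd \<Omega> \<phi>"
    and f: "\<And>n. in_W1p p \<Omega> (f n)" "\<And>n. continuous_on (closure \<Omega>) (f n)" "\<And>n. L1loc_bd \<Omega> (f n)"
    and lim: "(\<lambda>n. W1p_norm p \<Omega> (f n)) \<longlonglongrightarrow> 0" "L1loc_bd_tendsto \<Omega> f \<phi>"
    unfolding approximative_trace_def by auto
  have "\<forall>z. \<exists>\<delta>. z \<in> bd_loc \<Omega> \<longrightarrow> 0 < \<delta> \<and> (AE x in surface_measure. x \<in> frontier \<Omega> \<inter> ball z \<delta> \<longrightarrow> \<phi> x = 0)"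
    using approximative_trace_zero_locally[OF assms(1,3,4) _ \<phi> f lim] by blast
  from choice[OF this] obtain \<delta> where
    \<delta>: "\<forall>z. z \<in> bd_loc \<Omega> \<longrightarrow> 0 < \<delta> z \<and> (AE x in surface_measure. x \<in> frontier \<Omega> \<inter> ball z (\<delta> z) \<longrightarrow> \<phi> x = 0)" ..
  \<comment> \<open>Countably many of the balls already cover \<open>bd_loc\<close>, so the union of
    their exceptional null sets is null. On \<open>bd_inf\<close> the function vanishes almost
    everywhere by the definition of \<open>L1loc_bd\<close>.\<close>
  obtain \<F> where \<F>: "\<F> \<subseteq> (\<lambda>z. ball z (\<delta> z)) ` bd_loc \<Omega>" "countable \<F>" "\<Union>\<F> = \<Union>((\<lambda>z. ball z (\<delta> z)) ` bd_loc \<Omega>)"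
    using Lindelof[of "(\<lambda>z. ball z (\<delta> z)) ` bd_loc \<Omega>"] by auto
  have "\<forall>B\<in>\<F>. AE x in surface_measure. x \<in> frontier \<Omega> \<inter> B \<longrightarrow> \<phi> x = 0"
    using \<delta> \<F>(1) by blast
  then have "AE x in surface_measure. \<forall>B\<in>\<F>. x \<in> frontier \<Omega> \<inter> B \<longrightarrow> \<phi> x = 0"
    by (simp only: AE_ball_countable[OF \<F>(2)])
  moreover have "AE x in surface_measure. x \<in> bd_inf \<Omega> \<longrightarrow> \<phi> x = 0"
    using \<phi> by (simp add: L1loc_bd_def)
  ultimately show "AE x in surface_measure. x \<in> frontier \<Omega> \<longrightarrow> \<phi> x = 0"
  proof eventually_elim
    case (elim x)
    show ?case
    proof
      assume x: "x \<in> frontier \<Omega>"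
      show "\<phi> x = 0"
      proof (cases "x \<in> bd_loc \<Omega>")
        case True
        then have "x \<in> \<Union>\<F>" unfolding \<F>(3) using \<delta> by (auto intro!: bexI[of _ x])
        then show ?thesis using elim(1) x by blast
      next
        case False
        then show ?thesis using elim(2) x by (simp add: bd_inf_def)
      qed
    qed
  qed
qed

end
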